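(* Let $\Gamma$ be a discrete group, let $\mathcal{C}$ be a strict rigid $\Gamma$-graded C$^*$-tensor category with simple unit, let $\omega\colon\Gamma^3\to\mathbb{T}$ be a normalized $3$-cocycle, and let $\mathcal{C}^\omega$ be the twisted category. Let $\mathscr{X}=\{X_j\}_{j\in\mathcal{J}}$ be a full family of objects adapted to the grading, and let $\mathcal{A}=\mathcal{A}(\mathscr{X})$ be the vector space of the associated annular algebra (the same for $\mathcal{C}$ and $\mathcal{C}^\omega$), with $*$-algebra structure $(\bullet,\#)$ coming from $\mathcal{C}$ and $*$-algebra structure $(\mathbin{\bar\bullet},\star)$ coming from $\mathcal{C}^\omega$. Let $\mathcal{G}=\Gamma\ltimes_{\mathrm{Ad}}\Gamma$ be the action groupoid of the adjoint action and let $\psi$ be the $\mathbb{T}$-valued $2$-cocycle on $\mathcal{G}$ given, for composable $g_1=(s_1,\gamma_1)$, $g_2=(s_2,\gamma_2)$ (so $\gamma_1=s_2\gamma_2s_2^{-1}$), by $$\psi(g_1,g_2)=\omega(s_1\gamma_1s_1^{-1},s_1,s_2)\,\overline{\omega(s_1,\gamma_1,s_2)}\,\omega(s_1,s_2,\gamma_2).$$ Then the $*$-algebra $(\mathcal{A},\mathbin{\bar\bullet},\star)$ is the $2$-cocycle twist by $\psi$ of the Fell bundle $(\mathcal{A},\bullet,\#)=\bigoplus_{g\in\mathcal{G}}\mathcal{A}_g$ over $\mathcal{G}$. That is, for $(g_1,g_2)\in\mathcal{G}^{(2)}$, $a\in\mathcal{A}_{g_1}$, $b\in\mathcal{A}_{g_2}$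 one has $a\mathbin{\bar\bullet}b=\psi(g_1,g_2)\,a\bullet b$ (and $a\mathbin{\bar\bullet}b=0=a\bullet b$ if $g_1,g_2$ are not composable), and $a^\star=\overline{\psi(g^{-1},g)}\,a^\#$ for $a\in\mathcal{A}_g$, $g\in\mathcal{G}$.
   Context: **C$^*$-tensor categories.** C$^*$-categories are small and have finite direct sums and images of projections. A C$^*$-tensor category $\mathcal{C}$ has a C$^*$-bifunctor $\otimes$, a unit object $\mathbb{1}$, unitary natural associators $\alpha_{X,Y,Z}\colon(X\otimes Y)\otimes Z\to X\otimes(Y\otimes Z)$ satisfying the pentagon equation; the unit constraints are identity morphisms and $\mathbb{1}$ is simple ($\dim\mathrm{End}(\mathbb{1})=1$). It is strict if the $\alpha$ are identities. It is rigid if every $X$ has a dual $\bar X$ with $R\colon\mathbb{1}\to\bar X\otimes X$, $\bar R\colon\mathbb{1}\to X\otimes\bar X$ satisfying $(1_{\bar X}\otimes\bar R^* )\alpha_{\bar X,X,\bar X}(R\otimes1_{\bar X})=1_{\bar X}$ and $(1_X\otimes R^* )\alpha_{X,\bar X,X}(\bar R\otimes1_X)=1_X$. A solution is standard, written $(R_X,\bar R_X)$, if $\|R_X\|=\|\bar R_X\|=d(X)^{1/2}$ with $d(X)=\min\|R\|\|\bar R\|$ over all solutions. $\mathcal{I}=\mathrm{Irr}(\mathcal{C})$ is a set of representatives of isomorphism classes of simple objects; $\mathcal{C}(X,Y)$ is the morphism space. **Annular algebra.** For a family $\mathscr{X}=\{X_j\}_{j\in\mathcal{J}}$ (full means every $S\in\mathcal{I}$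 is isomorphic to a subobject of some $X_j$), let $\mathcal{A}_{k,j}$ be the quotient of $\bigoplus_{S\in\mathrm{Obj}(\mathcal{C})}\mathcal{C}(S\otimes X_j,X_k\otimes S)$ by the span of all $f(f'\otimes1_{X_j})-(1_{X_k}\otimes f')f$ with $f\in\mathcal{C}(T\otimes X_j,X_k\otimes S)$, $f'\in\mathcal{C}(S,T)$. Let $\psi^S_{k,j}$ be the restriction of the quotient map to $\mathcal{C}(S\otimes X_j,X_k\otimes S)$, with image $\mathcal{A}^S_{k,j}$. Then $\mathcal{A}_{k,j}=\bigoplus_{S\in\mathcal{I}}\mathcal{A}^S_{k,j}$ and $\psi^S_{k,j}$ is injective for $S\in\mathcal{I}$. Put $\mathcal{A}=\mathcal{A}(\mathscr{X})=\bigoplus_{j,k\in\mathcal J}\mathcal{A}_{k,j}$. The product is $$\psi^S_{m,k}(f)\bullet\psi^T_{k',j}(f')=\delta_{k,k'}\psi^{S\otimes T}_{m,j}\bigl(\alpha_{X_m,S,T}(f\otimes1_T)\alpha_{S,X_k,T}^{-1}(1_S\otimes f')\alpha_{S,T,X_j}\bigr),$$ and the conjugate-linear involution $\#$ sends $\psi^S_{k,j}(f)$ to $$\psi^{\bar S}_{j,k}\Bigl(\bigl(((R_S^*\otimes1_{X_j})\alpha_{\bar S,S,X_j}^{-1})\otimes1_{\bar S}\bigr)\bigl((1_{\bar S}\otimes f^* )\otimes1_{\bar S}\bigr)\alpha_{\bar S,X_k\otimes S,\bar S}^{-1}\bigl(1_{\bar S}\otimes(\alpha_{X_k,S,\bar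 S}^{-1}(1_{X_k}\otimes\bar R_S))\bigr)\Bigr).$$ These are well defined and make $\mathcal{A}$ a $*$-algebra. **Grading and twisting.** $\mathcal{C}$ is $\Gamma$-graded if $\mathcal{C}=\bigoplus_{\gamma\in\Gamma}\mathcal{C}_\gamma$ for mutually orthogonal full subcategories (no nonzero morphisms between different ones; each object is a direct sum of objects from the $\mathcal{C}_\gamma$) with $X\otimes Y$ isomorphic to an object of $\mathcal{C}_{\gamma\eta}$ for $X\in\mathcal{C}_\gamma$, $Y\in\mathcal{C}_\eta$. A normalized $3$-cocycle is $\omega\colon\Gamma^3\to\mathbb{T}=\{z\in\mathbb{C}:|z|=1\}$ with $\omega(\gamma_1,\gamma_2,\gamma_3)\omega(\gamma_1,\gamma_2\gamma_3,\gamma_4)\omega(\gamma_2,\gamma_3,\gamma_4)=\omega(\gamma_1\gamma_2,\gamma_3,\gamma_4)\omega(\gamma_1,\gamma_2,\gamma_3\gamma_4)$ and $\omega(\gamma_1,\gamma_2,\gamma_3)=1$ if some $\gamma_i=e$. $\mathcal{C}^\omega$ is $\mathcal{C}$ with the same C$^*$-category, tensor bifunctor and unit constraints, and with associator $\alpha^\omega_{X_1,X_2,X_3}=\omega(\gamma_1,\gamma_2,\gamma_3)\alpha_{X_1,X_2,X_3}$ for $X_i\in\mathcal{C}_{\gamma_i}$ (extended by direct sums); it is again rigid, and $\mathcal{A}(\mathscr{X})$ formed from it (with its own associators and standard solutions) has the same underlying vector space. **Fell bundle structure.** $\mathscr{X}$ is adapted if each $X_j$ is isomorphic to an object of some $\mathcal{C}_{\gamma_j}$.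 Write $\gamma_S$ for the degree of $S\in\mathcal{I}$. The groupoid $\mathcal{G}=\Gamma\ltimes_{\mathrm{Ad}}\Gamma$ has object set $\Gamma$, arrows $(s,\gamma)\in\Gamma\times\Gamma$ with domain $\gamma$ and codomain $s\gamma s^{-1}$, and composition $(s,\gamma)(t,\eta)=(st,\eta)$ when $\gamma=t\eta t^{-1}$; $\mathcal{G}^{(2)}$ is the set of composable pairs. For $g=(s,\gamma)$ put $\mathcal{A}_g=\bigoplus\mathcal{A}^S_{k,j}$ over $j,k\in\mathcal{J}$, $S\in\mathcal{I}$ with $\gamma_j=\gamma$, $\gamma_k=s\gamma s^{-1}$, $\gamma_S=s$. Then $\mathcal{A}=\bigoplus_{g\in\mathcal{G}}\mathcal{A}_g$, with $\mathcal{A}_g\bullet\mathcal{A}_{g'}\subset\mathcal{A}_{gg'}$ for composable $(g,g')$, products of non-composable components zero, and $(\mathcal{A}_g)^\#=\mathcal{A}_{g^{-1}}$; this is what is meant by a Fell bundle over $\mathcal{G}$. **Twist of a Fell bundle.** For a Fell bundle $A=\bigoplus_gA_g$ over $\mathcal{G}$ and a $\mathbb{T}$-valued $2$-cocycle $\psi$ with $\psi(g_1,g_2)=1$ whenever $g_1$ or $g_2$ is an identity arrow, the twist $A_\psi$ is the copy $\{a^{(\psi)}\}$ of $A$ with $a^{(\psi)}b^{(\psi)}=\psi(g_1,g_2)(ab)^{(\psi)}$ for $a\in A_{g_1}$, $b\in A_{g_2}$, $(g_1,g_2)\in\mathcal{G}^{(2)}$, and $(a^{(\psi)})^*=\overline{\psi(g^{-1},g)}(a^*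 )^{(\psi)}$ for $a\in A_g$. *)

theory Defs
  imports Complex_Main "HOL-Library.Poly_Mapping" "HOL-Algebra.Group"
begin

section \<open>C*-tensor categories\<close>

text \<open>
  All morphism spaces are linear subspaces of one complex vector space of type \<open>'m\<close> (with scalar
  multiplication \<open>smul\<close>), e.g. of the algebraic direct sum of all morphism spaces. Thus the
  operations on morphisms need no object arguments. They are only constrained on the morphism
  spaces, as is the norm. \<open>g \<cdot> f\<close> is composition in the usual order (first \<open>f\<close>),
  \<open>\<boxtimes>\<close> is the tensor product of objects, \<open>\<odot>\<close> that of morphisms and
  \<open>\<iota> X\<close> the identity morphism of \<open>X\<close>. The unit constraints being identities, they do
  not appear in the data.
\<close>

record ('o, 'm) tensor_cat =
  Ob    :: "'o set"
  Hom   :: "'o \<Rightarrow> 'o \<Rightarrow> 'm set"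
  smul  :: "complex \<Rightarrow> 'm \<Rightarrow> 'm"
  idm   :: "'o \<Rightarrow> 'm"  ("\<iota>\<index>")
  comp  :: "'m \<Rightarrow> 'm \<Rightarrow> 'm"  (infixl "\<cdot>\<index>" 70)
  adj   :: "'m \<Rightarrow> 'm"
  cnorm :: "'m \<Rightarrow> real"
  tob   :: "'o \<Rightarrow> 'o \<Rightarrow> 'o"  (infixl "\<boxtimes>\<index>" 75)
  tmor  :: "'m \<Rightarrow> 'm \<Rightarrow> 'm"  (infixl "\<odot>\<index>" 75)
  unito :: "'o"
  assoc :: "'o \<Rightarrow> 'o \<Rightarrow> 'o \<Rightarrow> 'm"

locale cstar_category =
  fixes C :: "('o, 'm::ab_group_add) tensor_cat" (structure)
  assumes vs: "vector_space (smul C)"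
    and Hom_subspace: "\<lbrakk>X \<in> Ob C; Y \<in> Ob C\<rbrakk> \<Longrightarrow> module.subspace (smul C) (Hom C X Y)"
    and idm_in: "X \<in> Ob C \<Longrightarrow> \<iota> X \<in> Hom C X X"
    and comp_in: "\<lbrakk>X \<in> Ob C; Y \<in> Ob C; Z \<in> Ob C; f \<in> Hom C X Y; g \<in> Hom C Y Z\<rbrakk>
          \<Longrightarrow> g \<cdot> f \<in> Hom C X Z"
    and idm_left: "\<lbrakk>X \<in> Ob C; Y \<in> Ob C; f \<in> Hom C X Y\<rbrakk> \<Longrightarrow> \<iota> Y \<cdot> f = f"
    and idm_right: "\<lbrakk>X \<in> Ob C; Y \<in> Ob C; f \<in> Hom C X Y\<rbrakk> \<Longrightarrow> f \<cdot> \<iota> X = f"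
    and comp_assoc: "\<lbrakk>W \<in> Ob C; X \<in> Ob C; Y \<in> Ob C; Z \<in> Ob C;
          f \<in> Hom C W X; g \<in> Hom C X Y; h \<in> Hom C Y Z\<rbrakk> \<Longrightarrow> (h \<cdot> g) \<cdot> f = h \<cdot> (g \<cdot> f)"
    and comp_add_left: "\<lbrakk>X \<in> Ob C; Y \<in> Ob C; Z \<in> Ob C; f \<in> Hom C X Y; g \<in> Hom C Y Z; g' \<in> Hom C Y Z\<rbrakk>
          \<Longrightarrow> (g + g') \<cdot> f = g \<cdot> f + g' \<cdot> f"
    and comp_add_right: "\<lbrakk>X \<in> Ob C; Y \<in> Ob C; Z \<in> Ob C; f \<in> Hom C X Y; f' \<in> Hom C X Y; g \<in> Hom C Y Z\<rbrakk>
          \<Longrightarrow> g \<cdot> (f + f') = g \<cdot> f + g \<cdot> f'"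
    and comp_smul_left: "\<lbrakk>X \<in> Ob C; Y \<in> Ob C; Z \<in> Ob C; f \<in> Hom C X Y; g \<in> Hom C Y Z\<rbrakk>
          \<Longrightarrow> smul C c g \<cdot> f = smul C c (g \<cdot> f)"
    and comp_smul_right: "\<lbrakk>X \<in> Ob C; Y \<in> Ob C; Z \<in> Ob C; f \<in> Hom C X Y; g \<in> Hom C Y Z\<rbrakk>
          \<Longrightarrow> g \<cdot> smul C c f = smul C c (g \<cdot> f)"
    and adj_in: "\<lbrakk>X \<in> Ob C; Y \<in> Ob C; f \<in> Hom C X Y\<rbrakk> \<Longrightarrow> adj C f \<in> Hom C Y X"
    and adj_adj: "\<lbrakk>X \<in> Ob C; Y \<in> Ob C; f \<in> Hom C X Y\<rbrakk> \<Longrightarrow> adj C (adj C f) = f"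
    and adj_add: "\<lbrakk>X \<in> Ob C; Y \<in> Ob C; f \<in> Hom C X Y; g \<in> Hom C X Y\<rbrakk>
          \<Longrightarrow> adj C (f + g) = adj C f + adj C g"
    and adj_smul: "\<lbrakk>X \<in> Ob C; Y \<in> Ob C; f \<in> Hom C X Y\<rbrakk>
          \<Longrightarrow> adj C (smul C c f) = smul C (cnj c) (adj C f)"
    and adj_comp: "\<lbrakk>X \<in> Ob C; Y \<in> Ob C; Z \<in> Ob C; f \<in> Hom C X Y; g \<in> Hom C Y Z\<rbrakk>
          \<Longrightarrow> adj C (g \<cdot> f) = adj C f \<cdot> adj C g"
    and norm_nonneg: "\<lbrakk>X \<in> Ob C; Y \<in> Ob C; f \<in> Hom C X Y\<rbrakk> \<Longrightarrow> 0 \<le> cnorm C f"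
    and norm_eq_0: "\<lbrakk>X \<in> Ob C; Y \<in> Ob C; f \<in> Hom C X Y\<rbrakk> \<Longrightarrow> cnorm C f = 0 \<longleftrightarrow> f = 0"
    and norm_smul: "\<lbrakk>X \<in> Ob C; Y \<in> Ob C; f \<in> Hom C X Y\<rbrakk>
          \<Longrightarrow> cnorm C (smul C c f) = cmod c * cnorm C f"
    and norm_triangle: "\<lbrakk>X \<in> Ob C; Y \<in> Ob C; f \<in> Hom C X Y; g \<in> Hom C X Y\<rbrakk>
          \<Longrightarrow> cnorm C (f + g) \<le> cnorm C f + cnorm C g"
    and norm_complete: "\<lbrakk>X \<in> Ob C; Y \<in> Ob C; \<And>n. \<sigma> n \<in> Hom C X Y;
          \<And>\<epsilon>. \<epsilon> > 0 \<Longrightarrow> \<exists>N. \<forall>m\<ge>N. \<forall>n\<ge>N. cnorm C (\<sigma> m - \<sigma> n) < \<epsilon>\<rbrakk>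
          \<Longrightarrow> \<exists>f\<in>Hom C X Y. (\<lambda>n. cnorm C (\<sigma> n - f)) \<longlonglongrightarrow> 0"
    and norm_comp: "\<lbrakk>X \<in> Ob C; Y \<in> Ob C; Z \<in> Ob C; f \<in> Hom C X Y; g \<in> Hom C Y Z\<rbrakk>
          \<Longrightarrow> cnorm C (g \<cdot> f) \<le> cnorm C g * cnorm C f"
    and cstar_identity: "\<lbrakk>X \<in> Ob C; Y \<in> Ob C; f \<in> Hom C X Y\<rbrakk>
          \<Longrightarrow> cnorm C (adj C f \<cdot> f) = (cnorm C f)\<^sup>2"
    \<comment> \<open>\<open>f\<^sup>*f\<close> is positive in the C*-algebra \<open>End X\<close>\<close>
    and positivity: "\<lbrakk>X \<in> Ob C; Y \<in> Ob C; f \<in> Hom C X Y\<rbrakk>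
          \<Longrightarrow> \<exists>h\<in>Hom C X X. adj C f \<cdot> f = adj C h \<cdot> h"
    and direct_sums: "\<lbrakk>X \<in> Ob C; Y \<in> Ob C\<rbrakk> \<Longrightarrow> \<exists>Z\<in>Ob C. \<exists>u\<in>Hom C X Z. \<exists>v\<in>Hom C Y Z.
          adj C u \<cdot> u = \<iota> X \<and> adj C v \<cdot> v = \<iota> Y \<and> u \<cdot> adj C u + v \<cdot> adj C v = \<iota> Z"
    and images_of_projections: "\<lbrakk>X \<in> Ob C; p \<in> Hom C X X; adj C p = p; p \<cdot> p = p\<rbrakk>
          \<Longrightarrow> \<exists>Y\<in>Ob C. \<exists>v\<in>Hom C Y X. adj C v \<cdot> v = \<iota> Y \<and> v \<cdot> adj C v = p"

definition isomorphic :: "('o, 'm::ab_group_add) tensor_cat \<Rightarrow> 'o \<Rightarrow> 'o \<Rightarrow> bool" where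
  "isomorphic C X Y \<longleftrightarrow>
     (\<exists>f\<in>Hom C X Y. \<exists>g\<in>Hom C Y X. g \<cdot>\<^bsub>C\<^esub> f = \<iota>\<^bsub>C\<^esub> X \<and> f \<cdot>\<^bsub>C\<^esub> g = \<iota>\<^bsub>C\<^esub> Y)"

definition simple_object :: "('o, 'm::ab_group_add) tensor_cat \<Rightarrow> 'o \<Rightarrow> bool" where
  "simple_object C X \<longleftrightarrow> X \<in> Ob C \<and> vector_space.dim (smul C) (Hom C X X) = 1"

locale cstar_tensor_category = cstar_category C
  for C :: "('o, 'm::ab_group_add) tensor_cat" (structure) +
  assumes tob_in: "\<lbrakk>X \<in> Ob C; Y \<in> Ob C\<rbrakk> \<Longrightarrow> X \<boxtimes> Y \<in> Ob C"
    and tmor_in: "\<lbrakk>X \<in> Ob C; Y \<in> Ob C; X' \<in> Ob C; Y' \<in> Ob C; f \<in> Hom C X Y; f' \<in> Hom C X' Y'\<rbrakk>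
          \<Longrightarrow> f \<odot> f' \<in> Hom C (X \<boxtimes> X') (Y \<boxtimes> Y')"
    and tmor_idm: "\<lbrakk>X \<in> Ob C; Y \<in> Ob C\<rbrakk> \<Longrightarrow> \<iota> X \<odot> \<iota> Y = \<iota> (X \<boxtimes> Y)"
    and tmor_comp: "\<lbrakk>X \<in> Ob C; Y \<in> Ob C; Z \<in> Ob C; X' \<in> Ob C; Y' \<in> Ob C; Z' \<in> Ob C;
          f \<in> Hom C X Y; g \<in> Hom C Y Z; f' \<in> Hom C X' Y'; g' \<in> Hom C Y' Z'\<rbrakk>
          \<Longrightarrow> (g \<cdot> f) \<odot> (g' \<cdot> f') = (g \<odot> g') \<cdot> (f \<odot> f')"
    and tmor_add_left: "\<lbrakk>X \<in> Ob C; Y \<in> Ob C; X' \<in> Ob C; Y' \<in> Ob C;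
          f \<in> Hom C X Y; g \<in> Hom C X Y; f' \<in> Hom C X' Y'\<rbrakk> \<Longrightarrow> (f + g) \<odot> f' = f \<odot> f' + g \<odot> f'"
    and tmor_add_right: "\<lbrakk>X \<in> Ob C; Y \<in> Ob C; X' \<in> Ob C; Y' \<in> Ob C;
          f \<in> Hom C X Y; f' \<in> Hom C X' Y'; g' \<in> Hom C X' Y'\<rbrakk> \<Longrightarrow> f \<odot> (f' + g') = f \<odot> f' + f \<odot> g'"
    and tmor_smul_left: "\<lbrakk>X \<in> Ob C; Y \<in> Ob C; X' \<in> Ob C; Y' \<in> Ob C;
          f \<in> Hom C X Y; f' \<in> Hom C X' Y'\<rbrakk> \<Longrightarrow> smul C c f \<odot> f' = smul C c (f \<odot> f')"
    and tmor_smul_right: "\<lbrakk>X \<in> Ob C; Y \<in> Ob C; X' \<in> Ob C; Y' \<in> Ob C;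
          f \<in> Hom C X Y; f' \<in> Hom C X' Y'\<rbrakk> \<Longrightarrow> f \<odot> smul C c f' = smul C c (f \<odot> f')"
    and tmor_adj: "\<lbrakk>X \<in> Ob C; Y \<in> Ob C; X' \<in> Ob C; Y' \<in> Ob C;
          f \<in> Hom C X Y; f' \<in> Hom C X' Y'\<rbrakk> \<Longrightarrow> adj C (f \<odot> f') = adj C f \<odot> adj C f'"
    and unit_simple: "simple_object C (unito C)"
    and unit_left: "X \<in> Ob C \<Longrightarrow> unito C \<boxtimes> X = X"
    and unit_right: "X \<in> Ob C \<Longrightarrow> X \<boxtimes> unito C = X"
    and unit_left_mor: "\<lbrakk>X \<in> Ob C; Y \<in> Ob C; f \<in> Hom C X Y\<rbrakk> \<Longrightarrow> \<iota> (unito C) \<odot> f = f"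
    and unit_right_mor: "\<lbrakk>X \<in> Ob C; Y \<in> Ob C; f \<in> Hom C X Y\<rbrakk> \<Longrightarrow> f \<odot> \<iota> (unito C) = f"
    and assoc_in: "\<lbrakk>X \<in> Ob C; Y \<in> Ob C; Z \<in> Ob C\<rbrakk>
          \<Longrightarrow> assoc C X Y Z \<in> Hom C ((X \<boxtimes> Y) \<boxtimes> Z) (X \<boxtimes> (Y \<boxtimes> Z))"
    and assoc_unitary_left: "\<lbrakk>X \<in> Ob C; Y \<in> Ob C; Z \<in> Ob C\<rbrakk>
          \<Longrightarrow> adj C (assoc C X Y Z) \<cdot> assoc C X Y Z = \<iota> ((X \<boxtimes> Y) \<boxtimes> Z)"
    and assoc_unitary_right: "\<lbrakk>X \<in> Ob C; Y \<in> Ob C; Z \<in> Ob C\<rbrakk>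
          \<Longrightarrow> assoc C X Y Z \<cdot> adj C (assoc C X Y Z) = \<iota> (X \<boxtimes> (Y \<boxtimes> Z))"
    and assoc_natural: "\<lbrakk>X \<in> Ob C; Y \<in> Ob C; Z \<in> Ob C; X' \<in> Ob C; Y' \<in> Ob C; Z' \<in> Ob C;
          f \<in> Hom C X X'; g \<in> Hom C Y Y'; h \<in> Hom C Z Z'\<rbrakk>
          \<Longrightarrow> assoc C X' Y' Z' \<cdot> ((f \<odot> g) \<odot> h) = (f \<odot> (g \<odot> h)) \<cdot> assoc C X Y Z"
    and pentagon: "\<lbrakk>W \<in> Ob C; X \<in> Ob C; Y \<in> Ob C; Z \<in> Ob C\<rbrakk>
          \<Longrightarrow> assoc C W X (Y \<boxtimes> Z) \<cdot> assoc C (W \<boxtimes> X) Y Z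
             = (\<iota> W \<odot> assoc C X Y Z) \<cdot> (assoc C W (X \<boxtimes> Y) Z \<cdot> (assoc C W X Y \<odot> \<iota> Z))"
    and triangle: "\<lbrakk>X \<in> Ob C; Y \<in> Ob C\<rbrakk> \<Longrightarrow> assoc C X (unito C) Y = \<iota> (X \<boxtimes> Y)"

definition strict_cat :: "('o, 'm::ab_group_add) tensor_cat \<Rightarrow> bool" where
  "strict_cat C \<longleftrightarrow> (\<forall>X\<in>Ob C. \<forall>Y\<in>Ob C. \<forall>Z\<in>Ob C.
     (X \<boxtimes>\<^bsub>C\<^esub> Y) \<boxtimes>\<^bsub>C\<^esub> Z = X \<boxtimes>\<^bsub>C\<^esub> (Y \<boxtimes>\<^bsub>C\<^esub> Z) \<and>
     assoc C X Y Z = \<iota>\<^bsub>C\<^esub> (X \<boxtimes>\<^bsub>C\<^esub> (Y \<boxtimes>\<^bsub>C\<^esub> Z)))"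

definition conj_solution :: "('o, 'm::ab_group_add) tensor_cat \<Rightarrow> 'o \<Rightarrow> 'o \<Rightarrow> 'm \<Rightarrow> 'm \<Rightarrow> bool" where
  "conj_solution C X Xb R Rb \<longleftrightarrow> Xb \<in> Ob C \<and>
     R \<in> Hom C (unito C) (Xb \<boxtimes>\<^bsub>C\<^esub> X) \<and> Rb \<in> Hom C (unito C) (X \<boxtimes>\<^bsub>C\<^esub> Xb) \<and>
     (\<iota>\<^bsub>C\<^esub> Xb \<odot>\<^bsub>C\<^esub> adj C Rb) \<cdot>\<^bsub>C\<^esub> assoc C Xb X Xb \<cdot>\<^bsub>C\<^esub> (R \<odot>\<^bsub>C\<^esub> \<iota>\<^bsub>C\<^esub> Xb) = \<iota>\<^bsub>C\<^esub> Xb \<and>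
     (\<iota>\<^bsub>C\<^esub> X \<odot>\<^bsub>C\<^esub> adj C R) \<cdot>\<^bsub>C\<^esub> assoc C X Xb X \<cdot>\<^bsub>C\<^esub> (Rb \<odot>\<^bsub>C\<^esub> \<iota>\<^bsub>C\<^esub> X) = \<iota>\<^bsub>C\<^esub> X"

definition rigid_cat :: "('o, 'm::ab_group_add) tensor_cat \<Rightarrow> bool" where
  "rigid_cat C \<longleftrightarrow> (\<forall>X\<in>Ob C. \<exists>Xb R Rb. conj_solution C X Xb R Rb)"

definition intrinsic_dim :: "('o, 'm::ab_group_add) tensor_cat \<Rightarrow> 'o \<Rightarrow> real" where
  "intrinsic_dim C X = Inf {cnorm C R * cnorm C Rb | Xb R Rb. conj_solution C X Xb R Rb}"

definition standard_solution :: "('o, 'm::ab_group_add) tensor_cat \<Rightarrow> 'o \<Rightarrow> 'o \<Rightarrow> 'm \<Rightarrow> 'm \<Rightarrow> bool" where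
  "standard_solution C X Xb R Rb \<longleftrightarrow> conj_solution C X Xb R Rb \<and>
     cnorm C R = sqrt (intrinsic_dim C X) \<and> cnorm C Rb = sqrt (intrinsic_dim C X)"

definition standard_choice ::
    "('o, 'm::ab_group_add) tensor_cat \<Rightarrow> ('o \<Rightarrow> 'o) \<Rightarrow> ('o \<Rightarrow> 'm) \<Rightarrow> ('o \<Rightarrow> 'm) \<Rightarrow> bool" where
  "standard_choice C dual R Rb \<longleftrightarrow> (\<forall>X\<in>Ob C. standard_solution C X (dual X) (R X) (Rb X))"

definition irr_representatives :: "('o, 'm::ab_group_add) tensor_cat \<Rightarrow> 'o set \<Rightarrow> bool" where
  "irr_representatives C I \<longleftrightarrow> (\<forall>S\<in>I. simple_object C S) \<and>
     (\<forall>S. simple_object C S \<longrightarrow> (\<exists>!T. T \<in> I \<and> isomorphic C S T))"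

definition full_family :: "('o, 'm::ab_group_add) tensor_cat \<Rightarrow> 'o set \<Rightarrow> ('j \<Rightarrow> 'o) \<Rightarrow> bool" where
  "full_family C I X \<longleftrightarrow> (\<forall>j. X j \<in> Ob C) \<and>
     (\<forall>S\<in>I. \<exists>j. \<exists>v\<in>Hom C S (X j). adj C v \<cdot>\<^bsub>C\<^esub> v = \<iota>\<^bsub>C\<^esub> S)"


section \<open>Gradings and twists by 3-cocycles\<close>

text \<open>\<open>Gr \<gamma>\<close> is the set of objects of the full subcategory of degree \<open>\<gamma>\<close>.\<close>

locale graded_category =
  fixes \<Gamma> :: "('g, 'z) monoid_scheme" and C :: "('o, 'm::ab_group_add) tensor_cat" (structure)
    and Gr :: "'g \<Rightarrow> 'o set"
  assumes Gr_Ob: "\<gamma> \<in> carrier \<Gamma> \<Longrightarrow> Gr \<gamma> \<subseteq> Ob C"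
    and Gr_orthogonal: "\<lbrakk>\<gamma> \<in> carrier \<Gamma>; \<eta> \<in> carrier \<Gamma>; \<gamma> \<noteq> \<eta>; X \<in> Gr \<gamma>; Y \<in> Gr \<eta>\<rbrakk>
          \<Longrightarrow> Hom C X Y = {0}"
    and Gr_direct_sum: "X \<in> Ob C \<Longrightarrow> \<exists>(n::nat) \<gamma> Y u.
          (\<forall>i<n. \<gamma> i \<in> carrier \<Gamma> \<and> Y i \<in> Gr (\<gamma> i) \<and> u i \<in> Hom C (Y i) X \<and> adj C (u i) \<cdot> u i = \<iota> (Y i)) \<and>
          (\<forall>i<n. \<forall>k<n. i \<noteq> k \<longrightarrow> adj C (u i) \<cdot> u k = 0) \<and>
          (\<Sum>i<n. u i \<cdot> adj C (u i)) = \<iota> X"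
    and Gr_tensor: "\<lbrakk>\<gamma> \<in> carrier \<Gamma>; \<eta> \<in> carrier \<Gamma>; X \<in> Gr \<gamma>; Y \<in> Gr \<eta>\<rbrakk>
          \<Longrightarrow> \<exists>Z\<in>Gr (\<gamma> \<otimes>\<^bsub>\<Gamma>\<^esub> \<eta>). isomorphic C (X \<boxtimes> Y) Z"

definition has_degree :: "('o, 'm::ab_group_add) tensor_cat \<Rightarrow> ('g \<Rightarrow> 'o set) \<Rightarrow> 'g \<Rightarrow> 'o \<Rightarrow> bool" where
  "has_degree C Gr \<gamma> X \<longleftrightarrow> (\<exists>Y\<in>Gr \<gamma>. isomorphic C X Y)"

definition normalized_3cocycle :: "('g, 'z) monoid_scheme \<Rightarrow> ('g \<Rightarrow> 'g \<Rightarrow> 'g \<Rightarrow> complex) \<Rightarrow> bool" where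
  "normalized_3cocycle \<Gamma> \<omega> \<longleftrightarrow>
     (\<forall>a\<in>carrier \<Gamma>. \<forall>b\<in>carrier \<Gamma>. \<forall>c\<in>carrier \<Gamma>. cmod (\<omega> a b c) = 1) \<and>
     (\<forall>a\<in>carrier \<Gamma>. \<forall>b\<in>carrier \<Gamma>. \<forall>c\<in>carrier \<Gamma>. \<forall>d\<in>carrier \<Gamma>.
        \<omega> a b c * \<omega> a (b \<otimes>\<^bsub>\<Gamma>\<^esub> c) d * \<omega> b c d = \<omega> (a \<otimes>\<^bsub>\<Gamma>\<^esub> b) c d * \<omega> a b (c \<otimes>\<^bsub>\<Gamma>\<^esub> d)) \<and>
     (\<forall>a\<in>carrier \<Gamma>. \<forall>b\<in>carrier \<Gamma>. \<forall>c\<in>carrier \<Gamma>.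
        a = \<one>\<^bsub>\<Gamma>\<^esub> \<or> b = \<one>\<^bsub>\<Gamma>\<^esub> \<or> c = \<one>\<^bsub>\<Gamma>\<^esub> \<longrightarrow> \<omega> a b c = 1)"

text \<open>
  The projection of \<open>X\<close> onto its component of degree \<open>\<gamma>\<close>: if \<open>X\<close> is the direct sum of
  \<open>Y\<^sub>i \<in> Gr (\<gamma>\<^sub>i)\<close> via isometries \<open>u\<^sub>i\<close>, it is the sum of the \<open>u\<^sub>i u\<^sub>i\<^sup>*\<close> with \<open>\<gamma>\<^sub>i = \<gamma>\<close>. It does not
  depend on the decomposition.
\<close>

definition degree_proj ::
    "('g, 'z) monoid_scheme \<Rightarrow> ('o, 'm::ab_group_add) tensor_cat \<Rightarrow> ('g \<Rightarrow> 'o set) \<Rightarrow> 'g \<Rightarrow> 'o \<Rightarrow> 'm" where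
  "degree_proj \<Gamma> C Gr \<gamma> X = (THE p. p \<in> Hom C X X \<and>
     (\<forall>\<eta>\<in>carrier \<Gamma>. \<forall>Y\<in>Gr \<eta>. \<forall>u\<in>Hom C Y X. p \<cdot>\<^bsub>C\<^esub> u = (if \<eta> = \<gamma> then u else 0)))"

definition degrees ::
    "('g, 'z) monoid_scheme \<Rightarrow> ('o, 'm::ab_group_add) tensor_cat \<Rightarrow> ('g \<Rightarrow> 'o set) \<Rightarrow> 'o \<Rightarrow> 'g set" where
  "degrees \<Gamma> C Gr X = {\<gamma> \<in> carrier \<Gamma>. degree_proj \<Gamma> C Gr \<gamma> X \<noteq> 0}"

text \<open>
  The twisted associator is \<open>\<omega> \<gamma>\<^sub>1 \<gamma>\<^sub>2 \<gamma>\<^sub>3\<close> times the given one on the component of degrees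
  \<open>\<gamma>\<^sub>1, \<gamma>\<^sub>2, \<gamma>\<^sub>3\<close>; this is its extension by direct sums from homogeneous objects to all objects.
\<close>

definition twisted_category ::
    "('g, 'z) monoid_scheme \<Rightarrow> ('g \<Rightarrow> 'o set) \<Rightarrow> ('g \<Rightarrow> 'g \<Rightarrow> 'g \<Rightarrow> complex) \<Rightarrow>
     ('o, 'm::ab_group_add) tensor_cat \<Rightarrow> ('o, 'm) tensor_cat" where
  "twisted_category \<Gamma> Gr \<omega> C = C\<lparr>assoc := (\<lambda>X Y Z.
     \<Sum>a\<in>degrees \<Gamma> C Gr X. \<Sum>b\<in>degrees \<Gamma> C Gr Y. \<Sum>c\<in>degrees \<Gamma> C Gr Z.
       smul C (\<omega> a b c) (assoc C X Y Z \<cdot>\<^bsub>C\<^esub>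
         ((degree_proj \<Gamma> C Gr a X \<odot>\<^bsub>C\<^esub> degree_proj \<Gamma> C Gr b Y) \<odot>\<^bsub>C\<^esub> degree_proj \<Gamma> C Gr c Z)))\<rparr>"


section \<open>The annular algebra\<close>

text \<open>
  The total direct sum of the spaces \<open>Hom (S \<boxtimes> X j) (X k \<boxtimes> S)\<close> consists of finitely supported
  functions of \<open>(k, j, S)\<close>. The relations respect \<open>(k, j)\<close>, so that the quotient of the total direct
  sum by the span of all relations is the direct sum over \<open>(k, j)\<close> of the quotients \<open>\<A>\<^bsub>k,j\<^esub>\<close>.
  Elements of the annular algebra are cosets.
\<close>

type_synonym ('j, 'o, 'm) annular_rep = "('j \<times> 'j \<times> 'o) \<Rightarrow>\<^sub>0 'm"

definition rep_scale ::
    "('o, 'm::ab_group_add) tensor_cat \<Rightarrow> complex \<Rightarrow> ('j, 'o, 'm) annular_rep \<Rightarrow> ('j, 'o, 'm) annular_rep" where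
  "rep_scale C c F = Poly_Mapping.map (smul C c) F"

definition annular_reps :: "('o, 'm::ab_group_add) tensor_cat \<Rightarrow> ('j \<Rightarrow> 'o) \<Rightarrow> ('j, 'o, 'm) annular_rep set" where
  "annular_reps C X = {F. \<forall>(k, j, S)\<in>Poly_Mapping.keys F.
     S \<in> Ob C \<and> Poly_Mapping.lookup F (k, j, S) \<in> Hom C (S \<boxtimes>\<^bsub>C\<^esub> X j) (X k \<boxtimes>\<^bsub>C\<^esub> S)}"

definition annular_relations :: "('o, 'm::ab_group_add) tensor_cat \<Rightarrow> ('j \<Rightarrow> 'o) \<Rightarrow> ('j, 'o, 'm) annular_rep set" where
  "annular_relations C X = module.span (rep_scale C)
     {Poly_Mapping.single (k, j, S) (f \<cdot>\<^bsub>C\<^esub> (f' \<odot>\<^bsub>C\<^esub> \<iota>\<^bsub>C\<^esub> (X j)))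
        - Poly_Mapping.single (k, j, T) ((\<iota>\<^bsub>C\<^esub> (X k) \<odot>\<^bsub>C\<^esub> f') \<cdot>\<^bsub>C\<^esub> f)
      | k j S T f f'. S \<in> Ob C \<and> T \<in> Ob C \<and>
          f \<in> Hom C (T \<boxtimes>\<^bsub>C\<^esub> X j) (X k \<boxtimes>\<^bsub>C\<^esub> S) \<and> f' \<in> Hom C S T}"

definition annular_class ::
    "('o, 'm::ab_group_add) tensor_cat \<Rightarrow> ('j \<Rightarrow> 'o) \<Rightarrow> ('j, 'o, 'm) annular_rep \<Rightarrow> ('j, 'o, 'm) annular_rep set" where
  "annular_class C X F = {H. H - F \<in> annular_relations C X}"

definition annular_space ::
    "('o, 'm::ab_group_add) tensor_cat \<Rightarrow> ('j \<Rightarrow> 'o) \<Rightarrow> ('j, 'o, 'm) annular_rep set set" where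
  "annular_space C X = annular_class C X ` annular_reps C X"

text \<open>
  The operations are given on representatives by linear extension of their values on the morphism
  spaces, and then passed to cosets; \<open>the_elem\<close> extracts the common class of all results.
\<close>

definition annular_scale ::
    "('o, 'm::ab_group_add) tensor_cat \<Rightarrow> ('j \<Rightarrow> 'o) \<Rightarrow> complex \<Rightarrow>
     ('j, 'o, 'm) annular_rep set \<Rightarrow> ('j, 'o, 'm) annular_rep set" where
  "annular_scale C X c a = the_elem (\<Union>F\<in>a. {annular_class C X (rep_scale C c F)})"

text \<open>Associators being unitary, their inverses are written as adjoints below.\<close>

definition mor_mult :: "('o, 'm::ab_group_add) tensor_cat \<Rightarrow> ('j \<Rightarrow> 'o) \<Rightarrow>
    'j \<Rightarrow> 'j \<Rightarrow> 'j \<Rightarrow> 'o \<Rightarrow> 'o \<Rightarrow> 'm \<Rightarrow> 'm \<Rightarrow> 'm" where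
  "mor_mult C X m k j S T f f' =
     assoc C (X m) S T \<cdot>\<^bsub>C\<^esub> (f \<odot>\<^bsub>C\<^esub> \<iota>\<^bsub>C\<^esub> T) \<cdot>\<^bsub>C\<^esub> adj C (assoc C S (X k) T)
       \<cdot>\<^bsub>C\<^esub> (\<iota>\<^bsub>C\<^esub> S \<odot>\<^bsub>C\<^esub> f') \<cdot>\<^bsub>C\<^esub> assoc C S T (X j)"

definition rep_mult :: "('o, 'm::ab_group_add) tensor_cat \<Rightarrow> ('j \<Rightarrow> 'o) \<Rightarrow>
    ('j, 'o, 'm) annular_rep \<Rightarrow> ('j, 'o, 'm) annular_rep \<Rightarrow> ('j, 'o, 'm) annular_rep" where
  "rep_mult C X F G =
     (\<Sum>(m, k, S)\<in>Poly_Mapping.keys F. \<Sum>(k', j, T)\<in>Poly_Mapping.keys G.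
        if k = k'
        then Poly_Mapping.single (m, j, S \<boxtimes>\<^bsub>C\<^esub> T)
               (mor_mult C X m k j S T (Poly_Mapping.lookup F (m, k, S)) (Poly_Mapping.lookup G (k', j, T)))
        else 0)"

definition annular_mult :: "('o, 'm::ab_group_add) tensor_cat \<Rightarrow> ('j \<Rightarrow> 'o) \<Rightarrow>
    ('j, 'o, 'm) annular_rep set \<Rightarrow> ('j, 'o, 'm) annular_rep set \<Rightarrow> ('j, 'o, 'm) annular_rep set" where
  "annular_mult C X a b = the_elem (\<Union>F\<in>a. \<Union>G\<in>b. {annular_class C X (rep_mult C X F G)})"

definition mor_star :: "('o, 'm::ab_group_add) tensor_cat \<Rightarrow> ('o \<Rightarrow> 'o) \<Rightarrow> ('o \<Rightarrow> 'm) \<Rightarrow> ('o \<Rightarrow> 'm) \<Rightarrow>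
    ('j \<Rightarrow> 'o) \<Rightarrow> 'j \<Rightarrow> 'j \<Rightarrow> 'o \<Rightarrow> 'm \<Rightarrow> 'm" where
  "mor_star C dual R Rb X k j S f =
     (((adj C (R S) \<odot>\<^bsub>C\<^esub> \<iota>\<^bsub>C\<^esub> (X j)) \<cdot>\<^bsub>C\<^esub> adj C (assoc C (dual S) S (X j))) \<odot>\<^bsub>C\<^esub> \<iota>\<^bsub>C\<^esub> (dual S))
     \<cdot>\<^bsub>C\<^esub> ((\<iota>\<^bsub>C\<^esub> (dual S) \<odot>\<^bsub>C\<^esub> adj C f) \<odot>\<^bsub>C\<^esub> \<iota>\<^bsub>C\<^esub> (dual S))
     \<cdot>\<^bsub>C\<^esub> adj C (assoc C (dual S) (X k \<boxtimes>\<^bsub>C\<^esub> S) (dual S))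
     \<cdot>\<^bsub>C\<^esub> (\<iota>\<^bsub>C\<^esub> (dual S) \<odot>\<^bsub>C\<^esub> (adj C (assoc C (X k) S (dual S)) \<cdot>\<^bsub>C\<^esub> (\<iota>\<^bsub>C\<^esub> (X k) \<odot>\<^bsub>C\<^esub> Rb S)))"

definition rep_star :: "('o, 'm::ab_group_add) tensor_cat \<Rightarrow> ('o \<Rightarrow> 'o) \<Rightarrow> ('o \<Rightarrow> 'm) \<Rightarrow> ('o \<Rightarrow> 'm) \<Rightarrow>
    ('j \<Rightarrow> 'o) \<Rightarrow> ('j, 'o, 'm) annular_rep \<Rightarrow> ('j, 'o, 'm) annular_rep" where
  "rep_star C dual R Rb X F =
     (\<Sum>(k, j, S)\<in>Poly_Mapping.keys F.
        Poly_Mapping.single (j, k, dual S) (mor_star C dual R Rb X k j S (Poly_Mapping.lookup F (k, j, S))))"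

definition annular_star :: "('o, 'm::ab_group_add) tensor_cat \<Rightarrow> ('o \<Rightarrow> 'o) \<Rightarrow> ('o \<Rightarrow> 'm) \<Rightarrow> ('o \<Rightarrow> 'm) \<Rightarrow>
    ('j \<Rightarrow> 'o) \<Rightarrow> ('j, 'o, 'm) annular_rep set \<Rightarrow> ('j, 'o, 'm) annular_rep set" where
  "annular_star C dual R Rb X a = the_elem (\<Union>F\<in>a. {annular_class C X (rep_star C dual R Rb X F)})"


section \<open>The action groupoid and the Fell bundle\<close>

definition arrows :: "('g, 'z) monoid_scheme \<Rightarrow> ('g \<times> 'g) set" where
  "arrows \<Gamma> = carrier \<Gamma> \<times> carrier \<Gamma>"

definition adjoint_act :: "('g, 'z) monoid_scheme \<Rightarrow> 'g \<Rightarrow> 'g \<Rightarrow> 'g" where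
  "adjoint_act \<Gamma> s \<gamma> = s \<otimes>\<^bsub>\<Gamma>\<^esub> \<gamma> \<otimes>\<^bsub>\<Gamma>\<^esub> inv\<^bsub>\<Gamma>\<^esub> s"

definition composable :: "('g, 'z) monoid_scheme \<Rightarrow> 'g \<times> 'g \<Rightarrow> 'g \<times> 'g \<Rightarrow> bool" where
  "composable \<Gamma> g\<^sub>1 g\<^sub>2 \<longleftrightarrow> snd g\<^sub>1 = adjoint_act \<Gamma> (fst g\<^sub>2) (snd g\<^sub>2)"

definition arrow_comp :: "('g, 'z) monoid_scheme \<Rightarrow> 'g \<times> 'g \<Rightarrow> 'g \<times> 'g \<Rightarrow> 'g \<times> 'g" where
  "arrow_comp \<Gamma> g\<^sub>1 g\<^sub>2 = (fst g\<^sub>1 \<otimes>\<^bsub>\<Gamma>\<^esub> fst g\<^sub>2, snd g\<^sub>2)"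

definition arrow_inv :: "('g, 'z) monoid_scheme \<Rightarrow> 'g \<times> 'g \<Rightarrow> 'g \<times> 'g" where
  "arrow_inv \<Gamma> g = (inv\<^bsub>\<Gamma>\<^esub> (fst g), adjoint_act \<Gamma> (fst g) (snd g))"

definition normalized_2cocycle ::
    "('g, 'z) monoid_scheme \<Rightarrow> ('g \<times> 'g \<Rightarrow> 'g \<times> 'g \<Rightarrow> complex) \<Rightarrow> bool" where
  "normalized_2cocycle \<Gamma> \<psi> \<longleftrightarrow>
     (\<forall>g\<^sub>1\<in>arrows \<Gamma>. \<forall>g\<^sub>2\<in>arrows \<Gamma>. composable \<Gamma> g\<^sub>1 g\<^sub>2 \<longrightarrow>
        cmod (\<psi> g\<^sub>1 g\<^sub>2) = 1 \<and> (fst g\<^sub>1 = \<one>\<^bsub>\<Gamma>\<^esub> \<or> fst g\<^sub>2 = \<one>\<^bsub>\<Gamma>\<^esub> \<longrightarrow> \<psi> g\<^sub>1 g\<^sub>2 = 1)) \<and>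
     (\<forall>g\<^sub>1\<in>arrows \<Gamma>. \<forall>g\<^sub>2\<in>arrows \<Gamma>. \<forall>g\<^sub>3\<in>arrows \<Gamma>. composable \<Gamma> g\<^sub>1 g\<^sub>2 \<longrightarrow> composable \<Gamma> g\<^sub>2 g\<^sub>3 \<longrightarrow>
        \<psi> g\<^sub>1 g\<^sub>2 * \<psi> (arrow_comp \<Gamma> g\<^sub>1 g\<^sub>2) g\<^sub>3 = \<psi> g\<^sub>2 g\<^sub>3 * \<psi> g\<^sub>1 (arrow_comp \<Gamma> g\<^sub>2 g\<^sub>3))"

fun transgression ::
    "('g, 'z) monoid_scheme \<Rightarrow> ('g \<Rightarrow> 'g \<Rightarrow> 'g \<Rightarrow> complex) \<Rightarrow> 'g \<times> 'g \<Rightarrow> 'g \<times> 'g \<Rightarrow> complex" where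
  "transgression \<Gamma> \<omega> (s\<^sub>1, \<gamma>\<^sub>1) (s\<^sub>2, \<gamma>\<^sub>2) =
     \<omega> (s\<^sub>1 \<otimes>\<^bsub>\<Gamma>\<^esub> \<gamma>\<^sub>1 \<otimes>\<^bsub>\<Gamma>\<^esub> inv\<^bsub>\<Gamma>\<^esub> s\<^sub>1) s\<^sub>1 s\<^sub>2 * cnj (\<omega> s\<^sub>1 \<gamma>\<^sub>1 s\<^sub>2) * \<omega> s\<^sub>1 s\<^sub>2 \<gamma>\<^sub>2"

text \<open>
  \<open>deg j\<close> is the degree of \<open>X j\<close>. A coset lies in the fibre over \<open>(s, \<gamma>)\<close> iff it is a sum of images of
  morphisms in \<open>Hom (S \<boxtimes> X j) (X k \<boxtimes> S)\<close> with \<open>(k, j, S)\<close> as indicated.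
\<close>

definition fibre :: "('g, 'z) monoid_scheme \<Rightarrow> ('o, 'm::ab_group_add) tensor_cat \<Rightarrow> ('g \<Rightarrow> 'o set) \<Rightarrow> 'o set \<Rightarrow>
    ('j \<Rightarrow> 'o) \<Rightarrow> ('j \<Rightarrow> 'g) \<Rightarrow> 'g \<times> 'g \<Rightarrow> ('j, 'o, 'm) annular_rep set set" where
  "fibre \<Gamma> C Gr I X deg g = annular_class C X ` {F \<in> annular_reps C X.
     \<forall>(k, j, S)\<in>Poly_Mapping.keys F. S \<in> I \<and> has_degree C Gr (fst g) S \<and>
       deg j = snd g \<and> deg k = adjoint_act \<Gamma> (fst g) (snd g)}"

end

theory Submission
  imports Defs
begin

text \<open>
  The twisted category has the same morphisms as \<open>C\<close>; only its associator differs, and on the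
  component of degrees \<open>(a, b, c)\<close> it is multiplication by \<open>\<omega> a b c\<close>. Hence every computation takes place
  in the strict category \<open>C\<close>, and the projections onto homogeneous components decide which scalar an
  associator contributes. In a product of elements of two fibres, the three associators act on triples
  of homogeneous objects, and their scalars multiply to the transgression of
  \<open>\<omega>\<close> (\<open>mor_mult_twisted\<close>). The transgression is a 2-cocycle by four instances of the 3-cocycle identity
  (\<open>transgression_cocycle\<close>).

  The operations are defined on cosets, and the representatives of a coset range over all objects,
  homogeneous or not. So one has to show that both products and both involutions respect the
  relations. For products, naturality of the associator suffices (\<open>arrow_mult_slide_left\<close>,
  \<open>arrow_mult_slide_right\<close>), and the twisted associator is natural because morphisms commute with the
  projections (\<open>natural_assoc_twisted\<close>).

  For the involution of \<open>C\<close>, a morphism \<open>U\<close> between objects has a conjugate \<open>V\<close> between the duals, and the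
  adjoints of the two sides of a relation along \<open>U\<close> are the two sides of a relation along \<open>V\<close>
  (\<open>strict_star_slide\<close>). With \<open>U\<close> an identity this says that the class of an adjoint does not depend on the
  solution of the conjugate equations (\<open>strict_star_class_unique\<close>).

  The involution of the twisted category is reduced to this case. Multiplying the component of degree \<open>a\<close> of
  the coevaluation by \<open>\<omega> a a\<^sup>-\<^sup>1 a\<close> turns a solution of the twisted conjugate equation into a solution of
  the strict one (\<open>zigzag_twist\<close>). With respect to it, the twisted adjoint of a morphism is the strict adjoint
  of its composite with an endomorphism that is multiplication by a scalar on each homogeneous component
  (\<open>arrow_star_twisted\<close>). Such endomorphisms commute with all morphisms, so the relations are still
  respected, and on a fibre only one scalar remains: the conjugate of the transgression at
  \<open>(g\<^sup>-\<^sup>1, g)\<close> (\<open>transgression_inverse\<close>).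
\<close>

section \<open>Typed arrows in a strict category\<close>

text \<open>
  All morphism spaces lie in one type, so that a morphism determines neither its source nor its
  target. Recording both turns the typing conditions of the category axioms into equations between
  objects, which the simplifier can solve.
\<close>

datatype ('o, 'm) arrow = Arrow (src: 'o) (tgt: 'o) (mor: 'm)

locale strict_tensor_category = cstar_tensor_category C
  for C :: "('o, 'm::ab_group_add) tensor_cat" (structure) +
  assumes strict: "strict_cat C"
begin

sublocale vs: vector_space "smul C" by (rule vs)

definition arr :: "('o, 'm) arrow \<Rightarrow> bool" where
  "arr F \<longleftrightarrow> src F \<in> Ob C \<and> tgt F \<in> Ob C \<and> mor F \<in> Hom C (src F) (tgt F)"

definition acomp :: "('o, 'm) arrow \<Rightarrow> ('o, 'm) arrow \<Rightarrow> ('o, 'm) arrow" (infixl "\<bullet>" 70) where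
  "G \<bullet> F = Arrow (src F) (tgt G) (mor G \<cdot> mor F)"

definition atens :: "('o, 'm) arrow \<Rightarrow> ('o, 'm) arrow \<Rightarrow> ('o, 'm) arrow" (infixl "||" 75) where
  "F || G = Arrow (src F \<boxtimes> src G) (tgt F \<boxtimes> tgt G) (mor F \<odot> mor G)"

definition aid :: "'o \<Rightarrow> ('o, 'm) arrow" ("\<I>") where
  "\<I> X = Arrow X X (\<iota> X)"

definition aadj :: "('o, 'm) arrow \<Rightarrow> ('o, 'm) arrow" ("_\<dagger>" [1000] 1000) where
  "F\<dagger> = Arrow (tgt F) (src F) (adj C (mor F))"

definition ascale :: "complex \<Rightarrow> ('o, 'm) arrow \<Rightarrow> ('o, 'm) arrow" (infixr "*\<^sub>s" 72) where
  "c *\<^sub>s F = Arrow (src F) (tgt F) (smul C c (mor F))"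

lemma sel_simps [simp]:
  "src (G \<bullet> F) = src F" "tgt (G \<bullet> F) = tgt G" "mor (G \<bullet> F) = mor G \<cdot> mor F"
  "src (F || G) = src F \<boxtimes> src G" "tgt (F || G) = tgt F \<boxtimes> tgt G" "mor (F || G) = mor F \<odot> mor G"
  "src (\<I> X) = X" "tgt (\<I> X) = X" "mor (\<I> X) = \<iota> X"
  "src (F\<dagger>) = tgt F" "tgt (F\<dagger>) = src F" "mor (F\<dagger>) = adj C (mor F)"
  "src (c *\<^sub>s F) = src F" "tgt (c *\<^sub>s F) = tgt F" "mor (c *\<^sub>s F) = smul C c (mor F)"
  by (simp_all add: acomp_def atens_def aid_def aadj_def ascale_def)

lemma smul_in: "\<lbrakk>X \<in> Ob C; Y \<in> Ob C; f \<in> Hom C X Y\<rbrakk> \<Longrightarrow> smul C c f \<in> Hom C X Y"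
  using vs.subspace_scale Hom_subspace by blast

lemma add_in: "\<lbrakk>X \<in> Ob C; Y \<in> Ob C; f \<in> Hom C X Y; g \<in> Hom C X Y\<rbrakk> \<Longrightarrow> f + g \<in> Hom C X Y"
  using vs.subspace_add Hom_subspace by blast

lemma zero_in: "\<lbrakk>X \<in> Ob C; Y \<in> Ob C\<rbrakk> \<Longrightarrow> 0 \<in> Hom C X Y"
  using vs.subspace_0 Hom_subspace by blast

lemma sum_in: "\<lbrakk>X \<in> Ob C; Y \<in> Ob C; \<And>i. i \<in> A \<Longrightarrow> f i \<in> Hom C X Y\<rbrakk> \<Longrightarrow> sum f A \<in> Hom C X Y"
  using vs.subspace_sum Hom_subspace by blast

lemma arr_Arrow [simp]: "arr (Arrow X Y f) \<longleftrightarrow> X \<in> Ob C \<and> Y \<in> Ob C \<and> f \<in> Hom C X Y"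
  by (simp add: arr_def)

lemma arr_ob: "arr F \<Longrightarrow> src F \<in> Ob C" "arr F \<Longrightarrow> tgt F \<in> Ob C"
  by (simp_all add: arr_def)

lemma arr_mor: "arr F \<Longrightarrow> mor F \<in> Hom C (src F) (tgt F)"
  by (simp add: arr_def)

lemma tob_Ob [simp]: "\<lbrakk>X \<in> Ob C; Y \<in> Ob C\<rbrakk> \<Longrightarrow> X \<boxtimes> Y \<in> Ob C"
  by (rule tob_in)

lemma unit_Ob [simp]: "unito C \<in> Ob C"
  using unit_simple by (simp add: simple_object_def)

declare unit_left [simp] unit_right [simp]

lemma tob_assoc [simp]:
  "\<lbrakk>X \<in> Ob C; Y \<in> Ob C; Z \<in> Ob C\<rbrakk> \<Longrightarrow> (X \<boxtimes> Y) \<boxtimes> Z = X \<boxtimes> (Y \<boxtimes> Z)"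
  using strict by (simp add: strict_cat_def)

lemma assoc_id: "\<lbrakk>X \<in> Ob C; Y \<in> Ob C; Z \<in> Ob C\<rbrakk> \<Longrightarrow> assoc C X Y Z = \<iota> (X \<boxtimes> (Y \<boxtimes> Z))"
  using strict by (simp add: strict_cat_def)

lemma arr_comp [simp]: "\<lbrakk>arr F; arr G; tgt F = src G\<rbrakk> \<Longrightarrow> arr (G \<bullet> F)"
  using comp_in[of "src F" "tgt F" "tgt G" "mor F" "mor G"] by (simp add: arr_def)

lemma arr_tens [simp]: "\<lbrakk>arr F; arr G\<rbrakk> \<Longrightarrow> arr (F || G)"
  by (simp add: arr_def tmor_in)

lemma arr_id [simp]: "X \<in> Ob C \<Longrightarrow> arr (\<I> X)"
  by (simp add: arr_def idm_in)

lemma arr_adj [simp]: "arr F \<Longrightarrow> arr (F\<dagger>)"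
  by (simp add: arr_def adj_in)

lemma arr_scale [simp]: "arr F \<Longrightarrow> arr (c *\<^sub>s F)"
  by (simp add: arr_def smul_in)

lemma arrow_eqI: "\<lbrakk>src F = src G; tgt F = tgt G; mor F = mor G\<rbrakk> \<Longrightarrow> F = G"
  by (rule arrow.expand) simp

lemma acomp_assoc:
  "\<lbrakk>arr F; arr G; arr H; tgt F = src G; tgt G = src H\<rbrakk> \<Longrightarrow> H \<bullet> G \<bullet> F = H \<bullet> (G \<bullet> F)"
  using comp_assoc[of "src F" "tgt F" "tgt G" "tgt H" "mor F" "mor G" "mor H"]
  by (intro arrow_eqI) (simp_all add: arr_def)

lemma acomp_id [simp]:
  "\<lbrakk>arr F; src F = X\<rbrakk> \<Longrightarrow> F \<bullet> \<I> X = F" "\<lbrakk>arr F; tgt F = X\<rbrakk> \<Longrightarrow> \<I> X \<bullet> F = F"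
  using idm_right[of "src F" "tgt F" "mor F"] idm_left[of "src F" "tgt F" "mor F"]
  by (auto intro: arrow_eqI simp: arr_def)

lemma interchange:
  "\<lbrakk>arr F; arr G; arr F'; arr G'; tgt F = src G; tgt F' = src G'\<rbrakk>
    \<Longrightarrow> (G || G') \<bullet> (F || F') = (G \<bullet> F) || (G' \<bullet> F')"
  using tmor_comp[of "src F" "tgt F" "tgt G" "src F'" "tgt F'" "tgt G'" "mor F" "mor G" "mor F'" "mor G'"]
  by (intro arrow_eqI) (simp_all add: arr_def)

lemma id_tens [simp]: "\<lbrakk>X \<in> Ob C; Y \<in> Ob C\<rbrakk> \<Longrightarrow> \<I> X || \<I> Y = \<I> (X \<boxtimes> Y)"
  by (rule arrow_eqI) (auto simp: tmor_idm)

lemma atens_assoc: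
  assumes "arr F" "arr G" "arr H" shows "F || G || H = F || (G || H)"
proof (rule arrow_eqI)
  have o: "src F \<in> Ob C" "src G \<in> Ob C" "src H \<in> Ob C" "tgt F \<in> Ob C" "tgt G \<in> Ob C" "tgt H \<in> Ob C"
    and t: "mor F \<in> Hom C (src F) (tgt F)" "mor G \<in> Hom C (src G) (tgt G)" "mor H \<in> Hom C (src H) (tgt H)"
    using assms by (simp_all add: arr_def)
  have 1: "mor F \<odot> mor G \<odot> mor H \<in> Hom C (src F \<boxtimes> (src G \<boxtimes> src H)) (tgt F \<boxtimes> (tgt G \<boxtimes> tgt H))"
    using tmor_in[OF _ _ _ _ tmor_in[OF _ _ _ _ t(1,2)] t(3)] o by simp
  have 2: "mor F \<odot> (mor G \<odot> mor H) \<in> Hom C (src F \<boxtimes> (src G \<boxtimes> src H)) (tgt F \<boxtimes> (tgt G \<boxtimes> tgt H))"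
    using tmor_in[OF _ _ _ _ t(1) tmor_in[OF _ _ _ _ t(2,3)]] o by simp
  show "mor (F || G || H) = mor (F || (G || H))"
    using assoc_natural[OF o t] idm_left[OF _ _ 1] idm_right[OF _ _ 2] o by (simp add: assoc_id)
qed (use assms in \<open>auto simp: arr_ob\<close>)

lemma id_tens_left [simp]:
  assumes "X \<in> Ob C" "Y \<in> Ob C" "arr F" shows "\<I> X || (\<I> Y || F) = \<I> (X \<boxtimes> Y) || F"
  using atens_assoc[of "\<I> X" "\<I> Y" F] assms by simp

lemma atens_unit [simp]: "arr F \<Longrightarrow> \<I> (unito C) || F = F" "arr F \<Longrightarrow> F || \<I> (unito C) = F"
  using unit_left_mor[of "src F" "tgt F" "mor F"] unit_right_mor[of "src F" "tgt F" "mor F"]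
  by (auto intro: arrow_eqI simp: arr_def)

lemma aadj_comp: "\<lbrakk>arr F; arr G; tgt F = src G\<rbrakk> \<Longrightarrow> (G \<bullet> F)\<dagger> = F\<dagger> \<bullet> G\<dagger>"
  using adj_comp[of "src F" "tgt F" "tgt G" "mor F" "mor G"]
  by (intro arrow_eqI) (simp_all add: arr_def)

lemma aadj_tens: "\<lbrakk>arr F; arr G\<rbrakk> \<Longrightarrow> (F || G)\<dagger> = F\<dagger> || G\<dagger>"
  using tmor_adj[of "src F" "tgt F" "src G" "tgt G" "mor F" "mor G"]
  by (intro arrow_eqI) (simp_all add: arr_def)

lemma aadj_aadj [simp]: "arr F \<Longrightarrow> (F\<dagger>)\<dagger> = F"
  using adj_adj[of "src F" "tgt F" "mor F"] by (intro arrow_eqI) (simp_all add: arr_def)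

lemma adj_idm: assumes "X \<in> Ob C" shows "adj C (\<iota> X) = \<iota> X"
proof -
  have i: "\<iota> X \<in> Hom C X X" using assms idm_in by blast
  have a: "adj C (\<iota> X) \<in> Hom C X X" using assms i adj_in by blast
  have "\<iota> X = adj C (adj C (\<iota> X))" using assms i by (simp add: adj_adj)
  also have "\<dots> = adj C (\<iota> X \<cdot> adj C (\<iota> X))" using assms a by (simp add: idm_left)
  also have "\<dots> = adj C (adj C (\<iota> X)) \<cdot> adj C (\<iota> X)" using assms a i by (simp add: adj_comp)
  also have "\<dots> = adj C (\<iota> X)" using assms a i by (simp add: adj_adj idm_left)
  finally show ?thesis by simp
qed

lemma aadj_id [simp]: "X \<in> Ob C \<Longrightarrow> (\<I> X)\<dagger> = \<I> X"
  by (rule arrow_eqI) (auto simp: adj_idm)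

lemma ascale_rules:
  "\<lbrakk>arr F; arr G; tgt F = src G\<rbrakk> \<Longrightarrow> (c *\<^sub>s G) \<bullet> F = c *\<^sub>s (G \<bullet> F)"
  "\<lbrakk>arr F; arr G; tgt F = src G\<rbrakk> \<Longrightarrow> G \<bullet> (c *\<^sub>s F) = c *\<^sub>s (G \<bullet> F)"
  "\<lbrakk>arr F; arr G\<rbrakk> \<Longrightarrow> (c *\<^sub>s F) || G = c *\<^sub>s (F || G)"
  "\<lbrakk>arr F; arr G\<rbrakk> \<Longrightarrow> F || (c *\<^sub>s G) = c *\<^sub>s (F || G)"
  "arr F \<Longrightarrow> (c *\<^sub>s F)\<dagger> = cnj c *\<^sub>s F\<dagger>"
  "c *\<^sub>s (d *\<^sub>s F) = (c * d) *\<^sub>s F"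
  using comp_smul_left[of "src F" "tgt F" "tgt G" "mor F" "mor G" c]
    comp_smul_right[of "src F" "tgt F" "tgt G" "mor F" "mor G" c]
    tmor_smul_left[of "src F" "tgt F" "src G" "tgt G" "mor F" "mor G" c]
    tmor_smul_right[of "src F" "tgt F" "src G" "tgt G" "mor F" "mor G" c]
    adj_smul[of "src F" "tgt F" "mor F" c]
  by (auto intro: arrow_eqI simp: arr_def)

declare arr_ob [simp]

lemma ascale_one [simp]: "1 *\<^sub>s F = F"
  by (auto intro!: arrow_eqI)

lemma comp_zero:
  assumes "X \<in> Ob C" "Y \<in> Ob C" "Z \<in> Ob C"
  shows "f \<in> Hom C X Y \<Longrightarrow> 0 \<in> Hom C Y Z \<Longrightarrow> 0 \<cdot> f = 0" "g \<in> Hom C Y Z \<Longrightarrow> g \<cdot> 0 = 0"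
  using comp_smul_left[OF assms, of f 0 0] comp_smul_right[OF assms zero_in, of g 0]
    zero_in assms by auto

lemma comp_sum_left:
  assumes "X \<in> Ob C" "Y \<in> Ob C" "Z \<in> Ob C" "f \<in> Hom C X Y" "\<And>i. i \<in> A \<Longrightarrow> g i \<in> Hom C Y Z"
  shows "(\<Sum>i\<in>A. g i) \<cdot> f = (\<Sum>i\<in>A. g i \<cdot> f)"
  using assms(5)
proof (induction A rule: infinite_finite_induct)
  case (insert i A)
  then show ?case
    using assms(1-4) by (simp add: comp_add_left[OF assms(1-4)] sum_in)
qed (use assms comp_zero zero_in in auto)

lemma comp_sum_right:
  assumes "X \<in> Ob C" "Y \<in> Ob C" "Z \<in> Ob C" "g \<in> Hom C Y Z" "\<And>i. i \<in> A \<Longrightarrow> f i \<in> Hom C X Y"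
  shows "g \<cdot> (\<Sum>i\<in>A. f i) = (\<Sum>i\<in>A. g \<cdot> f i)"
  using assms(5)
proof (induction A rule: infinite_finite_induct)
  case (insert i A)
  then show ?case
    using assms(1-4) by (simp add: comp_add_right[OF assms(1-3) _ _ assms(4)] sum_in)
qed (use assms comp_zero zero_in in auto)

lemma tmor_zero:
  assumes "X \<in> Ob C" "Y \<in> Ob C" "X' \<in> Ob C" "Y' \<in> Ob C"
  shows "f \<in> Hom C X' Y' \<Longrightarrow> 0 \<odot> f = 0" "f \<in> Hom C X Y \<Longrightarrow> f \<odot> 0 = 0"
  using tmor_smul_left[OF assms zero_in, of f 0] tmor_smul_right[OF assms _ zero_in, of f 0]
    assms by auto

lemma tmor_sum_left:
  assumes "X \<in> Ob C" "Y \<in> Ob C" "X' \<in> Ob C" "Y' \<in> Ob C" "f \<in> Hom C X' Y'"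
    "\<And>i. i \<in> A \<Longrightarrow> g i \<in> Hom C X Y"
  shows "(\<Sum>i\<in>A. g i) \<odot> f = (\<Sum>i\<in>A. g i \<odot> f)"
  using assms(6)
proof (induction A rule: infinite_finite_induct)
  case (insert i A)
  then show ?case
    using assms(1-5) by (simp add: tmor_add_left[OF assms(1-4)] sum_in)
qed (use assms tmor_zero in auto)

lemma tmor_sum_right:
  assumes "X \<in> Ob C" "Y \<in> Ob C" "X' \<in> Ob C" "Y' \<in> Ob C" "f \<in> Hom C X Y"
    "\<And>i. i \<in> A \<Longrightarrow> g i \<in> Hom C X' Y'"
  shows "f \<odot> (\<Sum>i\<in>A. g i) = (\<Sum>i\<in>A. f \<odot> g i)"
  using assms(6)
proof (induction A rule: infinite_finite_induct)
  case (insert i A)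
  then show ?case
    using assms(1-5) by (simp add: tmor_add_right[OF assms(1-4)] sum_in)
qed (use assms tmor_zero in auto)

lemma adj_sum:
  assumes "X \<in> Ob C" "Y \<in> Ob C" "\<And>i. i \<in> A \<Longrightarrow> f i \<in> Hom C X Y"
  shows "adj C (\<Sum>i\<in>A. f i) = (\<Sum>i\<in>A. adj C (f i))"
  using assms(3)
proof (induction A rule: infinite_finite_induct)
  case (insert i A)
  then show ?case
    using assms(1-2) by (simp add: adj_add[OF assms(1-2)] sum_in)
qed (use assms adj_smul[OF assms(1,2) zero_in, of 0] in auto)

section \<open>Products and adjoints with respect to an arbitrary natural associator\<close>

definition aadd :: "('o, 'm) arrow \<Rightarrow> ('o, 'm) arrow \<Rightarrow> ('o, 'm) arrow" (infixl "+\<^sub>a" 65) where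
  "F +\<^sub>a G = Arrow (src F) (tgt F) (mor F + mor G)"

lemma aadd_sel [simp]: "src (F +\<^sub>a G) = src F" "tgt (F +\<^sub>a G) = tgt F" "mor (F +\<^sub>a G) = mor F + mor G"
  by (simp_all add: aadd_def)

lemma arr_aadd [simp]: "\<lbrakk>arr F; arr G; src F = src G; tgt F = tgt G\<rbrakk> \<Longrightarrow> arr (F +\<^sub>a G)"
  using add_in[OF arr_ob arr_mor, of F "mor G"] arr_mor[of G] arr_ob[of F] by (simp add: aadd_def)

lemma aadd_rules:
  assumes "arr F" "arr F'" "src F = src F'" "tgt F = tgt F'"
  shows "\<lbrakk>arr G; tgt G = src F\<rbrakk> \<Longrightarrow> (F +\<^sub>a F') \<bullet> G = F \<bullet> G +\<^sub>a F' \<bullet> G"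
    and "\<lbrakk>arr G; src G = tgt F\<rbrakk> \<Longrightarrow> G \<bullet> (F +\<^sub>a F') = G \<bullet> F +\<^sub>a G \<bullet> F'"
    and "arr G \<Longrightarrow> (F +\<^sub>a F') || G = F || G +\<^sub>a F' || G"
    and "arr G \<Longrightarrow> G || (F +\<^sub>a F') = G || F +\<^sub>a G || F'"
    and "(F +\<^sub>a F')\<dagger> = F\<dagger> +\<^sub>a F'\<dagger>"
proof -
  note t = arr_ob[OF assms(1)] arr_mor[OF assms(1)] arr_mor[OF assms(2), folded assms(3,4)]
  show "(F +\<^sub>a F') \<bullet> G = F \<bullet> G +\<^sub>a F' \<bullet> G" if "arr G" "tgt G = src F"
    using comp_add_left[OF _ t(1,2) _ t(3,4), of "src G" "mor G"] arr_ob(1)[OF that(1)] arr_mor[OF that(1)]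
      that(2) by (intro arrow_eqI) simp_all
  show "G \<bullet> (F +\<^sub>a F') = G \<bullet> F +\<^sub>a G \<bullet> F'" if "arr G" "src G = tgt F"
    using comp_add_right[OF t(1,2) _ t(3,4), of "tgt G" "mor G"] arr_ob(2)[OF that(1)] arr_mor[OF that(1)]
      that(2) by (intro arrow_eqI) simp_all
  show "(F +\<^sub>a F') || G = F || G +\<^sub>a F' || G" if "arr G"
    using tmor_add_left[OF t(1,2) arr_ob[OF that] t(3,4) arr_mor[OF that]] by (intro arrow_eqI) simp_all
  show "G || (F +\<^sub>a F') = G || F +\<^sub>a G || F'" if "arr G"
    using tmor_add_right[OF arr_ob[OF that] t(1,2) arr_mor[OF that] t(3,4)] by (intro arrow_eqI) simp_all
  show "(F +\<^sub>a F')\<dagger> = F\<dagger> +\<^sub>a F'\<dagger>"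
    using adj_add[OF t] by (intro arrow_eqI) simp_all
qed

text \<open>
  Turns a commutation rule into one that also applies inside the right-nested composites produced by
  \<open>acomp_assoc\<close>.
\<close>

lemma acomp_slide:
  "\<lbrakk>A \<bullet> B = D \<bullet> E; arr A; arr B; arr D; arr E; arr R; tgt B = src A; tgt E = src D; tgt R = src B; src E = src B\<rbrakk>
    \<Longrightarrow> A \<bullet> (B \<bullet> R) = D \<bullet> (E \<bullet> R)"
  by (metis acomp_assoc)

definition assoc_arr :: "('o \<Rightarrow> 'o \<Rightarrow> 'o \<Rightarrow> 'm) \<Rightarrow> 'o \<Rightarrow> 'o \<Rightarrow> 'o \<Rightarrow> ('o, 'm) arrow" where
  "assoc_arr A X Y Z = Arrow (X \<boxtimes> (Y \<boxtimes> Z)) (X \<boxtimes> (Y \<boxtimes> Z)) (A X Y Z)"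

lemma assoc_arr_sel [simp]:
  "src (assoc_arr A X Y Z) = X \<boxtimes> (Y \<boxtimes> Z)" "tgt (assoc_arr A X Y Z) = X \<boxtimes> (Y \<boxtimes> Z)"
  "mor (assoc_arr A X Y Z) = A X Y Z"
  by (simp_all add: assoc_arr_def)

text \<open>
  The part of the associator axioms on which well-definedness of the product depends; it is shared by
  the strict and the twisted associator.
\<close>

definition natural_assoc :: "('o \<Rightarrow> 'o \<Rightarrow> 'o \<Rightarrow> 'm) \<Rightarrow> bool" where
  "natural_assoc A \<longleftrightarrow>
    (\<forall>X\<in>Ob C. \<forall>Y\<in>Ob C. \<forall>Z\<in>Ob C. arr (assoc_arr A X Y Z)) \<and>
    (\<forall>F G H. arr F \<longrightarrow> arr G \<longrightarrow> arr H \<longrightarrow>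
      assoc_arr A (tgt F) (tgt G) (tgt H) \<bullet> (F || (G || H)) = (F || (G || H)) \<bullet> assoc_arr A (src F) (src G) (src H))"

lemma arr_assocow:
  "\<lbrakk>natural_assoc A; X \<in> Ob C; Y \<in> Ob C; Z \<in> Ob C\<rbrakk> \<Longrightarrow> arr (assoc_arr A X Y Z)"
  by (simp add: natural_assoc_def)

lemma assoc_arr_natural:
  "\<lbrakk>natural_assoc A; arr F; arr G; arr H; X' = tgt F; Y' = tgt G; Z' = tgt H; X = src F; Y = src G; Z = src H\<rbrakk>
    \<Longrightarrow> assoc_arr A X' Y' Z' \<bullet> (F || (G || H)) = (F || (G || H)) \<bullet> assoc_arr A X Y Z"
  by (simp add: natural_assoc_def)

lemma assoc_arr_adj_natural:
  assumes "natural_assoc A" "arr F" "arr G" "arr H" "X' = tgt F" "Y' = tgt G" "Z' = tgt H" "X = src F" "Y = src G" "Z = src H"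
  shows "(assoc_arr A X' Y' Z')\<dagger> \<bullet> (F || (G || H)) = (F || (G || H)) \<bullet> (assoc_arr A X Y Z)\<dagger>"
proof -
  have "(assoc_arr A X Y Z \<bullet> (F\<dagger> || (G\<dagger> || H\<dagger>)))\<dagger> = ((F\<dagger> || (G\<dagger> || H\<dagger>)) \<bullet> assoc_arr A X' Y' Z')\<dagger>"
    using assms by (subst assoc_arr_natural[OF assms(1)]) simp_all
  then show ?thesis
    using assms(2-) by (simp add: aadj_comp aadj_tens arr_assocow[OF assms(1)])
qed

lemma natural_assoc_assoc: "natural_assoc (assoc C)"
proof -
  have "assoc_arr (assoc C) X Y Z = \<I> (X \<boxtimes> (Y \<boxtimes> Z))" if "X \<in> Ob C" "Y \<in> Ob C" "Z \<in> Ob C" for X Y Z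
    using that by (intro arrow_eqI) (simp_all add: assoc_id)
  then show ?thesis unfolding natural_assoc_def by simp
qed

definition arrow_mult :: "('o \<Rightarrow> 'o \<Rightarrow> 'o \<Rightarrow> 'm) \<Rightarrow> 'o \<Rightarrow> 'o \<Rightarrow> 'o \<Rightarrow> 'o \<Rightarrow> 'o \<Rightarrow>
    ('o, 'm) arrow \<Rightarrow> ('o, 'm) arrow \<Rightarrow> ('o, 'm) arrow" where
  "arrow_mult A Xm Xk Xj S T F F' = assoc_arr A Xm S T \<bullet> (F || \<I> T) \<bullet> (assoc_arr A S Xk T)\<dagger>
     \<bullet> (\<I> S || F') \<bullet> assoc_arr A S T Xj"

lemma mor_mult_arrow:
  "mor_mult (C\<lparr>assoc := A\<rparr>) X m k j S T f f' =
    mor (arrow_mult A (X m) (X k) (X j) S T (Arrow (S \<boxtimes> X k) (X m \<boxtimes> S) f) (Arrow (T \<boxtimes> X j) (X k \<boxtimes> T) f'))"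
  by (simp add: mor_mult_def arrow_mult_def)

context
  fixes A Xm Xk Xj
  assumes A: "natural_assoc A" and X: "Xm \<in> Ob C" "Xk \<in> Ob C" "Xj \<in> Ob C"
begin

text \<open>
  Precomposed to \<open>F\<close>, the morphism \<open>U\<close> can be moved to the right end of the product, past the associators by
  naturality; postcomposed, it can be moved to the left end. What remains is the same arrow \<open>H\<close> in both cases,
  so that two related left factors give related products.
\<close>

lemma arrow_mult_slide_left:
  assumes "arr F" "arr F'" "arr U" "T \<in> Ob C"
    "src F = tgt U \<boxtimes> Xk" "tgt F = Xm \<boxtimes> src U" "src F' = T \<boxtimes> Xj" "tgt F' = Xk \<boxtimes> T"
  shows "\<exists>H. arr H \<and> src H = (tgt U \<boxtimes> T) \<boxtimes> Xj \<and> tgt H = Xm \<boxtimes> (src U \<boxtimes> T) \<and>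
    arrow_mult A Xm Xk Xj (src U) T (F \<bullet> (U || \<I> Xk)) F' = H \<bullet> ((U || \<I> T) || \<I> Xj) \<and>
    arrow_mult A Xm Xk Xj (tgt U) T ((\<I> Xm || U) \<bullet> F) F' = (\<I> Xm || (U || \<I> T)) \<bullet> H"
proof -
  define H where "H = assoc_arr A Xm (src U) T \<bullet> (F || \<I> T) \<bullet> (assoc_arr A (tgt U) Xk T)\<dagger>
     \<bullet> (\<I> (tgt U) || F') \<bullet> assoc_arr A (tgt U) T Xj"
  note a = assms X arr_assocow[OF A]
  have e0: "(F \<bullet> (U || \<I> Xk)) || \<I> T = (F || \<I> T) \<bullet> (U || \<I> (Xk \<boxtimes> T))"
    using interchange[of "U || \<I> Xk" F "\<I> T" "\<I> T"] a by (simp add: atens_assoc)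
  have e1: "(U || \<I> (Xk \<boxtimes> T)) \<bullet> (assoc_arr A (src U) Xk T)\<dagger> = (assoc_arr A (tgt U) Xk T)\<dagger> \<bullet> (U || \<I> (Xk \<boxtimes> T))"
    using assoc_arr_adj_natural[OF A, of U "\<I> Xk" "\<I> T"] a by simp
  have e2: "(U || \<I> (Xk \<boxtimes> T)) \<bullet> (\<I> (src U) || F') = (\<I> (tgt U) || F') \<bullet> (U || \<I> (T \<boxtimes> Xj))"
    using a by (simp add: interchange)
  have e3: "(U || \<I> (T \<boxtimes> Xj)) \<bullet> assoc_arr A (src U) T Xj = assoc_arr A (tgt U) T Xj \<bullet> (U || \<I> (T \<boxtimes> Xj))"
    using assoc_arr_natural[OF A, of U "\<I> T" "\<I> Xj"] a by simp
  have d0: "((\<I> Xm || U) \<bullet> F) || \<I> T = (\<I> Xm || (U || \<I> T)) \<bullet> (F || \<I> T)"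
    using interchange[of F "\<I> Xm || U" "\<I> T" "\<I> T"] a by (simp add: atens_assoc)
  have d1: "assoc_arr A Xm (tgt U) T \<bullet> (\<I> Xm || (U || \<I> T)) = (\<I> Xm || (U || \<I> T)) \<bullet> assoc_arr A Xm (src U) T"
    using assoc_arr_natural[OF A, of "\<I> Xm" U "\<I> T"] a by simp
  have "arr H" "src H = (tgt U \<boxtimes> T) \<boxtimes> Xj" "tgt H = Xm \<boxtimes> (src U \<boxtimes> T)"
    unfolding H_def using a by simp_all
  moreover have "arrow_mult A Xm Xk Xj (src U) T (F \<bullet> (U || \<I> Xk)) F' = H \<bullet> ((U || \<I> T) || \<I> Xj)"
    unfolding arrow_mult_def H_def e0 using a
    by (simp add: acomp_assoc atens_assoc e3 acomp_slide[OF e1] acomp_slide[OF e2])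
  moreover have "arrow_mult A Xm Xk Xj (tgt U) T ((\<I> Xm || U) \<bullet> F) F' = (\<I> Xm || (U || \<I> T)) \<bullet> H"
    unfolding arrow_mult_def H_def d0 using a
    by (simp add: acomp_assoc acomp_slide[OF d1])
  ultimately show ?thesis by blast
qed

text \<open>
  The analogue for the right factor, with \<open>U\<close> tensored by the object \<open>S\<close> of the left factor.
\<close>

lemma arrow_mult_slide_right:
  assumes "arr F" "arr F'" "arr U" "S \<in> Ob C"
    "src F = S \<boxtimes> Xk" "tgt F = Xm \<boxtimes> S" "src F' = tgt U \<boxtimes> Xj" "tgt F' = Xk \<boxtimes> src U"
  shows "\<exists>H. arr H \<and> src H = (S \<boxtimes> tgt U) \<boxtimes> Xj \<and> tgt H = Xm \<boxtimes> (S \<boxtimes> src U) \<and>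
    arrow_mult A Xm Xk Xj S (src U) F (F' \<bullet> (U || \<I> Xj)) = H \<bullet> ((\<I> S || U) || \<I> Xj) \<and>
    arrow_mult A Xm Xk Xj S (tgt U) F ((\<I> Xk || U) \<bullet> F') = (\<I> Xm || (\<I> S || U)) \<bullet> H"
proof -
  define H where "H = assoc_arr A Xm S (src U) \<bullet> (F || \<I> (src U)) \<bullet> (assoc_arr A S Xk (src U))\<dagger>
     \<bullet> (\<I> S || F') \<bullet> assoc_arr A S (tgt U) Xj"
  note a = assms X arr_assocow[OF A]
  have e0: "\<I> S || (F' \<bullet> (U || \<I> Xj)) = (\<I> S || F') \<bullet> (\<I> S || (U || \<I> Xj))"
    using interchange[of "\<I> S" "\<I> S" "U || \<I> Xj" F'] a by simp
  have e3: "(\<I> S || (U || \<I> Xj)) \<bullet> assoc_arr A S (src U) Xj = assoc_arr A S (tgt U) Xj \<bullet> (\<I> S || (U || \<I> Xj))"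
    using assoc_arr_natural[OF A, of "\<I> S" U "\<I> Xj"] a by simp
  have d0: "\<I> S || ((\<I> Xk || U) \<bullet> F') = (\<I> (S \<boxtimes> Xk) || U) \<bullet> (\<I> S || F')"
    using interchange[of "\<I> S" "\<I> S" F' "\<I> Xk || U"] a by simp
  have d1: "(assoc_arr A S Xk (tgt U))\<dagger> \<bullet> (\<I> (S \<boxtimes> Xk) || U) = (\<I> (S \<boxtimes> Xk) || U) \<bullet> (assoc_arr A S Xk (src U))\<dagger>"
    using assoc_arr_adj_natural[OF A, of "\<I> S" "\<I> Xk" U] a by simp
  have d2: "(F || \<I> (tgt U)) \<bullet> (\<I> (S \<boxtimes> Xk) || U) = (\<I> (Xm \<boxtimes> S) || U) \<bullet> (F || \<I> (src U))"
    using a by (simp add: interchange)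
  have d3: "assoc_arr A Xm S (tgt U) \<bullet> (\<I> (Xm \<boxtimes> S) || U) = (\<I> (Xm \<boxtimes> S) || U) \<bullet> assoc_arr A Xm S (src U)"
    using assoc_arr_natural[OF A, of "\<I> Xm" "\<I> S" U] a by simp
  have "arr H" "src H = (S \<boxtimes> tgt U) \<boxtimes> Xj" "tgt H = Xm \<boxtimes> (S \<boxtimes> src U)"
    unfolding H_def using a by simp_all
  moreover have "arrow_mult A Xm Xk Xj S (src U) F (F' \<bullet> (U || \<I> Xj)) = H \<bullet> ((\<I> S || U) || \<I> Xj)"
    unfolding arrow_mult_def H_def e0 using a
    by (simp add: acomp_assoc atens_assoc e3)
  moreover have "arrow_mult A Xm Xk Xj S (tgt U) F ((\<I> Xk || U) \<bullet> F') = (\<I> Xm || (\<I> S || U)) \<bullet> H"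
    unfolding arrow_mult_def H_def d0 using a
    by (simp add: acomp_assoc acomp_slide[OF d1] acomp_slide[OF d2] acomp_slide[OF d3])
  ultimately show ?thesis by blast
qed

end

text \<open>
  The involution on arrows. The arguments \<open>E\<close> and \<open>G\<close> stand for \<open>R\<^sup>*\<close> and \<open>f\<^sup>*\<close>, which makes the
  expression linear in each argument.
\<close>

definition arrow_star :: "('o \<Rightarrow> 'o \<Rightarrow> 'o \<Rightarrow> 'm) \<Rightarrow> 'o \<Rightarrow> 'o \<Rightarrow> 'o \<Rightarrow> 'o \<Rightarrow>
    ('o, 'm) arrow \<Rightarrow> ('o, 'm) arrow \<Rightarrow> ('o, 'm) arrow \<Rightarrow> ('o, 'm) arrow" where
  "arrow_star A Z S Xk Xj E B G = (((E || \<I> Xj) \<bullet> (assoc_arr A Z S Xj)\<dagger>) || \<I> Z)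
     \<bullet> ((\<I> Z || G) || \<I> Z) \<bullet> (assoc_arr A Z (Xk \<boxtimes> S) Z)\<dagger>
     \<bullet> (\<I> Z || ((assoc_arr A Xk S Z)\<dagger> \<bullet> (\<I> Xk || B)))"

lemma mor_star_arrow:
  "mor_star (C\<lparr>assoc := A\<rparr>) dual R Rb X k j S f =
    mor (arrow_star A (dual S) S (X k) (X j) ((Arrow (unito C) (dual S \<boxtimes> S) (R S))\<dagger>)
      (Arrow (unito C) (S \<boxtimes> dual S) (Rb S)) ((Arrow (S \<boxtimes> X j) (X k \<boxtimes> S) f)\<dagger>))"
  by (simp add: mor_star_def arrow_star_def)

definition strict_star :: "'o \<Rightarrow> 'o \<Rightarrow> 'o \<Rightarrow> 'o \<Rightarrow>
    ('o, 'm) arrow \<Rightarrow> ('o, 'm) arrow \<Rightarrow> ('o, 'm) arrow \<Rightarrow> ('o, 'm) arrow" where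
  "strict_star Z S Xk Xj E B G = (E || \<I> (Xj \<boxtimes> Z)) \<bullet> (\<I> Z || (G || \<I> Z)) \<bullet> (\<I> (Z \<boxtimes> Xk) || B)"

text \<open>
  Only the typing of an evaluation and a coevaluation: the strict and the twisted category impose different
  equations on them.
\<close>

definition dual_pair :: "'o \<Rightarrow> 'o \<Rightarrow> ('o, 'm) arrow \<Rightarrow> ('o, 'm) arrow \<Rightarrow> bool" where
  "dual_pair Z S E B \<longleftrightarrow> Z \<in> Ob C \<and> S \<in> Ob C \<and> arr E \<and> arr B \<and> src E = Z \<boxtimes> S \<and> tgt E = unito C \<and>
     src B = unito C \<and> tgt B = S \<boxtimes> Z"

lemma dual_pairD:
  assumes "dual_pair Z S E B"
  shows "Z \<in> Ob C" "S \<in> Ob C" "arr E" "arr B" "src E = Z \<boxtimes> S" "tgt E = unito C" "src B = unito C" "tgt B = S \<boxtimes> Z"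
  using assms by (simp_all add: dual_pair_def)

definition zigzag :: "'o \<Rightarrow> ('o, 'm) arrow \<Rightarrow> ('o, 'm) arrow \<Rightarrow> bool" where
  "zigzag S E B \<longleftrightarrow> (\<I> S || E) \<bullet> (B || \<I> S) = \<I> S"

lemma assoc_arr_assoc: "\<lbrakk>X \<in> Ob C; Y \<in> Ob C; Z \<in> Ob C\<rbrakk> \<Longrightarrow> assoc_arr (assoc C) X Y Z = \<I> (X \<boxtimes> (Y \<boxtimes> Z))"
  by (intro arrow_eqI) (simp_all add: assoc_id)

lemma arrow_star_strict:
  assumes "dual_pair Z S E B" "Xk \<in> Ob C" "Xj \<in> Ob C" "arr G" "src G = Xk \<boxtimes> S" "tgt G = S \<boxtimes> Xj"
  shows "arrow_star (assoc C) Z S Xk Xj E B G = strict_star Z S Xk Xj E B G"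
  using dual_pairD[OF assms(1)] assms(2-)
  by (simp add: arrow_star_def strict_star_def assoc_arr_assoc atens_assoc)

lemma arr_strict_star:
  assumes "dual_pair Z S E B" "Xk \<in> Ob C" "Xj \<in> Ob C" "arr G" "src G = Xk \<boxtimes> S" "tgt G = S \<boxtimes> Xj"
  shows "arr (strict_star Z S Xk Xj E B G)" "src (strict_star Z S Xk Xj E B G) = Z \<boxtimes> Xk" "tgt (strict_star Z S Xk Xj E B G) = Xj \<boxtimes> Z"
  using dual_pairD[OF assms(1)] assms(2-) by (simp_all add: strict_star_def)

lemma arr_arrow_star:
  assumes "natural_assoc A" "dual_pair Z S E B" "Xk \<in> Ob C" "Xj \<in> Ob C" "arr G" "src G = Xk \<boxtimes> S" "tgt G = S \<boxtimes> Xj"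
  shows "arr (arrow_star A Z S Xk Xj E B G)" "src (arrow_star A Z S Xk Xj E B G) = Z \<boxtimes> Xk" "tgt (arrow_star A Z S Xk Xj E B G) = Xj \<boxtimes> Z"
  using dual_pairD[OF assms(2)] assms(3-) arr_assocow[OF assms(1)] by (simp_all add: arrow_star_def)

text \<open>
  The arrow \<open>V\<close> is the conjugate of \<open>U\<close> with respect to the two solutions. The zigzag equations let \<open>U\<close> be
  traded for \<open>V\<close> at the evaluation (\<open>f1\<close>) and at the coevaluation (\<open>f2\<close>); both adjoints then contain the
  same arrow \<open>H\<close>, built from the evaluation of \<open>T\<close> and the coevaluation of \<open>S\<close>.
\<close>

lemma strict_star_slide:
  assumes Z: "dual_pair Z S E B" "zigzag S E B" and W: "dual_pair W T P D" "zigzag T P D"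
    and X: "Xk \<in> Ob C" "Xj \<in> Ob C" and U: "arr U" "src U = T" "tgt U = S" and G: "arr G" "src G = Xk \<boxtimes> S" "tgt G = T \<boxtimes> Xj"
  shows "\<exists>V H. arr V \<and> src V = Z \<and> tgt V = W \<and> arr H \<and> src H = W \<boxtimes> Xk \<and> tgt H = Xj \<boxtimes> Z \<and>
    strict_star Z S Xk Xj E B ((U || \<I> Xj) \<bullet> G) = H \<bullet> (V || \<I> Xk) \<and>
    strict_star W T Xk Xj P D (G \<bullet> (\<I> Xk || U)) = (\<I> Xj || V) \<bullet> H"
proof -
  note a = dual_pairD[OF Z(1)] dual_pairD[OF W(1)] X U G
  define Q where "Q = E \<bullet> (\<I> Z || U)"
  define V where "V = (Q || \<I> W) \<bullet> (\<I> Z || D)"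
  define H where "H = (P || \<I> (Xj \<boxtimes> Z)) \<bullet> (\<I> W || (G || \<I> Z)) \<bullet> (\<I> (W \<boxtimes> Xk) || B)"
  have Q: "arr Q" "src Q = Z \<boxtimes> T" "tgt Q = unito C" using a by (simp_all add: Q_def)
  have V: "arr V" "src V = Z" "tgt V = W" using a Q by (simp_all add: V_def)
  have H: "arr H" "src H = W \<boxtimes> Xk" "tgt H = Xj \<boxtimes> Z" using a by (simp_all add: H_def)
  note a = a Q
  have f1: "P \<bullet> (V || \<I> T) = Q"
  proof -
    have "V || \<I> T = (Q || \<I> (W \<boxtimes> T)) \<bullet> (\<I> Z || (D || \<I> T))"
      using interchange[of "\<I> Z || D" "Q || \<I> W" "\<I> T" "\<I> T"] a by (simp add: V_def atens_assoc)
    moreover have "P \<bullet> (Q || \<I> (W \<boxtimes> T)) = Q \<bullet> (\<I> (Z \<boxtimes> T) || P)"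
      using interchange[of Q "\<I> (unito C)" "\<I> (W \<boxtimes> T)" P] interchange[of "\<I> (Z \<boxtimes> T)" Q P "\<I> (unito C)"] a by simp
    moreover have "(\<I> (Z \<boxtimes> T) || P) \<bullet> (\<I> Z || (D || \<I> T)) = \<I> (Z \<boxtimes> T)"
      using interchange[of "\<I> Z" "\<I> Z" "D || \<I> T" "\<I> T || P"] a W(2) by (simp add: zigzag_def)
    ultimately show ?thesis using a
      by (simp add: acomp_slide[of P "Q || \<I> (W \<boxtimes> T)" Q "\<I> (Z \<boxtimes> T) || P"])
  qed
  have f2: "(\<I> S || V) \<bullet> B = (U || \<I> W) \<bullet> D"
  proof -
    have 1: "\<I> S || V = (\<I> S || (Q || \<I> W)) \<bullet> (\<I> (S \<boxtimes> Z) || D)"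
      using interchange[of "\<I> S" "\<I> S" "\<I> Z || D" "Q || \<I> W"] a by (simp add: V_def)
    have 2: "(\<I> (S \<boxtimes> Z) || D) \<bullet> B = (B || \<I> (T \<boxtimes> W)) \<bullet> D"
      using interchange[of B "\<I> (S \<boxtimes> Z)" "\<I> (unito C)" D] interchange[of "\<I> (unito C)" B D "\<I> (T \<boxtimes> W)"] a by simp
    have 3: "(\<I> S || Q) \<bullet> (B || \<I> T) = U"
    proof -
      have "\<I> S || Q = (\<I> S || E) \<bullet> (\<I> (S \<boxtimes> Z) || U)"
        using interchange[of "\<I> S" "\<I> S" "\<I> Z || U" E] a by (simp add: Q_def)
      moreover have "(\<I> (S \<boxtimes> Z) || U) \<bullet> (B || \<I> T) = (B || \<I> S) \<bullet> U"
        using interchange[of B "\<I> (S \<boxtimes> Z)" "\<I> T" U] interchange[of "\<I> (unito C)" B U "\<I> S"] a by simp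
      ultimately show ?thesis
        using a Z(2) acomp_assoc[of U "B || \<I> S" "\<I> S || E"]
         acomp_assoc[of "B || \<I> T" "\<I> (S \<boxtimes> Z) || U" "\<I> S || E"] by (simp add: zigzag_def)
    qed
    have 4: "(\<I> S || (Q || \<I> W)) \<bullet> (B || \<I> (T \<boxtimes> W)) = U || \<I> W"
      using interchange[of "B || \<I> T" "\<I> S || Q" "\<I> W" "\<I> W"] a 3 by (simp add: atens_assoc)
    have "(\<I> S || V) \<bullet> B = (\<I> S || (Q || \<I> W)) \<bullet> ((\<I> (S \<boxtimes> Z) || D) \<bullet> B)"
      unfolding 1 using a by (simp add: acomp_assoc)
    also have "\<dots> = (\<I> S || (Q || \<I> W)) \<bullet> (B || \<I> (T \<boxtimes> W)) \<bullet> D"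
      unfolding 2 using a by (simp add: acomp_assoc)
    finally show ?thesis unfolding 4 .
  qed
  note b = a V
  have "strict_star Z S Xk Xj E B ((U || \<I> Xj) \<bullet> G) = H \<bullet> (V || \<I> Xk)"
  proof -
    have 1: "\<I> Z || (((U || \<I> Xj) \<bullet> G) || \<I> Z) = (\<I> Z || (U || \<I> (Xj \<boxtimes> Z))) \<bullet> (\<I> Z || (G || \<I> Z))"
      using interchange[of G "U || \<I> Xj" "\<I> Z" "\<I> Z"] interchange[of "\<I> Z" "\<I> Z" "G || \<I> Z" "U || \<I> (Xj \<boxtimes> Z)"] b
      by (simp add: atens_assoc)
    have 2: "(E || \<I> (Xj \<boxtimes> Z)) \<bullet> (\<I> Z || (U || \<I> (Xj \<boxtimes> Z))) = (P || \<I> (Xj \<boxtimes> Z)) \<bullet> (V || \<I> (T \<boxtimes> (Xj \<boxtimes> Z)))"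
      using interchange[of "\<I> Z || U" E "\<I> (Xj \<boxtimes> Z)" "\<I> (Xj \<boxtimes> Z)"] f1[unfolded Q_def]
        interchange[of "V || \<I> T" P "\<I> (Xj \<boxtimes> Z)" "\<I> (Xj \<boxtimes> Z)"] b by (simp add: atens_assoc)
    have 3: "(V || \<I> (T \<boxtimes> (Xj \<boxtimes> Z))) \<bullet> (\<I> Z || (G || \<I> Z)) = (\<I> W || (G || \<I> Z)) \<bullet> (V || \<I> (Xk \<boxtimes> (S \<boxtimes> Z)))"
      using b by (simp add: interchange)
    have 4: "(V || \<I> (Xk \<boxtimes> (S \<boxtimes> Z))) \<bullet> (\<I> (Z \<boxtimes> Xk) || B) = (\<I> (W \<boxtimes> Xk) || B) \<bullet> (V || \<I> Xk)"
      using interchange[of "\<I> (Z \<boxtimes> Xk)" "V || \<I> Xk" B "\<I> (S \<boxtimes> Z)"]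
        interchange[of "V || \<I> Xk" "\<I> (W \<boxtimes> Xk)" "\<I> (unito C)" B] b by (simp add: atens_assoc)
    show ?thesis unfolding strict_star_def 1 H_def using b
      by (simp add: acomp_assoc acomp_slide[OF 2] acomp_slide[OF 3] 4)
  qed
  moreover have "strict_star W T Xk Xj P D (G \<bullet> (\<I> Xk || U)) = (\<I> Xj || V) \<bullet> H"
  proof -
    have 1: "\<I> W || ((G \<bullet> (\<I> Xk || U)) || \<I> W) = (\<I> W || (G || \<I> W)) \<bullet> (\<I> (W \<boxtimes> Xk) || (U || \<I> W))"
      using interchange[of "\<I> Xk || U" G "\<I> W" "\<I> W"]
        interchange[of "\<I> W" "\<I> W" "\<I> Xk || (U || \<I> W)" "G || \<I> W"] b
      by (simp add: atens_assoc)
    have 2: "(\<I> (W \<boxtimes> Xk) || (U || \<I> W)) \<bullet> (\<I> (W \<boxtimes> Xk) || D) = (\<I> (W \<boxtimes> (Xk \<boxtimes> S)) || V) \<bullet> (\<I> (W \<boxtimes> Xk) || B)"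
      using interchange[of "\<I> (W \<boxtimes> Xk)" "\<I> (W \<boxtimes> Xk)" D "U || \<I> W"] f2
        interchange[of "\<I> (W \<boxtimes> Xk)" "\<I> (W \<boxtimes> Xk)" B "\<I> S || V"] b by simp
    have 3: "(\<I> W || (G || \<I> W)) \<bullet> (\<I> (W \<boxtimes> (Xk \<boxtimes> S)) || V) = (\<I> (W \<boxtimes> (T \<boxtimes> Xj)) || V) \<bullet> (\<I> W || (G || \<I> Z))"
      using interchange[of "\<I> (W \<boxtimes> (Xk \<boxtimes> S))" "\<I> W || G" V "\<I> W"]
        interchange[of "\<I> W || G" "\<I> (W \<boxtimes> (T \<boxtimes> Xj))" "\<I> Z" V] b by (simp add: atens_assoc)
    have 4: "(P || \<I> (Xj \<boxtimes> W)) \<bullet> (\<I> (W \<boxtimes> (T \<boxtimes> Xj)) || V) = (\<I> Xj || V) \<bullet> (P || \<I> (Xj \<boxtimes> Z))"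
      using interchange[of "\<I> (W \<boxtimes> T)" P "\<I> Xj || V" "\<I> (Xj \<boxtimes> W)"]
        interchange[of P "\<I> (unito C)" "\<I> (Xj \<boxtimes> Z)" "\<I> Xj || V"] b by simp
    show ?thesis unfolding strict_star_def 1 H_def using b
      by (simp add: acomp_assoc 2 acomp_slide[OF 3] acomp_slide[OF 4])
  qed
  ultimately show ?thesis using V H by blast
qed

lemma arrow_star_linear:
  assumes "natural_assoc A" "dual_pair Z S E B" "Xk \<in> Ob C" "Xj \<in> Ob C" "arr G" "src G = Xk \<boxtimes> S" "tgt G = S \<boxtimes> Xj"
  shows "arrow_star A Z S Xk Xj E B (c *\<^sub>s G) = c *\<^sub>s arrow_star A Z S Xk Xj E B G"
    and "\<lbrakk>arr G'; src G' = Xk \<boxtimes> S; tgt G' = S \<boxtimes> Xj\<rbrakk> \<Longrightarrow>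
      arrow_star A Z S Xk Xj E B (G +\<^sub>a G') = arrow_star A Z S Xk Xj E B G +\<^sub>a arrow_star A Z S Xk Xj E B G'"
  using dual_pairD[OF assms(2)] assms(3-) arr_assocow[OF assms(1)]
  by (simp_all add: arrow_star_def ascale_rules aadd_rules)

end

section \<open>Projections onto the homogeneous components\<close>

locale strict_graded_category = \<Gamma>: group \<Gamma> + strict_tensor_category C + graded_category \<Gamma> C Gr
  for \<Gamma> :: "('g, 'z) monoid_scheme" and C :: "('o, 'm::ab_group_add) tensor_cat" (structure)
    and Gr :: "'g \<Rightarrow> 'o set"
begin

lemma homogeneous_resolution:
  assumes "X \<in> Ob C"
  obtains n :: nat and \<gamma> Y u where
    "\<And>i. i < n \<Longrightarrow> \<gamma> i \<in> carrier \<Gamma>" "\<And>i. i < n \<Longrightarrow> Y i \<in> Gr (\<gamma> i)" "\<And>i. i < n \<Longrightarrow> Y i \<in> Ob C"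
    "\<And>i. i < n \<Longrightarrow> u i \<in> Hom C (Y i) X" "(\<Sum>i<n. u i \<cdot> adj C (u i)) = \<iota> X"
proof -
  obtain n :: nat and \<gamma> Y u where *: "\<forall>i<n. \<gamma> i \<in> carrier \<Gamma> \<and> Y i \<in> Gr (\<gamma> i) \<and> u i \<in> Hom C (Y i) X"
    "(\<Sum>i<n. u i \<cdot> adj C (u i)) = \<iota> X"
    using Gr_direct_sum[OF assms] by blast
  moreover from * have "\<forall>i<n. Y i \<in> Ob C" using Gr_Ob by blast
  ultimately show ?thesis using that[of n \<gamma> Y u] by blast
qed

text \<open>
  The identity of \<open>X\<close> is the sum of the \<open>u\<^sub>i u\<^sub>i\<^sup>*\<close> of a homogeneous decomposition, so a morphism is
  determined by its composites with the \<open>u\<^sub>i\<close>.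
\<close>

lemma homogeneous_ext:
  assumes "X \<in> Ob C" "Z \<in> Ob C" and p: "p \<in> Hom C X Z" "q \<in> Hom C X Z"
    and eq: "\<And>\<eta> Y u. \<eta> \<in> carrier \<Gamma> \<Longrightarrow> Y \<in> Gr \<eta> \<Longrightarrow> Y \<in> Ob C \<Longrightarrow> u \<in> Hom C Y X \<Longrightarrow> p \<cdot> u = q \<cdot> u"
  shows "p = q"
proof -
  obtain n :: nat and \<gamma> Y u where
    d: "\<And>i. i < n \<Longrightarrow> \<gamma> i \<in> carrier \<Gamma>" "\<And>i. i < n \<Longrightarrow> Y i \<in> Gr (\<gamma> i)" "\<And>i. i < n \<Longrightarrow> Y i \<in> Ob C"
    "\<And>i. i < n \<Longrightarrow> u i \<in> Hom C (Y i) X" "(\<Sum>i<n. u i \<cdot> adj C (u i)) = \<iota> X"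
    by (rule homogeneous_resolution[OF assms(1)]) blast
  have "r = (\<Sum>i<n. (r \<cdot> u i) \<cdot> adj C (u i))" if r: "r \<in> Hom C X Z" for r
  proof -
    have "r = r \<cdot> (\<Sum>i<n. u i \<cdot> adj C (u i))"
      using idm_right[OF assms(1,2) r] d(5) by simp
    also have "\<dots> = (\<Sum>i<n. r \<cdot> (u i \<cdot> adj C (u i)))"
    proof (rule comp_sum_right[OF assms(1,1,2) r])
      fix i assume "i \<in> {..<n}"
      then show "u i \<cdot> adj C (u i) \<in> Hom C X X"
        using comp_in[OF assms(1) d(3) assms(1) adj_in[OF d(3) assms(1) d(4)] d(4)] by simp
    qed
    also have "\<dots> = (\<Sum>i<n. (r \<cdot> u i) \<cdot> adj C (u i))"
      by (rule sum.cong[OF refl])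
        (simp add: comp_assoc[OF assms(1) d(3) assms(1,2) adj_in[OF d(3) assms(1) d(4)] d(4) r])
    finally show ?thesis .
  qed
  from this[OF p(1)] this[OF p(2)] show ?thesis
    using eq[OF d(1-4)] by simp
qed

abbreviation proj :: "'g \<Rightarrow> 'o \<Rightarrow> 'm" where
  "proj \<equiv> degree_proj \<Gamma> C Gr"

abbreviation degs :: "'o \<Rightarrow> 'g set" where
  "degs \<equiv> degrees \<Gamma> C Gr"

abbreviation group_mult :: "'g \<Rightarrow> 'g \<Rightarrow> 'g"  (infixl "\<otimes>\<^sub>\<Gamma>" 70) where
  "a \<otimes>\<^sub>\<Gamma> b \<equiv> a \<otimes>\<^bsub>\<Gamma>\<^esub> b"

abbreviation group_inv :: "'g \<Rightarrow> 'g"  ("inv\<^sub>\<Gamma> _" [81] 80) where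
  "inv\<^sub>\<Gamma> a \<equiv> inv\<^bsub>\<Gamma>\<^esub> a"

lemma proj_unique:
  assumes "X \<in> Ob C" and p: "p \<in> Hom C X X"
    and "\<And>\<eta> Y u. \<eta> \<in> carrier \<Gamma> \<Longrightarrow> Y \<in> Gr \<eta> \<Longrightarrow> Y \<in> Ob C \<Longrightarrow> u \<in> Hom C Y X
       \<Longrightarrow> p \<cdot> u = (if \<eta> = \<gamma> then u else 0)"
  shows "proj \<gamma> X = p"
  unfolding degree_proj_def
proof (rule the_equality)
  show "p \<in> Hom C X X \<and>
    (\<forall>\<eta>\<in>carrier \<Gamma>. \<forall>Y\<in>Gr \<eta>. \<forall>u\<in>Hom C Y X. p \<cdot> u = (if \<eta> = \<gamma> then u else 0))"
    using p assms(3) Gr_Ob by blast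
  fix q
  assume q: "q \<in> Hom C X X \<and>
    (\<forall>\<eta>\<in>carrier \<Gamma>. \<forall>Y\<in>Gr \<eta>. \<forall>u\<in>Hom C Y X. q \<cdot> u = (if \<eta> = \<gamma> then u else 0))"
  show "q = p"
    by (rule homogeneous_ext[OF assms(1,1)]) (use q p assms(3) in auto)
qed

lemma Gr_orth: 
  "\<lbrakk>\<gamma> \<in> carrier \<Gamma>; \<eta> \<in> carrier \<Gamma>; \<gamma> \<noteq> \<eta>; X \<in> Gr \<gamma>; Y \<in> Gr \<eta>; f \<in> Hom C X Y\<rbrakk> \<Longrightarrow> f = 0"
  using Gr_orthogonal by blast

text \<open>
  For \<open>v\<close> of degree \<open>\<eta>\<close>, the terms \<open>u\<^sub>i u\<^sub>i\<^sup>* v\<close> with \<open>\<gamma>\<^sub>i \<noteq> \<eta>\<close> vanish by orthogonality of the grading, and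
  the other ones add up to \<open>v\<close>. This identifies the projection, which is then visibly self-adjoint.
\<close>

lemma proj_explicit:
  assumes X: "X \<in> Ob C" and g: "g \<in> carrier \<Gamma>"
    and d: "\<And>i. i < n \<Longrightarrow> \<gamma> i \<in> carrier \<Gamma>" "\<And>i. i < n \<Longrightarrow> Y i \<in> Gr (\<gamma> i)" "\<And>i. i < n \<Longrightarrow> Y i \<in> Ob C"
    "\<And>i. i < n \<Longrightarrow> u i \<in> Hom C (Y i) X" "(\<Sum>i<n. u i \<cdot> adj C (u i)) = \<iota> X"
  defines "p \<equiv> \<Sum>i<(n::nat). if \<gamma> i = g then u i \<cdot> adj C (u i) else 0"
  shows "proj g X = p" and "p \<in> Hom C X X" and "adj C p = p"
    and "\<lbrakk>\<eta> \<in> carrier \<Gamma>; Z \<in> Gr \<eta>; v \<in> Hom C Z X\<rbrakk> \<Longrightarrow> p \<cdot> v = (if \<eta> = g then v else 0)"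
proof -
  have uu: "u i \<cdot> adj C (u i) \<in> Hom C X X" if "i < n" for i
    using that X d by (intro comp_in[of X "Y i" X]) (auto intro!: adj_in)
  show P: "p \<in> Hom C X X"
    unfolding p_def using uu X by (intro sum_in) (auto simp: zero_in)
  have "adj C (u i \<cdot> adj C (u i)) = u i \<cdot> adj C (u i)" if "i < n" for i
    using adj_comp[OF X d(3) X adj_in[OF d(3) X d(4)] d(4)] adj_adj[OF d(3) X d(4)] that by simp
  moreover have "adj C 0 = 0" using adj_smul[OF X X zero_in, of 0] X by simp
  moreover have "adj C p = (\<Sum>i<n. adj C (if \<gamma> i = g then u i \<cdot> adj C (u i) else 0))"
    unfolding p_def using uu X by (intro adj_sum[of X X]) (auto simp: zero_in)
  ultimately show "adj C p = p"
    unfolding p_def by (auto intro!: sum.cong)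
  show spec: "p \<cdot> v = (if \<eta> = g then v else 0)"
    if v: "\<eta> \<in> carrier \<Gamma>" "Z \<in> Gr \<eta>" "v \<in> Hom C Z X" for \<eta> Z v
  proof -
    have Z: "Z \<in> Ob C" using v Gr_Ob by blast
    note v = v(1,2) Z v(3)
    have van: "u i \<cdot> adj C (u i) \<cdot> v = 0" if "i < n" "\<gamma> i \<noteq> \<eta>" for i
    proof -
      have a: "adj C (u i) \<in> Hom C X (Y i)" using that X d by (auto intro!: adj_in)
      have "adj C (u i) \<cdot> v \<in> Hom C Z (Y i)" using comp_in[OF _ X _ v(4) a] v d that by auto
      then have "adj C (u i) \<cdot> v = 0" using Gr_orth[OF v(1) d(1) _ v(2) d(2)] that by metis
      then show ?thesis
        using comp_assoc[OF v(3) X d(3) X v(4) a d(4)] comp_zero(2)[OF v(3) d(3) X d(4)] that by simp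
    qed
    have "(\<Sum>i<n. if \<gamma> i = g then u i \<cdot> adj C (u i) else 0) \<cdot> v =
      (\<Sum>i<n. (if \<gamma> i = g then u i \<cdot> adj C (u i) else 0) \<cdot> v)"
      using uu X v by (intro comp_sum_left[of Z X X]) (auto simp: zero_in)
    also have "\<dots> = (\<Sum>i<n. if \<eta> = g then u i \<cdot> adj C (u i) \<cdot> v else 0)"
      using van comp_zero(1)[OF v(3) X X v(4) zero_in] X by (intro sum.cong) (auto)
    also have "\<dots> = (if \<eta> = g then (\<Sum>i<n. u i \<cdot> adj C (u i) \<cdot> v) else 0)" by simp
    also have "(\<Sum>i<n. u i \<cdot> adj C (u i) \<cdot> v) = (\<Sum>i<n. u i \<cdot> adj C (u i)) \<cdot> v"
      using uu X v by (intro comp_sum_left[of Z X X, symmetric]) auto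
    also have "\<dots> = v" using d(5) v X by (simp add: idm_left)
    finally show ?thesis unfolding p_def .
  qed
  show "proj g X = p" by (rule proj_unique[OF X P]) (use spec in blast)
qed

lemma
  assumes X: "X \<in> Ob C" and g: "g \<in> carrier \<Gamma>"
  shows proj_in: "proj g X \<in> Hom C X X"
    and proj_selfadjoint: "adj C (proj g X) = proj g X"
    and proj_comp: "\<eta> \<in> carrier \<Gamma> \<Longrightarrow> Y \<in> Gr \<eta> \<Longrightarrow> u \<in> Hom C Y X \<Longrightarrow> proj g X \<cdot> u = (if \<eta> = g then u else 0)"
    and finite_degrees: "finite (degs X)"
proof -
  obtain n :: nat and \<gamma> Y u where
    d: "\<And>i. i < n \<Longrightarrow> \<gamma> i \<in> carrier \<Gamma>" "\<And>i. i < n \<Longrightarrow> Y i \<in> Gr (\<gamma> i)" "\<And>i. i < n \<Longrightarrow> Y i \<in> Ob C"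
    "\<And>i. i < n \<Longrightarrow> u i \<in> Hom C (Y i) X" "(\<Sum>i<n. u i \<cdot> adj C (u i)) = \<iota> X"
    by (rule homogeneous_resolution[OF X]) blast
  have e: "proj h X = (\<Sum>i<n. if \<gamma> i = h then u i \<cdot> adj C (u i) else 0)" if "h \<in> carrier \<Gamma>" for h
    by (rule proj_explicit(1)[OF X that d])
  note e = e proj_explicit(2-4)[OF X g d, folded e[OF g]]
  show "proj g X \<in> Hom C X X" by (rule e(2))
  show "adj C (proj g X) = proj g X" by (rule e(3))
  show "proj g X \<cdot> v = (if \<eta> = g then v else 0)"
    if v: "\<eta> \<in> carrier \<Gamma>" "Z \<in> Gr \<eta>" "v \<in> Hom C Z X" for \<eta> Z v
    by (rule e(4)) (use v in auto)
  have "degs X \<subseteq> \<gamma> ` {..<n}"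
  proof
    fix h assume h: "h \<in> degs X"
    then have "proj h X \<noteq> 0" "h \<in> carrier \<Gamma>" by (auto simp: degrees_def)
    then have "(\<Sum>i<n. if \<gamma> i = h then u i \<cdot> adj C (u i) else 0) \<noteq> 0" using e(1)[of h] by simp
    then obtain i where "i < n" "\<gamma> i = h" by (elim sum.not_neutral_contains_not_neutral) (auto split: if_splits)
    then show "h \<in> \<gamma> ` {..<n}" by auto
  qed
  then show "finite (degs X)" by (rule finite_subset) simp
qed


lemma proj_ext:
  assumes X: "X \<in> Ob C" "Z \<in> Ob C" and p: "p \<in> Hom C X Z" "q \<in> Hom C X Z"
    and eq: "\<And>a. a \<in> carrier \<Gamma> \<Longrightarrow> p \<cdot> proj a X = q \<cdot> proj a X"
  shows "p = q"
proof (rule homogeneous_ext[OF X p])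
  fix \<eta> Y u assume u: "\<eta> \<in> carrier \<Gamma>" "Y \<in> Gr \<eta>" "Y \<in> Ob C" "u \<in> Hom C Y X"
  have "r \<cdot> u = (r \<cdot> proj \<eta> X) \<cdot> u" if "r \<in> Hom C X Z" for r
    using comp_assoc[OF u(3) X(1,1,2) u(4) proj_in[OF X(1) u(1)] that] proj_comp[OF X(1) u(1,1,2,4)]
    by simp
  then show "p \<cdot> u = q \<cdot> u" using p eq[OF u(1)] by metis
qed

text \<open>
  Both sides agree on morphisms from homogeneous objects, since composition with \<open>f\<close> preserves the
  degree of the source.
\<close>

lemma proj_natural:
  assumes X: "X \<in> Ob C" "Y \<in> Ob C" and f: "f \<in> Hom C X Y" and a: "a \<in> carrier \<Gamma>"
  shows "proj a Y \<cdot> f = f \<cdot> proj a X"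
proof (rule homogeneous_ext[OF X])
  note P = proj_in[OF X(1) a] proj_in[OF X(2) a]
  show "proj a Y \<cdot> f \<in> Hom C X Y" "f \<cdot> proj a X \<in> Hom C X Y"
    using comp_in[OF X(1,2,2) f P(2)] comp_in[OF X(1,1,2) P(1) f] by auto
  fix \<eta> Z u assume u: "\<eta> \<in> carrier \<Gamma>" "Z \<in> Gr \<eta>" "Z \<in> Ob C" "u \<in> Hom C Z X"
  have "f \<cdot> 0 = 0" using comp_zero(2)[OF u(3) X f] .
  then show "proj a Y \<cdot> f \<cdot> u = f \<cdot> proj a X \<cdot> u"
    using comp_assoc[OF u(3) X(1,2,2) u(4) f P(2)] comp_assoc[OF u(3) X(1,1,2) u(4) P(1) f]
      proj_comp[OF X(1) a u(1,2,4)] proj_comp[OF X(2) a u(1,2) comp_in[OF u(3) X u(4) f]]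
    by simp
qed

definition aproj :: "'g \<Rightarrow> 'o \<Rightarrow> ('o, 'm) arrow" ("\<pi>") where
  "\<pi> a X = Arrow X X (proj a X)"

lemma aproj_sel [simp]: "src (\<pi> a X) = X" "tgt (\<pi> a X) = X" "mor (\<pi> a X) = proj a X"
  by (simp_all add: aproj_def)

lemma arr_aproj [simp]: "\<lbrakk>X \<in> Ob C; a \<in> carrier \<Gamma>\<rbrakk> \<Longrightarrow> arr (\<pi> a X)"
  by (simp add: aproj_def proj_in)

lemma aproj_adj [simp]: "\<lbrakk>X \<in> Ob C; a \<in> carrier \<Gamma>\<rbrakk> \<Longrightarrow> (\<pi> a X)\<dagger> = \<pi> a X"
  by (rule arrow_eqI) (simp_all add: proj_selfadjoint)

lemma aproj_natural:
  "\<lbrakk>arr F; a \<in> carrier \<Gamma>; X = src F; Y = tgt F\<rbrakk> \<Longrightarrow> \<pi> a Y \<bullet> F = F \<bullet> \<pi> a X"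
  by (rule arrow_eqI) (simp_all add: proj_natural arr_mor)

lemma aproj_ext:
  assumes "arr F" "arr G" "src F = src G" "tgt F = tgt G"
    and "\<And>a. a \<in> carrier \<Gamma> \<Longrightarrow> F \<bullet> \<pi> a (src F) = G \<bullet> \<pi> a (src F)"
  shows "F = G"
proof (rule arrow_eqI[OF assms(3,4)])
  have "mor F \<cdot> proj a (src F) = mor G \<cdot> proj a (src F)" if "a \<in> carrier \<Gamma>" for a
    using arg_cong[OF assms(5)[OF that], of mor] by simp
  then show "mor F = mor G"
    using proj_ext[OF arr_ob[OF assms(1)] arr_mor[OF assms(1)]] arr_mor[OF assms(2)]
    unfolding assms(3,4)[symmetric] by blast
qed

text \<open>
  The degree of an object is invariant under isomorphism, so the defining property of the projections
  extends from the objects of \<open>Gr \<eta>\<close> to all objects isomorphic to one of them.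
\<close>

lemma has_degree_comp:
  assumes X: "X \<in> Ob C" "W \<in> Ob C" and u: "u \<in> Hom C W X" and d: "has_degree C Gr \<eta> W"
    and a: "a \<in> carrier \<Gamma>" "\<eta> \<in> carrier \<Gamma>"
  shows "proj a X \<cdot> u = (if \<eta> = a then u else 0)"
proof -
  obtain Y f g where Y: "Y \<in> Gr \<eta>" "f \<in> Hom C W Y" "g \<in> Hom C Y W" "g \<cdot> f = \<iota> W"
    using d by (auto simp: has_degree_def isomorphic_def)
  have YO: "Y \<in> Ob C" using Y Gr_Ob a by blast
  note P = proj_in[OF X(1) a(1)]
  have ug: "u \<cdot> g \<in> Hom C Y X" by (rule comp_in[OF YO X(2,1) Y(3) u])
  have e: "u = u \<cdot> g \<cdot> f"
    using comp_assoc[OF X(2) YO X(2,1) Y(2,3) u] Y(4) idm_right[OF X(2,1) u] by simp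
  have "proj a X \<cdot> u = proj a X \<cdot> (u \<cdot> g) \<cdot> f"
    using comp_assoc[OF X(2) YO X(1,1) Y(2) ug P] e by simp
  also have "\<dots> = (if \<eta> = a then u else 0)"
    using proj_comp[OF X(1) a(1) a(2) Y(1) ug] e comp_zero(1)[OF X(2) YO X(1) Y(2)] zero_in[OF YO X(1)] by simp
  finally show ?thesis .
qed

lemma has_degree_Gr: "\<lbrakk>\<eta> \<in> carrier \<Gamma>; X \<in> Gr \<eta>\<rbrakk> \<Longrightarrow> has_degree C Gr \<eta> X"
  using Gr_Ob idm_in idm_left unfolding has_degree_def isomorphic_def by (metis subsetD)

lemma aproj_orth:
  assumes "X \<in> Ob C" "a \<in> carrier \<Gamma>" "b \<in> carrier \<Gamma>"
  shows "\<pi> a X \<bullet> \<pi> b X = of_bool (a = b) *\<^sub>s \<pi> b X"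
proof (rule arrow_eqI)
  note P = proj_in[OF assms(1,2)] proj_in[OF assms(1,3)]
  have "proj a X \<cdot> proj b X = smul C (of_bool (a = b)) (proj b X)"
  proof (rule homogeneous_ext[OF assms(1,1)])
    show "proj a X \<cdot> proj b X \<in> Hom C X X" "smul C (of_bool (a = b)) (proj b X) \<in> Hom C X X"
      using comp_in[OF assms(1,1,1) P(2,1)] smul_in[OF assms(1,1) P(2)] by auto
    fix \<eta> Y u assume u: "\<eta> \<in> carrier \<Gamma>" "Y \<in> Gr \<eta>" "Y \<in> Ob C" "u \<in> Hom C Y X"
    show "proj a X \<cdot> proj b X \<cdot> u = smul C (of_bool (a = b)) (proj b X) \<cdot> u"
      using comp_assoc[OF u(3) assms(1,1,1) u(4) P(2,1)] proj_comp[OF assms(1,2) u(1,2,4)]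
        proj_comp[OF assms(1,3) u(1,2,4)] comp_smul_left[OF u(3) assms(1,1) u(4) P(2), of "of_bool (a = b)"]
        comp_zero(2)[OF u(3) assms(1,1) P(1)] by auto
  qed
  then show "mor (\<pi> a X \<bullet> \<pi> b X) = mor (of_bool (a = b) *\<^sub>s \<pi> b X)" by simp
qed simp_all

lemma proj_sum: 
  assumes X: "X \<in> Ob C" shows "(\<Sum>a\<in>degs X. proj a X) = \<iota> X"
proof (rule homogeneous_ext[OF X X])
  have c: "a \<in> degs X \<Longrightarrow> a \<in> carrier \<Gamma>" for a by (simp add: degrees_def)
  show "(\<Sum>a\<in>degs X. proj a X) \<in> Hom C X X"
    using X c by (intro sum_in) (auto intro: proj_in)
  show "\<iota> X \<in> Hom C X X" using idm_in X .
  fix \<eta> Y u assume u: "\<eta> \<in> carrier \<Gamma>" "Y \<in> Gr \<eta>" "Y \<in> Ob C" "u \<in> Hom C Y X"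
  have "(\<Sum>a\<in>degs X. proj a X) \<cdot> u = (\<Sum>a\<in>degs X. proj a X \<cdot> u)"
    using X c u by (intro comp_sum_left[of Y X X]) (auto intro: proj_in)
  also have "\<dots> = (\<Sum>a\<in>degs X. if a = \<eta> then u else 0)"
    using X c u by (intro sum.cong) (auto simp: proj_comp)
  also have "\<dots> = (if \<eta> \<in> degs X then u else 0)"
    using finite_degrees[OF X \<Gamma>.one_closed] by simp
  also have "\<dots> = u"
    using proj_comp[OF X u(1,1,2,4)] u(1) comp_zero(1)[OF u(3) X X u(4) zero_in[OF X X]]
    by (auto simp: degrees_def)
  finally show "(\<Sum>a\<in>degs X. proj a X) \<cdot> u = \<iota> X \<cdot> u"
    using idm_left[OF u(3) X u(4)] by simp
qed

text \<open>
  As \<open>homogeneous_ext\<close>, with the identity of one tensor factor decomposed.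
\<close>

lemma homogeneous_ext_left:
  assumes X: "X \<in> Ob C" "Y \<in> Ob C" "Z \<in> Ob C"
    and p: "p \<in> Hom C (X \<boxtimes> Y) Z" "q \<in> Hom C (X \<boxtimes> Y) Z"
    and eq: "\<And>\<eta> W u. \<eta> \<in> carrier \<Gamma> \<Longrightarrow> W \<in> Gr \<eta> \<Longrightarrow> W \<in> Ob C \<Longrightarrow> u \<in> Hom C W X
      \<Longrightarrow> p \<cdot> (u \<odot> \<iota> Y) = q \<cdot> (u \<odot> \<iota> Y)"
  shows "p = q"
proof -
  obtain n :: nat and \<gamma> W u where
    d: "\<And>i. i < n \<Longrightarrow> \<gamma> i \<in> carrier \<Gamma>" "\<And>i. i < n \<Longrightarrow> W i \<in> Gr (\<gamma> i)" "\<And>i. i < n \<Longrightarrow> W i \<in> Ob C"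
    "\<And>i. i < n \<Longrightarrow> u i \<in> Hom C (W i) X" "(\<Sum>i<n. u i \<cdot> adj C (u i)) = \<iota> X"
    by (rule homogeneous_resolution[OF X(1)]) blast
  note a = adj_in[OF d(3) X(1) d(4)]
  note i = idm_in[OF X(2)]
  have "r = (\<Sum>i<n. (r \<cdot> (u i \<odot> \<iota> Y)) \<cdot> (adj C (u i) \<odot> \<iota> Y))" if r: "r \<in> Hom C (X \<boxtimes> Y) Z" for r
  proof -
    have t: "(u i \<cdot> adj C (u i)) \<odot> \<iota> Y = (u i \<odot> \<iota> Y) \<cdot> (adj C (u i) \<odot> \<iota> Y)"
      "u i \<cdot> adj C (u i) \<in> Hom C X X"
      "u i \<odot> \<iota> Y \<in> Hom C (W i \<boxtimes> Y) (X \<boxtimes> Y)" "adj C (u i) \<odot> \<iota> Y \<in> Hom C (X \<boxtimes> Y) (W i \<boxtimes> Y)" if "i < n" for i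
      using tmor_comp[OF X(1) d(3) X(1,2,2,2) a d(4) i i] idm_left[OF X(2,2) i] comp_in[OF X(1) d(3) X(1) a d(4)]
        tmor_in[OF d(3) X(1,2,2) d(4) i] tmor_in[OF X(1) d(3) X(2,2) a i] that by simp_all
    have "r = r \<cdot> ((\<Sum>i<n. u i \<cdot> adj C (u i)) \<odot> \<iota> Y)"
      using idm_right[OF tob_in[OF X(1,2)] X(3) r] d(5) tmor_idm[OF X(1,2)] by simp
    also have "\<dots> = r \<cdot> (\<Sum>i<n. (u i \<cdot> adj C (u i)) \<odot> \<iota> Y)"
      using t(2) X i by (subst tmor_sum_left[of X X Y Y]) auto
    also have "\<dots> = (\<Sum>i<n. r \<cdot> ((u i \<cdot> adj C (u i)) \<odot> \<iota> Y))"
      using tmor_in[OF X(1,1,2,2) t(2) i] X r by (intro comp_sum_right[of "X \<boxtimes> Y" "X \<boxtimes> Y" Z]) auto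
    also have "\<dots> = (\<Sum>i<n. (r \<cdot> (u i \<odot> \<iota> Y)) \<cdot> (adj C (u i) \<odot> \<iota> Y))"
    proof (rule sum.cong[OF refl])
      fix i assume "i \<in> {..<n}"
      then have n: "i < n" by simp
      show "r \<cdot> ((u i \<cdot> adj C (u i)) \<odot> \<iota> Y) = (r \<cdot> (u i \<odot> \<iota> Y)) \<cdot> (adj C (u i) \<odot> \<iota> Y)"
        using comp_assoc[OF tob_in[OF X(1,2)] tob_in[OF d(3)[OF n] X(2)] tob_in[OF X(1,2)] X(3) t(4,3)[OF n] r]
          t(1)[OF n] by simp
    qed
    finally show ?thesis .
  qed
  from this[OF p(1)] this[OF p(2)] show ?thesis
    using eq[OF d(1-4)] by simp
qed

lemma homogeneous_ext_right:
  assumes X: "X \<in> Ob C" "Y \<in> Ob C" "Z \<in> Ob C"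
    and p: "p \<in> Hom C (Y \<boxtimes> X) Z" "q \<in> Hom C (Y \<boxtimes> X) Z"
    and eq: "\<And>\<eta> W u. \<eta> \<in> carrier \<Gamma> \<Longrightarrow> W \<in> Gr \<eta> \<Longrightarrow> W \<in> Ob C \<Longrightarrow> u \<in> Hom C W X
      \<Longrightarrow> p \<cdot> (\<iota> Y \<odot> u) = q \<cdot> (\<iota> Y \<odot> u)"
  shows "p = q"
proof -
  obtain n :: nat and \<gamma> W u where
    d: "\<And>i. i < n \<Longrightarrow> \<gamma> i \<in> carrier \<Gamma>" "\<And>i. i < n \<Longrightarrow> W i \<in> Gr (\<gamma> i)" "\<And>i. i < n \<Longrightarrow> W i \<in> Ob C"
    "\<And>i. i < n \<Longrightarrow> u i \<in> Hom C (W i) X" "(\<Sum>i<n. u i \<cdot> adj C (u i)) = \<iota> X"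
    by (rule homogeneous_resolution[OF X(1)]) blast
  note a = adj_in[OF d(3) X(1) d(4)]
  note i = idm_in[OF X(2)]
  have "r = (\<Sum>i<n. (r \<cdot> (\<iota> Y \<odot> u i)) \<cdot> (\<iota> Y \<odot> adj C (u i)))" if r: "r \<in> Hom C (Y \<boxtimes> X) Z" for r
  proof -
    have t: "\<iota> Y \<odot> (u i \<cdot> adj C (u i)) = (\<iota> Y \<odot> u i) \<cdot> (\<iota> Y \<odot> adj C (u i))"
      "u i \<cdot> adj C (u i) \<in> Hom C X X"
      "\<iota> Y \<odot> u i \<in> Hom C (Y \<boxtimes> W i) (Y \<boxtimes> X)" "\<iota> Y \<odot> adj C (u i) \<in> Hom C (Y \<boxtimes> X) (Y \<boxtimes> W i)" if "i < n" for i
      using tmor_comp[OF X(2,2,2,1) d(3) X(1) i i a d(4)] idm_left[OF X(2,2) i] comp_in[OF X(1) d(3) X(1) a d(4)]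
        tmor_in[OF X(2,2) d(3) X(1) i d(4)] tmor_in[OF X(2,2,1) d(3) i a] that by simp_all
    have "r = r \<cdot> (\<iota> Y \<odot> (\<Sum>i<n. u i \<cdot> adj C (u i)))"
      using idm_right[OF tob_in[OF X(2,1)] X(3) r] d(5) tmor_idm[OF X(2,1)] by simp
    also have "\<dots> = r \<cdot> (\<Sum>i<n. \<iota> Y \<odot> (u i \<cdot> adj C (u i)))"
      using t(2) X i by (subst tmor_sum_right[of Y Y X X]) auto
    also have "\<dots> = (\<Sum>i<n. r \<cdot> (\<iota> Y \<odot> (u i \<cdot> adj C (u i))))"
      using tmor_in[OF X(2,2,1,1) i t(2)] X r by (intro comp_sum_right[of "Y \<boxtimes> X" "Y \<boxtimes> X" Z]) auto
    also have "\<dots> = (\<Sum>i<n. (r \<cdot> (\<iota> Y \<odot> u i)) \<cdot> (\<iota> Y \<odot> adj C (u i)))"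
    proof (rule sum.cong[OF refl])
      fix i assume "i \<in> {..<n}"
      then have n: "i < n" by simp
      show "r \<cdot> (\<iota> Y \<odot> (u i \<cdot> adj C (u i))) = (r \<cdot> (\<iota> Y \<odot> u i)) \<cdot> (\<iota> Y \<odot> adj C (u i))"
        using comp_assoc[OF tob_in[OF X(2,1)] tob_in[OF X(2) d(3)[OF n]] tob_in[OF X(2,1)] X(3) t(4,3)[OF n] r]
          t(1)[OF n] by simp
    qed
    finally show ?thesis .
  qed
  from this[OF p(1)] this[OF p(2)] show ?thesis
    using eq[OF d(1-4)] by simp
qed

lemma has_degree_aproj_comp:
  assumes "arr U" "tgt U = X" "has_degree C Gr \<eta> (src U)" "a \<in> carrier \<Gamma>" "\<eta> \<in> carrier \<Gamma>"
  shows "\<pi> a X \<bullet> U = of_bool (a = \<eta>) *\<^sub>s U"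
  using has_degree_comp[OF _ _ arr_mor[OF assms(1)] assms(3-5)] assms(1,2)
  by (intro arrow_eqI) auto

lemma arrow_ext_left:
  assumes F: "arr F" "arr G" "src F = X \<boxtimes> Y" "src G = X \<boxtimes> Y" "tgt F = tgt G" and X: "X \<in> Ob C" "Y \<in> Ob C"
    and eq: "\<And>\<eta> U. \<eta> \<in> carrier \<Gamma> \<Longrightarrow> arr U \<Longrightarrow> src U \<in> Gr \<eta> \<Longrightarrow> tgt U = X
       \<Longrightarrow> F \<bullet> (U || \<I> Y) = G \<bullet> (U || \<I> Y)"
  shows "F = G"
proof (rule arrow_eqI)
  show "src F = src G" "tgt F = tgt G" using F by simp_all
  show "mor F = mor G"
  proof (rule homogeneous_ext_left[OF X arr_ob(2)[OF F(1)]])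
    show "mor F \<in> Hom C (X \<boxtimes> Y) (tgt F)" "mor G \<in> Hom C (X \<boxtimes> Y) (tgt F)"
      using arr_mor[OF F(1)] arr_mor[OF F(2)] unfolding F(3,4) F(5) by simp_all
    fix \<eta> W u assume "\<eta> \<in> carrier \<Gamma>" "W \<in> Gr \<eta>" "W \<in> Ob C" "u \<in> Hom C W X"
    then show "mor F \<cdot> (u \<odot> \<iota> Y) = mor G \<cdot> (u \<odot> \<iota> Y)"
      using eq[of \<eta> "Arrow W X u"] X by (auto dest: arg_cong[where f = mor])
  qed
qed

lemma arrow_ext_right:
  assumes F: "arr F" "arr G" "src F = Y \<boxtimes> X" "src G = Y \<boxtimes> X" "tgt F = tgt G" and X: "X \<in> Ob C" "Y \<in> Ob C"
    and eq: "\<And>\<eta> U. \<eta> \<in> carrier \<Gamma> \<Longrightarrow> arr U \<Longrightarrow> src U \<in> Gr \<eta> \<Longrightarrow> tgt U = X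
       \<Longrightarrow> F \<bullet> (\<I> Y || U) = G \<bullet> (\<I> Y || U)"
  shows "F = G"
proof (rule arrow_eqI)
  show "src F = src G" "tgt F = tgt G" using F by simp_all
  show "mor F = mor G"
  proof (rule homogeneous_ext_right[OF X arr_ob(2)[OF F(1)]])
    show "mor F \<in> Hom C (Y \<boxtimes> X) (tgt F)" "mor G \<in> Hom C (Y \<boxtimes> X) (tgt F)"
      using arr_mor[OF F(1)] arr_mor[OF F(2)] unfolding F(3,4) F(5) by simp_all
    fix \<eta> W u assume "\<eta> \<in> carrier \<Gamma>" "W \<in> Gr \<eta>" "W \<in> Ob C" "u \<in> Hom C W X"
    then show "mor F \<cdot> (\<iota> Y \<odot> u) = mor G \<cdot> (\<iota> Y \<odot> u)"
      using eq[of \<eta> "Arrow W X u"] X by (auto dest: arg_cong[where f = mor])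
  qed
qed

lemma aproj_ext_left:
  assumes F: "arr F" "arr G" "src F = X \<boxtimes> Y" "src G = X \<boxtimes> Y" "tgt F = tgt G" and X: "X \<in> Ob C" "Y \<in> Ob C"
    and eq: "\<And>a. a \<in> carrier \<Gamma> \<Longrightarrow> F \<bullet> (\<pi> a X || \<I> Y) = G \<bullet> (\<pi> a X || \<I> Y)"
  shows "F = G"
proof (rule arrow_ext_left[OF F X])
  fix \<eta> U assume U: "\<eta> \<in> carrier \<Gamma>" "arr U" "src U \<in> Gr \<eta>" "tgt U = X"
  have "U || \<I> Y = (\<pi> \<eta> X || \<I> Y) \<bullet> (U || \<I> Y)"
    using has_degree_aproj_comp[OF U(2,4) has_degree_Gr[OF U(1,3)] U(1,1)] X U by (simp add: interchange)
  then show "F \<bullet> (U || \<I> Y) = G \<bullet> (U || \<I> Y)"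
    using eq[OF U(1)] acomp_assoc[of "U || \<I> Y" "\<pi> \<eta> X || \<I> Y"] U X F by (metis arr_aproj arr_id arr_tens aproj_sel sel_simps(4,5,7,8))
qed

lemma aproj_ext_right:
  assumes F: "arr F" "arr G" "src F = Y \<boxtimes> X" "src G = Y \<boxtimes> X" "tgt F = tgt G" and X: "X \<in> Ob C" "Y \<in> Ob C"
    and eq: "\<And>a. a \<in> carrier \<Gamma> \<Longrightarrow> F \<bullet> (\<I> Y || \<pi> a X) = G \<bullet> (\<I> Y || \<pi> a X)"
  shows "F = G"
proof (rule arrow_ext_right[OF F X])
  fix \<eta> U assume U: "\<eta> \<in> carrier \<Gamma>" "arr U" "src U \<in> Gr \<eta>" "tgt U = X"
  have "\<I> Y || U = (\<I> Y || \<pi> \<eta> X) \<bullet> (\<I> Y || U)"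
    using has_degree_aproj_comp[OF U(2,4) has_degree_Gr[OF U(1,3)] U(1,1)] X U by (simp add: interchange)
  then show "F \<bullet> (\<I> Y || U) = G \<bullet> (\<I> Y || U)"
    using eq[OF U(1)] acomp_assoc[of "\<I> Y || U" "\<I> Y || \<pi> \<eta> X"] U X F by (metis arr_aproj arr_id arr_tens aproj_sel sel_simps(4,5,7,8))
qed

text \<open>
  It suffices to compare both sides on \<open>U || V\<close> with homogeneous sources; the source of this arrow is
  homogeneous of the product degree.
\<close>

lemma aproj_tens:
  assumes X: "X \<in> Ob C" "Y \<in> Ob C" and a: "a \<in> carrier \<Gamma>" "b \<in> carrier \<Gamma>" "c \<in> carrier \<Gamma>"
  shows "\<pi> c (X \<boxtimes> Y) \<bullet> (\<pi> a X || \<pi> b Y) = of_bool (c = a \<otimes>\<^sub>\<Gamma> b) *\<^sub>s (\<pi> a X || \<pi> b Y)"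
proof (rule arrow_ext_left[where X = X and Y = Y], goal_cases)
  case (8 \<eta> U)
  show ?case
  proof (rule arrow_ext_right[where Y = "src U" and X = Y], goal_cases)
    case (8 \<theta> V)
    note U = \<open>\<eta> \<in> carrier \<Gamma>\<close> \<open>arr U\<close> \<open>src U \<in> Gr \<eta>\<close> \<open>tgt U = X\<close>
    note V = 8
    have e: "\<pi> a X \<bullet> U = of_bool (a = \<eta>) *\<^sub>s U" "\<pi> b Y \<bullet> V = of_bool (b = \<theta>) *\<^sub>s V"
      using has_degree_aproj_comp[OF U(2,4) has_degree_Gr[OF U(1,3)] a(1) U(1)]
       has_degree_aproj_comp[OF V(2,4) has_degree_Gr[OF V(1,3)] a(2) V(1)] by auto
    have "has_degree C Gr (\<eta> \<otimes>\<^sub>\<Gamma> \<theta>) (src U \<boxtimes> src V)"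
      using Gr_tensor[OF U(1) V(1) U(3) V(3)] by (auto simp: has_degree_def)
    then have f: "\<pi> c (X \<boxtimes> Y) \<bullet> (U || V) = of_bool (c = \<eta> \<otimes>\<^sub>\<Gamma> \<theta>) *\<^sub>s (U || V)"
      using U V a by (intro has_degree_aproj_comp) auto
    show ?case
      using X a U V e f
      by (simp add: acomp_assoc interchange ascale_rules)
  qed (use X a 8 in simp_all)
qed (use X a in simp_all)

text \<open>
  Fixing the degrees of a tensor product and of one of its factors fixes the degree of the other factor.
\<close>

lemma aproj_tens_right:
  assumes X: "X \<in> Ob C" "Y \<in> Ob C" and a: "b \<in> carrier \<Gamma>" "c \<in> carrier \<Gamma>"
  shows "\<pi> c (X \<boxtimes> Y) \<bullet> (\<I> X || \<pi> b Y) = \<pi> (c \<otimes>\<^sub>\<Gamma> inv\<^sub>\<Gamma> b) X || \<pi> b Y"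
proof (rule aproj_ext_left[where X = X and Y = Y], goal_cases)
  case (8 d)
  have "c = d \<otimes>\<^sub>\<Gamma> b \<longleftrightarrow> c \<otimes>\<^sub>\<Gamma> inv\<^sub>\<Gamma> b = d"
    using a 8 by (metis \<Gamma>.inv_solve_right)
  then show ?case
    using X a 8 by (simp add: acomp_assoc interchange ascale_rules aproj_tens aproj_orth)
qed (use X a in simp_all)

lemma aproj_tens_left:
  assumes X: "X \<in> Ob C" "Y \<in> Ob C" and a: "a \<in> carrier \<Gamma>" "c \<in> carrier \<Gamma>"
  shows "\<pi> c (X \<boxtimes> Y) \<bullet> (\<pi> a X || \<I> Y) = \<pi> a X || \<pi> (inv\<^sub>\<Gamma> a \<otimes>\<^sub>\<Gamma> c) Y"
proof (rule aproj_ext_right[where Y = X and X = Y], goal_cases)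
  case (8 d)
  have "c = a \<otimes>\<^sub>\<Gamma> d \<longleftrightarrow> inv\<^sub>\<Gamma> a \<otimes>\<^sub>\<Gamma> c = d"
    using a 8 by (metis \<Gamma>.inv_solve_left)
  then show ?case
    using X a 8 by (simp add: acomp_assoc interchange ascale_rules aproj_tens aproj_orth)
qed (use X a in simp_all)

text \<open>
  The projections of the middle factor arise from those of \<open>X \<boxtimes> Y\<close>: once \<open>X\<close> is cut down to degree \<open>a\<close>, the
  component of degree \<open>d\<close> of \<open>X \<boxtimes> Y\<close> is the one where \<open>Y\<close> has degree \<open>a\<^sup>-\<^sup>1 d\<close>.
\<close>

lemma aproj_ext3:
  assumes F: "arr F" "arr G" "src F = X \<boxtimes> (Y \<boxtimes> Z)" "src G = X \<boxtimes> (Y \<boxtimes> Z)" "tgt F = tgt G"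
    and X: "X \<in> Ob C" "Y \<in> Ob C" "Z \<in> Ob C"
    and eq: "\<And>a b c. a \<in> carrier \<Gamma> \<Longrightarrow> b \<in> carrier \<Gamma> \<Longrightarrow> c \<in> carrier \<Gamma> \<Longrightarrow>
      F \<bullet> (\<pi> a X || (\<pi> b Y || \<pi> c Z)) = G \<bullet> (\<pi> a X || (\<pi> b Y || \<pi> c Z))"
  shows "F = G"
proof (rule aproj_ext_left[where X = X and Y = "Y \<boxtimes> Z"], goal_cases)
  case (8 a)
  show ?case
  proof (rule aproj_ext_right[where Y = "X \<boxtimes> Y" and X = Z], goal_cases)
    case (8 c)
    show ?case
    proof (rule aproj_ext_left[where X = "X \<boxtimes> Y" and Y = Z], goal_cases)
      case (8 d)
      note c = \<open>a \<in> carrier \<Gamma>\<close> \<open>c \<in> carrier \<Gamma>\<close> 8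
      have *: "H \<bullet> (\<pi> a X || \<I> (Y \<boxtimes> Z)) \<bullet> (\<I> (X \<boxtimes> Y) || \<pi> c Z) \<bullet> (\<pi> d (X \<boxtimes> Y) || \<I> Z)
        = H \<bullet> (\<pi> a X || (\<pi> (inv\<^sub>\<Gamma> a \<otimes>\<^sub>\<Gamma> d) Y || \<pi> c Z))" if H: "arr H" "src H = X \<boxtimes> (Y \<boxtimes> Z)" for H
      proof -
        have 1: "\<pi> a X || \<I> (Y \<boxtimes> Z) = (\<pi> a X || \<I> Y) || \<I> Z"
          using X c by (simp add: atens_assoc)
        have 2: "(\<pi> a X || \<I> Y) \<bullet> \<pi> d (X \<boxtimes> Y) = \<pi> a X || \<pi> (inv\<^sub>\<Gamma> a \<otimes>\<^sub>\<Gamma> d) Y"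
          by (rule trans[OF aproj_natural[of "\<pi> a X || \<I> Y" d "X \<boxtimes> Y" "X \<boxtimes> Y", symmetric] aproj_tens_left])
            (use X c in simp_all)
        have "((\<pi> a X || \<I> Y) || \<I> Z) \<bullet> ((\<I> (X \<boxtimes> Y) || \<pi> c Z) \<bullet> (\<pi> d (X \<boxtimes> Y) || \<I> Z))
         = ((\<pi> a X || \<I> Y) \<bullet> \<pi> d (X \<boxtimes> Y)) || \<pi> c Z"
          using X c by (subst interchange, simp_all)+
        then show ?thesis
          unfolding 1 2 using X c H by (simp add: acomp_assoc atens_assoc)
      qed
      show ?case using *[OF F(1,3)] *[OF F(2,4)] eq[OF c(1) _ c(2)] c by simp
    qed (use F X 8 \<open>a \<in> carrier \<Gamma>\<close> in simp_all)
  qed (use F X 8 in simp_all)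
qed (use F X in simp_all)

text \<open>
  The projections of the unit object are orthogonal idempotents in a one-dimensional algebra, so exactly
  one of them is nonzero. Its degree \<open>d\<close> is idempotent, because the unit object is its own tensor square.
\<close>

lemma aproj_unit:
  assumes a: "a \<in> carrier \<Gamma>"
  shows "\<pi> a (unito C) = of_bool (a = \<one>\<^bsub>\<Gamma>\<^esub>) *\<^sub>s \<I> (unito C)"
proof -
  let ?U = "unito C" and ?D = "degs (unito C)"
  have dim: "vs.dim (Hom C ?U ?U) = 1"
    using unit_simple by (simp add: simple_object_def)
  obtain B where B: "B \<subseteq> Hom C ?U ?U" "vs.independent B" "Hom C ?U ?U \<subseteq> vs.span B" "card B = 1"
    using vs.basis_exists[of "Hom C ?U ?U"] dim by metis
  then obtain e where e: "B = {e}" by (auto simp: card_1_singleton_iff)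
  have mult: "\<exists>k. f = smul C k e" if "f \<in> Hom C ?U ?U" for f
    using that B(3) unfolding e by (auto simp: vs.span_singleton)
  have e0: "e \<noteq> 0" using B(2) e vs.dependent_zero[of B] by auto
  have eU: "e \<in> Hom C ?U ?U" using B e by auto
  have i0: "\<iota> ?U \<noteq> 0"
    using idm_right[OF unit_Ob unit_Ob eU] comp_zero(2)[OF unit_Ob unit_Ob unit_Ob eU] e0 by auto
  have "?D \<noteq> {}" using proj_sum[OF unit_Ob] i0 by auto
  then obtain d where d: "d \<in> carrier \<Gamma>" "proj d ?U \<noteq> 0" by (auto simp: degrees_def)
  have other: "proj b ?U = 0" if b: "b \<in> carrier \<Gamma>" "b \<noteq> d" for b
  proof -
    note P = proj_in[OF unit_Ob d(1)] proj_in[OF unit_Ob b(1)]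
    obtain x y where xy: "proj d ?U = smul C x e" "proj b ?U = smul C y e"
      using mult[OF P(1)] mult[OF P(2)] by auto
    have "x \<noteq> 0" using d xy by auto
    then have *: "proj b ?U = smul C (y / x) (proj d ?U)" by (simp add: xy)
    have "proj b ?U = proj b ?U \<cdot> proj b ?U"
      using arg_cong[OF aproj_orth[OF unit_Ob b(1) b(1)], of mor] by simp
    also have "\<dots> = smul C (y / x) (proj b ?U \<cdot> proj d ?U)"
      using comp_smul_right[OF unit_Ob unit_Ob unit_Ob P] * by metis
    also have "proj b ?U \<cdot> proj d ?U = 0"
      using arg_cong[OF aproj_orth[OF unit_Ob b(1) d(1)], of mor] b by simp
    finally show ?thesis by simp
  qed
  have "?D = {d}" using other d by (auto simp: degrees_def)
  then have "proj d ?U = \<iota> ?U" using proj_sum[OF unit_Ob] by simp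
  then have \<pi>d: "\<pi> b ?U = of_bool (b = d) *\<^sub>s \<I> ?U" if "b \<in> carrier \<Gamma>" for b
    using other[OF that] by (intro arrow_eqI) auto
  have "\<I> ?U = of_bool (d = d \<otimes>\<^sub>\<Gamma> d) *\<^sub>s \<I> ?U"
    using aproj_tens[OF unit_Ob unit_Ob d(1) d(1) d(1)] \<pi>d[OF d(1)] by simp
  from arg_cong[where f = mor, OF this] have "d = d \<otimes>\<^sub>\<Gamma> d"
    using i0 by (cases "d = d \<otimes>\<^sub>\<Gamma> d") auto
  then have "d = \<one>\<^bsub>\<Gamma>\<^esub>" using d(1) by (metis \<Gamma>.l_cancel_one')
  then show ?thesis using \<pi>d[OF a] by simp
qed

lemma has_degree_aproj:
  "\<lbrakk>X \<in> Ob C; has_degree C Gr \<eta> X; \<eta> \<in> carrier \<Gamma>; a \<in> carrier \<Gamma>\<rbrakk> \<Longrightarrow> \<pi> a X = of_bool (a = \<eta>) *\<^sub>s \<I> X"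
  using has_degree_aproj_comp[of "\<I> X" X \<eta> a] by simp

end

section \<open>Identities for the 3-cocycle\<close>

locale three_cocycle = \<Gamma>: group \<Gamma> for \<Gamma> :: "('g, 'z) monoid_scheme" (structure) +
  fixes \<omega> :: "'g \<Rightarrow> 'g \<Rightarrow> 'g \<Rightarrow> complex"
  assumes \<omega>: "normalized_3cocycle \<Gamma> \<omega>"
begin

lemma cocycle:
  "\<lbrakk>a \<in> carrier \<Gamma>; b \<in> carrier \<Gamma>; c \<in> carrier \<Gamma>; d \<in> carrier \<Gamma>\<rbrakk> \<Longrightarrow>
     \<omega> a b c * \<omega> a (b \<otimes> c) d * \<omega> b c d = \<omega> (a \<otimes> b) c d * \<omega> a b (c \<otimes> d)"
  using \<omega> by (simp add: normalized_3cocycle_def)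

lemma cocycle_one:
  "\<lbrakk>a \<in> carrier \<Gamma>; b \<in> carrier \<Gamma>\<rbrakk> \<Longrightarrow> \<omega> \<one> a b = 1 \<and> \<omega> a \<one> b = 1 \<and> \<omega> a b \<one> = 1"
  using \<omega> \<Gamma>.one_closed unfolding normalized_3cocycle_def by blast

lemma cocycle_norm: "\<lbrakk>a \<in> carrier \<Gamma>; b \<in> carrier \<Gamma>; c \<in> carrier \<Gamma>\<rbrakk> \<Longrightarrow> cmod (\<omega> a b c) = 1"
  using \<omega> by (simp add: normalized_3cocycle_def)

lemma cocycle_nonzero: "\<lbrakk>a \<in> carrier \<Gamma>; b \<in> carrier \<Gamma>; c \<in> carrier \<Gamma>\<rbrakk> \<Longrightarrow> \<omega> a b c \<noteq> 0"
  using cocycle_norm by fastforce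

lemma cnj_cocycle: "\<lbrakk>a \<in> carrier \<Gamma>; b \<in> carrier \<Gamma>; c \<in> carrier \<Gamma>\<rbrakk> \<Longrightarrow> cnj (\<omega> a b c) = inverse (\<omega> a b c)"
  using cocycle_norm[of a b c] cocycle_nonzero[of a b c] complex_norm_square[of "\<omega> a b c"]
  by (simp add: field_simps)

text \<open>
  Let \<open>\<kappa> = r \<gamma>\<^sub>1 r\<^sup>-\<^sup>1\<close>. The 3-cocycle identity for \<open>(\<kappa>, r, s, t)\<close>, \<open>(r, \<gamma>\<^sub>1, s, t)\<close>, \<open>(r, s, \<gamma>\<^sub>2, t)\<close> and
  \<open>(r, s, t, \<gamma>)\<close> gives the claim: by \<open>\<kappa> r = r \<gamma>\<^sub>1\<close>, \<open>\<gamma>\<^sub>1 s = s \<gamma>\<^sub>2\<close> and \<open>\<gamma>\<^sub>2 t = t \<gamma>\<close>, each value of \<open>\<omega>\<close> that does not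
  occur in the claim occurs in two of these identities and cancels.
\<close>

lemma transgression_cocycle: "normalized_2cocycle \<Gamma> (transgression \<Gamma> \<omega>)"
  unfolding normalized_2cocycle_def
proof (intro conjI ballI impI)
  fix g1 g2 assume g: "g1 \<in> arrows \<Gamma>" "g2 \<in> arrows \<Gamma>" "composable \<Gamma> g1 g2"
  obtain s1 \<gamma>1 s2 \<gamma>2 where e: "g1 = (s1, \<gamma>1)" "g2 = (s2, \<gamma>2)" by (cases g1, cases g2)
  have c: "s1 \<in> carrier \<Gamma>" "\<gamma>1 \<in> carrier \<Gamma>" "s2 \<in> carrier \<Gamma>" "\<gamma>2 \<in> carrier \<Gamma>"
    using g by (simp_all add: e arrows_def)
  show "cmod (transgression \<Gamma> \<omega> g1 g2) = 1"
    using c by (simp add: e norm_mult cocycle_norm)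
  assume "fst g1 = \<one> \<or> fst g2 = \<one>"
  then show "transgression \<Gamma> \<omega> g1 g2 = 1" using c by (auto simp: e cocycle_one)
next
  fix g1 g2 g3 assume g: "g1 \<in> arrows \<Gamma>" "g2 \<in> arrows \<Gamma>" "g3 \<in> arrows \<Gamma>" "composable \<Gamma> g1 g2" "composable \<Gamma> g2 g3"
  obtain r s t \<gamma>1 \<gamma>2 \<gamma> where e: "g1 = (r, \<gamma>1)" "g2 = (s, \<gamma>2)" "g3 = (t, \<gamma>)" by (cases g1, cases g2, cases g3)
  have c: "r \<in> carrier \<Gamma>" "\<gamma>1 \<in> carrier \<Gamma>" "s \<in> carrier \<Gamma>" "\<gamma>2 \<in> carrier \<Gamma>" "t \<in> carrier \<Gamma>" "\<gamma> \<in> carrier \<Gamma>"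
    using g by (simp_all add: e arrows_def)
  define \<kappa> where "\<kappa> = r \<otimes> \<gamma>1 \<otimes> inv r"
  have \<kappa>: "\<kappa> \<in> carrier \<Gamma>" using c by (simp add: \<kappa>_def)
  have g1: "\<gamma>1 = s \<otimes> \<gamma>2 \<otimes> inv s" and g2: "\<gamma>2 = t \<otimes> \<gamma> \<otimes> inv t"
    using g by (simp_all add: e composable_def adjoint_act_def)
  have h: "\<kappa> \<otimes> r = r \<otimes> \<gamma>1" "\<gamma>1 \<otimes> s = s \<otimes> \<gamma>2" "\<gamma>2 \<otimes> t = t \<otimes> \<gamma>"
    using c by (simp_all add: \<kappa>_def g1 g2 \<Gamma>.m_assoc)
  have k: "(r \<otimes> s) \<otimes> \<gamma>2 \<otimes> inv (r \<otimes> s) = \<kappa>"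
    using c by (simp add: \<kappa>_def g1 \<Gamma>.m_assoc \<Gamma>.inv_mult_group)
  note n = cocycle_nonzero
  have q: "\<omega> \<kappa> r s * \<omega> \<kappa> (r \<otimes> s) t * \<omega> r s t = \<omega> (r \<otimes> \<gamma>1) s t * \<omega> \<kappa> r (s \<otimes> t)"
    "\<omega> r \<gamma>1 s * \<omega> r (s \<otimes> \<gamma>2) t * \<omega> \<gamma>1 s t = \<omega> (r \<otimes> \<gamma>1) s t * \<omega> r \<gamma>1 (s \<otimes> t)"
    "\<omega> r s \<gamma>2 * \<omega> r (s \<otimes> \<gamma>2) t * \<omega> s \<gamma>2 t = \<omega> (r \<otimes> s) \<gamma>2 t * \<omega> r s (t \<otimes> \<gamma>)"
    "\<omega> r s t * \<omega> r (s \<otimes> t) \<gamma> * \<omega> s t \<gamma> = \<omega> (r \<otimes> s) t \<gamma> * \<omega> r s (t \<otimes> \<gamma>)"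
    using cocycle[OF \<kappa> c(1,3,5)] cocycle[OF c(1,2,3,5)] cocycle[OF c(1,3,4,5)] cocycle[OF c(1,3,5,6)]
    by (simp_all add: h)
  \<comment> \<open>multiplying the hypotheses, two of them read backwards, gives \<open>x y z w\<close> times the claim cleared of denominators\<close>
  have alg: "A1 * inverse B1 * C1 * (A2 * inverse B2 * C2) = A3 * inverse B3 * C3 * (A4 * inverse B4 * C4)"
    if "A1 * A2 * x = y * A4" "B1 * z * A3 = y * B4" "C1 * z * B3 = B2 * w" "x * C4 * C3 = C2 * w"
      "B1 \<noteq> 0" "B2 \<noteq> 0" "B3 \<noteq> 0" "B4 \<noteq> 0" "x \<noteq> 0" "y \<noteq> 0" "z \<noteq> 0" "w \<noteq> 0" for A1 A2 A3 A4 B1 B2 B3 B4 C1 C2 C3 C4 x y z w :: complex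
  proof -
    have "(A1 * C1 * A2 * C2 * B3 * B4) * (x * y * z * w) = (A1 * A2 * x) * (C1 * z * B3) * (y * B4) * (C2 * w)"
      by (simp add: mult_ac)
    also have "\<dots> = (y * A4) * (B2 * w) * (B1 * z * A3) * (x * C4 * C3)" using that by simp
    also have "\<dots> = (A3 * C3 * A4 * C4 * B1 * B2) * (x * y * z * w)" by (simp add: mult_ac)
    finally have "A1 * C1 * A2 * C2 * B3 * B4 = A3 * C3 * A4 * C4 * B1 * B2" using that by simp
    then show ?thesis using that by (simp add: field_simps)
  qed
  show "transgression \<Gamma> \<omega> g1 g2 * transgression \<Gamma> \<omega> (arrow_comp \<Gamma> g1 g2) g3 =
        transgression \<Gamma> \<omega> g2 g3 * transgression \<Gamma> \<omega> g1 (arrow_comp \<Gamma> g2 g3)"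
    unfolding e arrow_comp_def fst_conv snd_conv transgression.simps k \<kappa>_def[symmetric] g1[symmetric]
    using c \<kappa> by (simp only: cnj_cocycle \<Gamma>.m_closed) (rule alg[OF q]; simp add: n)
qed

text \<open>
  The right-hand side is the scalar that the associators contribute to the twisted adjoint on the fibre over
  \<open>(s, \<gamma>)\<close>. The two expressions agree by the 3-cocycle identity for \<open>(t, \<kappa>, s, t)\<close>, \<open>(\<gamma>, t, s, t)\<close> and
  \<open>(s, t, s, t)\<close>, using \<open>t \<kappa> = \<gamma> t\<close>.
\<close>

lemma transgression_inverse:
  assumes "s \<in> carrier \<Gamma>" "\<gamma> \<in> carrier \<Gamma>"
  defines "\<kappa> \<equiv> adjoint_act \<Gamma> s \<gamma>" and "t \<equiv> inv s"
  shows "transgression \<Gamma> \<omega> (t, \<kappa>) (s, \<gamma>) = \<omega> t s \<gamma> * \<omega> t (\<kappa> \<otimes> s) t * \<omega> \<kappa> s t * \<omega> s t s"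
proof -
  have c: "s \<in> carrier \<Gamma>" "\<gamma> \<in> carrier \<Gamma>" "t \<in> carrier \<Gamma>" "\<kappa> \<in> carrier \<Gamma>"
    using assms by (simp_all add: adjoint_act_def)
  have e: "t \<otimes> \<kappa> \<otimes> inv t = \<gamma>" "t \<otimes> \<kappa> = \<gamma> \<otimes> t" "t \<otimes> s = \<one>" "s \<otimes> t = \<one>"
    "\<gamma> \<otimes> t \<otimes> inv t = \<gamma>"
    using assms(1,2) by (simp_all add: \<kappa>_def t_def adjoint_act_def \<Gamma>.m_assoc \<Gamma>.inv_solve_left')
  have 1: "\<omega> t \<kappa> s * \<omega> t (\<kappa> \<otimes> s) t * \<omega> \<kappa> s t = \<omega> (\<gamma> \<otimes> t) s t"
    using cocycle[OF c(3,4,1,3)] c cocycle_one by (simp add: e)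
  have 2: "\<omega> \<gamma> t s * \<omega> t s t = \<omega> (\<gamma> \<otimes> t) s t"
    using cocycle[OF c(2,3,1,3)] c cocycle_one by (simp add: e)
  have 3: "\<omega> s t s * \<omega> t s t = 1"
    using cocycle[OF c(1,3,1,3)] c cocycle_one by (simp add: e)
  have n: "\<omega> t \<kappa> s \<noteq> 0" using cocycle_nonzero c by simp
  have "\<omega> t (\<kappa> \<otimes> s) t * \<omega> \<kappa> s t = \<omega> \<gamma> t s * \<omega> t s t * inverse (\<omega> t \<kappa> s)"
    using 1 2 n by (simp add: field_simps)
  then have "\<omega> t (\<kappa> \<otimes> s) t * \<omega> \<kappa> s t * \<omega> s t s = \<omega> \<gamma> t s * inverse (\<omega> t \<kappa> s) * (\<omega> s t s * \<omega> t s t)"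
    by simp
  then show ?thesis using c by (simp add: e 3 cnj_cocycle mult.assoc)
qed

end

section \<open>The twisted associator and the twisted adjoint\<close>

context strict_graded_category
begin

lemma aproj_degrees_zero:
  assumes "X \<in> Ob C" "a \<in> carrier \<Gamma>" "a \<notin> degs X" shows "proj a X = 0"
  using assms by (simp add: degrees_def)

definition twisted_assoc :: "('g \<Rightarrow> 'g \<Rightarrow> 'g \<Rightarrow> complex) \<Rightarrow> 'o \<Rightarrow> 'o \<Rightarrow> 'o \<Rightarrow> 'm" where
  "twisted_assoc \<omega> = assoc (twisted_category \<Gamma> Gr \<omega> C)"

lemma twisted_category_update: "twisted_category \<Gamma> Gr \<omega> C = C\<lparr>assoc := twisted_assoc \<omega>\<rparr>"
  by (simp add: twisted_category_def twisted_assoc_def)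

lemma twisted_assoc_sum:
  assumes X: "X \<in> Ob C" "Y \<in> Ob C" "Z \<in> Ob C"
  shows "twisted_assoc \<omega> X Y Z = (\<Sum>(a, b, c)\<in>degs X \<times> degs Y \<times> degs Z.
    mor (\<omega> a b c *\<^sub>s (\<pi> a X || (\<pi> b Y || \<pi> c Z))))"
proof -
  have 1: "assoc C X Y Z \<cdot> ((proj a X \<odot> proj b Y) \<odot> proj c Z) = mor (\<pi> a X || (\<pi> b Y || \<pi> c Z))"
    if "a \<in> carrier \<Gamma>" "b \<in> carrier \<Gamma>" "c \<in> carrier \<Gamma>" for a b c
  proof -
    have "mor (\<I> (X \<boxtimes> (Y \<boxtimes> Z)) \<bullet> (\<pi> a X || \<pi> b Y || \<pi> c Z)) = mor (\<pi> a X || (\<pi> b Y || \<pi> c Z))"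
      using X that by (subst acomp_id) (simp_all add: atens_assoc)
    then show ?thesis using X by (simp add: assoc_id)
  qed
  have "twisted_assoc \<omega> X Y Z = (\<Sum>a\<in>degs X. \<Sum>b\<in>degs Y. \<Sum>c\<in>degs Z.
    mor (\<omega> a b c *\<^sub>s (\<pi> a X || (\<pi> b Y || \<pi> c Z))))"
    unfolding twisted_assoc_def twisted_category_def
    using 1 by (simp add: degrees_def)
  then show ?thesis by (simp add: sum.cartesian_product case_prod_unfold)
qed

lemma arr_twisted:
  assumes X: "X \<in> Ob C" "Y \<in> Ob C" "Z \<in> Ob C"
  shows "arr (assoc_arr (twisted_assoc \<omega>) X Y Z)"
proof -
  have "mor (\<omega> a b c *\<^sub>s (\<pi> a X || (\<pi> b Y || \<pi> c Z))) \<in> Hom C (X \<boxtimes> (Y \<boxtimes> Z)) (X \<boxtimes> (Y \<boxtimes> Z))"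
    if "a \<in> degs X" "b \<in> degs Y" "c \<in> degs Z" for a b c
    using arr_mor[of "\<omega> a b c *\<^sub>s (\<pi> a X || (\<pi> b Y || \<pi> c Z))"] that X by (simp add: degrees_def)
  then show ?thesis
    unfolding assoc_arr_def twisted_assoc_sum[OF X] using X
    by (auto intro!: sum_in simp del: sel_simps)
qed

text \<open>
  Only the term of degrees \<open>(a, b, c)\<close> of the sum survives. It is missing from the sum if one of the
  projections is zero, but then both sides are zero.
\<close>

lemma twisted_aproj:
  assumes X: "X \<in> Ob C" "Y \<in> Ob C" "Z \<in> Ob C" and a: "a \<in> carrier \<Gamma>" "b \<in> carrier \<Gamma>" "c \<in> carrier \<Gamma>"
  shows "assoc_arr (twisted_assoc \<omega>) X Y Z \<bullet> (\<pi> a X || (\<pi> b Y || \<pi> c Z)) = \<omega> a b c *\<^sub>s (\<pi> a X || (\<pi> b Y || \<pi> c Z))"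
proof (rule arrow_eqI)
  let ?D = "degs X \<times> degs Y \<times> degs Z"
  let ?W = "X \<boxtimes> (Y \<boxtimes> Z)"
  define q where "q = mor (\<pi> a X || (\<pi> b Y || \<pi> c Z))"
  define t where "t p = mor (case p of (a, b, c) \<Rightarrow> \<omega> a b c *\<^sub>s (\<pi> a X || (\<pi> b Y || \<pi> c Z)))" for p
  have D: "a' \<in> carrier \<Gamma>" "b' \<in> carrier \<Gamma>" "c' \<in> carrier \<Gamma>" if "(a', b', c') \<in> ?D" for a' b' c'
    using that by (auto simp: degrees_def)
  have W: "?W \<in> Ob C" using X by simp
  have q: "q \<in> Hom C ?W ?W"
    using arr_mor[of "\<pi> a X || (\<pi> b Y || \<pi> c Z)"] X a by (simp add: q_def)
  have t: "t p \<in> Hom C ?W ?W" if "p \<in> ?D" for p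
    using arr_mor[of "case p of (a, b, c) \<Rightarrow> \<omega> a b c *\<^sub>s (\<pi> a X || (\<pi> b Y || \<pi> c Z))"] that D X by (auto simp: t_def)
  have tq: "t p \<cdot> q = (if p = (a, b, c) then smul C (\<omega> a b c) q else 0)" if "p \<in> ?D" for p
  proof -
    obtain a' b' c' where p: "p = (a', b', c')" by (cases p)
    have "(\<omega> a' b' c' *\<^sub>s (\<pi> a' X || (\<pi> b' Y || \<pi> c' Z))) \<bullet> (\<pi> a X || (\<pi> b Y || \<pi> c Z)) =
       (\<omega> a' b' c' * (of_bool (a' = a) * (of_bool (b' = b) * of_bool (c' = c)))) *\<^sub>s (\<pi> a X || (\<pi> b Y || \<pi> c Z))"
      using X a D[OF that[unfolded p]] by (simp add: interchange ascale_rules aproj_orth mult.assoc)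
    from arg_cong[where f = mor, OF this] show ?thesis
      by (auto simp: p t_def q_def)
  qed
  have "twisted_assoc \<omega> X Y Z \<cdot> q = (\<Sum>p\<in>?D. t p) \<cdot> q"
    unfolding twisted_assoc_sum[OF X] t_def by (simp add: case_prod_unfold)
  also have "\<dots> = (\<Sum>p\<in>?D. t p \<cdot> q)"
    by (rule comp_sum_left[OF W W W q t])
  also have "\<dots> = (\<Sum>p\<in>?D. if p = (a, b, c) then smul C (\<omega> a b c) q else 0)"
    by (rule sum.cong[OF refl tq])
  also have "\<dots> = (if (a, b, c) \<in> ?D then smul C (\<omega> a b c) q else 0)"
    using finite_degrees[OF X(1) a(1)] finite_degrees[OF X(2) a(1)] finite_degrees[OF X(3) a(1)] by simp
  also have "\<dots> = smul C (\<omega> a b c) q"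
  proof (cases "(a, b, c) \<in> ?D")
    case False
    then have "proj a X = 0 \<or> proj b Y = 0 \<or> proj c Z = 0"
      using aproj_degrees_zero X a by auto
    moreover note P = proj_in[OF X(1) a(1)] proj_in[OF X(2) a(2)] proj_in[OF X(3) a(3)]
    ultimately have "q = 0"
      using tmor_zero[OF X(2,2,3,3)] tmor_zero[OF X(1,1) tob_in[OF X(2,3)] tob_in[OF X(2,3)]]
        tmor_in[OF X(2,2,3,3) P(2,3)] by (auto simp: q_def)
    then show ?thesis by simp
  qed simp
  finally show "mor (assoc_arr (twisted_assoc \<omega>) X Y Z \<bullet> (\<pi> a X || (\<pi> b Y || \<pi> c Z))) =
     mor (\<omega> a b c *\<^sub>s (\<pi> a X || (\<pi> b Y || \<pi> c Z)))" by (simp add: q_def)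
qed simp_all

text \<open>
  Compare both sides on each component of degrees \<open>(a, b, c)\<close>: there the twisted associator is the same
  scalar on the source and on the target, because morphisms commute with the projections.
\<close>

lemma natural_assoc_twisted: "natural_assoc (twisted_assoc \<omega>)"
proof -
  have "assoc_arr (twisted_assoc \<omega>) (tgt F) (tgt G) (tgt H) \<bullet> (F || (G || H)) =
      (F || (G || H)) \<bullet> assoc_arr (twisted_assoc \<omega>) (src F) (src G) (src H)" (is "?L = ?R")
    if F: "arr F" "arr G" "arr H" for F G H
  proof (rule aproj_ext3[where X = "src F" and Y = "src G" and Z = "src H"], goal_cases)
    case (9 a b c)
    have n: "(F || (G || H)) \<bullet> (\<pi> a (src F) || (\<pi> b (src G) || \<pi> c (src H))) =
      (\<pi> a (tgt F) || (\<pi> b (tgt G) || \<pi> c (tgt H))) \<bullet> (F || (G || H))"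
      using F 9 by (simp add: interchange aproj_natural)
    have "?L \<bullet> (\<pi> a (src F) || (\<pi> b (src G) || \<pi> c (src H))) =
      assoc_arr (twisted_assoc \<omega>) (tgt F) (tgt G) (tgt H) \<bullet> (\<pi> a (tgt F) || (\<pi> b (tgt G) || \<pi> c (tgt H))) \<bullet> (F || (G || H))"
      using F 9 by (simp add: acomp_assoc arr_twisted n)
    also have "\<dots> = \<omega> a b c *\<^sub>s ((F || (G || H)) \<bullet> (\<pi> a (src F) || (\<pi> b (src G) || \<pi> c (src H))))"
      using F 9 by (simp add: twisted_aproj ascale_rules n)
    also have "\<dots> = ?R \<bullet> (\<pi> a (src F) || (\<pi> b (src G) || \<pi> c (src H)))"
      using F 9 by (simp add: acomp_assoc arr_twisted twisted_aproj ascale_rules)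
    finally show ?case .
  qed (use F arr_twisted in simp_all)
  then show ?thesis unfolding natural_assoc_def using arr_twisted by blast
qed

text \<open>
  The natural endomorphism of the identity functor that is multiplication by \<open>\<phi> a\<close> in degree \<open>a\<close>.
\<close>

definition degree_scalar :: "('g \<Rightarrow> complex) \<Rightarrow> 'o \<Rightarrow> ('o, 'm) arrow" where
  "degree_scalar \<phi> Y = Arrow Y Y (\<Sum>a\<in>degs Y. smul C (\<phi> a) (proj a Y))"

lemma degree_scalar_sel [simp]: "src (degree_scalar \<phi> Y) = Y" "tgt (degree_scalar \<phi> Y) = Y"
  by (simp_all add: degree_scalar_def)

lemma arr_degree_scalar [simp]: assumes "Y \<in> Ob C" shows "arr (degree_scalar \<phi> Y)"
proof -
  have "(\<Sum>a\<in>degs Y. smul C (\<phi> a) (proj a Y)) \<in> Hom C Y Y"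
    using assms by (intro sum_in smul_in proj_in) (auto simp: degrees_def)
  then show ?thesis using assms by (simp add: degree_scalar_def)
qed

lemma degree_scalar_aproj:
  assumes Y: "Y \<in> Ob C" and a: "a \<in> carrier \<Gamma>"
  shows "degree_scalar \<phi> Y \<bullet> \<pi> a Y = \<phi> a *\<^sub>s \<pi> a Y"
proof (rule arrow_eqI)
  have D: "b \<in> carrier \<Gamma>" if "b \<in> degs Y" for b using that by (simp add: degrees_def)
  have P: "proj b Y \<cdot> proj a Y = (if b = a then proj a Y else 0)" if "b \<in> carrier \<Gamma>" for b
    using arg_cong[OF aproj_orth[OF Y that a], of mor] by simp
  have "(\<Sum>b\<in>degs Y. smul C (\<phi> b) (proj b Y)) \<cdot> proj a Y =
    (\<Sum>b\<in>degs Y. smul C (\<phi> b) (proj b Y) \<cdot> proj a Y)"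
    using Y a D by (intro comp_sum_left[of Y Y Y] smul_in proj_in)
  also have "\<dots> = (\<Sum>b\<in>degs Y. if b = a then smul C (\<phi> a) (proj a Y) else 0)"
    using comp_smul_left[OF Y Y Y proj_in[OF Y a] proj_in[OF Y D]] P D by (intro sum.cong) auto
  also have "\<dots> = (if a \<in> degs Y then smul C (\<phi> a) (proj a Y) else 0)"
    using finite_degrees[OF Y a] by simp
  also have "\<dots> = smul C (\<phi> a) (proj a Y)"
    using aproj_degrees_zero[OF Y a] by auto
  finally show "mor (degree_scalar \<phi> Y \<bullet> \<pi> a Y) = mor (\<phi> a *\<^sub>s \<pi> a Y)" by (simp add: degree_scalar_def)
qed simp_all

lemma degree_scalar_natural:
  assumes "arr F" "X = src F" "Y = tgt F" shows "degree_scalar \<phi> Y \<bullet> F = F \<bullet> degree_scalar \<phi> X"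
proof (rule aproj_ext, goal_cases)
  case (5 a)
  have "degree_scalar \<phi> Y \<bullet> F \<bullet> \<pi> a X = degree_scalar \<phi> Y \<bullet> \<pi> a Y \<bullet> F"
    using assms 5 by (simp add: acomp_assoc aproj_natural)
  also have "\<dots> = \<phi> a *\<^sub>s (F \<bullet> \<pi> a X)"
    using assms 5 by (simp add: degree_scalar_aproj ascale_rules aproj_natural)
  also have "\<dots> = F \<bullet> degree_scalar \<phi> X \<bullet> \<pi> a X"
    using assms 5 by (simp add: acomp_assoc degree_scalar_aproj ascale_rules)
  finally show ?case using assms by simp
qed (use assms in simp_all)

lemma aproj_degree_scalar:
  assumes Y: "Y \<in> Ob C" and a: "a \<in> carrier \<Gamma>"
  shows "\<pi> a Y \<bullet> degree_scalar \<phi> Y = \<phi> a *\<^sub>s \<pi> a Y"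
  using degree_scalar_natural[of "\<pi> a Y" Y Y \<phi>] degree_scalar_aproj[OF assms] assms by simp

lemma degree_scalar_has_degree:
  assumes "Y \<in> Ob C" "has_degree C Gr s Y" "s \<in> carrier \<Gamma>"
  shows "degree_scalar \<phi> Y = \<phi> s *\<^sub>s \<I> Y"
  using degree_scalar_aproj[OF assms(1,3), of \<phi>] has_degree_aproj[OF assms(1,2,3,3)] assms by simp

lemma twisted_adj_aproj:
  assumes X: "X \<in> Ob C" "Y \<in> Ob C" "Z \<in> Ob C" and a: "a \<in> carrier \<Gamma>" "b \<in> carrier \<Gamma>" "c \<in> carrier \<Gamma>"
  shows "(assoc_arr (twisted_assoc \<omega>) X Y Z)\<dagger> \<bullet> (\<pi> a X || (\<pi> b Y || \<pi> c Z)) =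
    cnj (\<omega> a b c) *\<^sub>s (\<pi> a X || (\<pi> b Y || \<pi> c Z))"
proof -
  let ?A = "assoc_arr (twisted_assoc \<omega>) X Y Z" and ?P = "\<pi> a X || (\<pi> b Y || \<pi> c Z)"
  have "(?A \<bullet> ?P)\<dagger> = (\<omega> a b c *\<^sub>s ?P)\<dagger>" by (simp add: twisted_aproj assms)
  then have "?P \<bullet> ?A\<dagger> = cnj (\<omega> a b c) *\<^sub>s ?P"
    using assms arr_twisted by (simp add: aadj_comp aadj_tens ascale_rules)
  then show ?thesis
    using assoc_arr_adj_natural[OF natural_assoc_twisted, of "\<pi> a X" "\<pi> b Y" "\<pi> c Z" X Y Z X Y Z] assms by simp
qed

text \<open>
  A morphism into the unit object vanishes outside the trivial degree, so it can only pair components of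
  inverse degrees.
\<close>

lemma eval_aproj:
  assumes "arr E" "src E = Z \<boxtimes> S" "tgt E = unito C" "Z \<in> Ob C" "S \<in> Ob C" "a \<in> carrier \<Gamma>"
  shows "E \<bullet> (\<I> Z || \<pi> a S) = E \<bullet> (\<pi> (inv\<^sub>\<Gamma> a) Z || \<pi> a S)"
    and "E \<bullet> (\<pi> (inv\<^sub>\<Gamma> a) Z || \<I> S) = E \<bullet> (\<pi> (inv\<^sub>\<Gamma> a) Z || \<pi> a S)"
proof -
  have "E = E \<bullet> \<pi> \<one>\<^bsub>\<Gamma>\<^esub> (Z \<boxtimes> S)"
    using aproj_natural[of E "\<one>\<^bsub>\<Gamma>\<^esub>" "Z \<boxtimes> S" "unito C"] assms by (simp add: aproj_unit)
  then have *: "E \<bullet> F = E \<bullet> (\<pi> \<one>\<^bsub>\<Gamma>\<^esub> (Z \<boxtimes> S) \<bullet> F)" if "arr F" "tgt F = Z \<boxtimes> S" for F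
    using acomp_assoc[of F "\<pi> \<one>\<^bsub>\<Gamma>\<^esub> (Z \<boxtimes> S)" E] that assms by simp
  show "E \<bullet> (\<I> Z || \<pi> a S) = E \<bullet> (\<pi> (inv\<^sub>\<Gamma> a) Z || \<pi> a S)"
    by (subst *) (use assms in \<open>simp_all add: aproj_tens_right\<close>)
  show "E \<bullet> (\<pi> (inv\<^sub>\<Gamma> a) Z || \<I> S) = E \<bullet> (\<pi> (inv\<^sub>\<Gamma> a) Z || \<pi> a S)"
    by (subst *) (use assms in \<open>simp_all add: aproj_tens_left\<close>)
qed

lemma coeval_aproj:
  assumes "arr B" "src B = unito C" "tgt B = S \<boxtimes> Z" "Z \<in> Ob C" "S \<in> Ob C" "a \<in> carrier \<Gamma>"
  shows "(\<pi> a S || \<I> Z) \<bullet> B = (\<pi> a S || \<pi> (inv\<^sub>\<Gamma> a) Z) \<bullet> B"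
proof -
  have B: "B = \<pi> \<one>\<^bsub>\<Gamma>\<^esub> (S \<boxtimes> Z) \<bullet> B"
    using aproj_natural[of B "\<one>\<^bsub>\<Gamma>\<^esub>" "unito C" "S \<boxtimes> Z"] assms by (simp add: aproj_unit)
  have "(\<pi> a S || \<I> Z) \<bullet> \<pi> \<one>\<^bsub>\<Gamma>\<^esub> (S \<boxtimes> Z) = \<pi> a S || \<pi> (inv\<^sub>\<Gamma> a) Z"
    by (rule trans[OF aproj_natural[of "\<pi> a S || \<I> Z" "\<one>\<^bsub>\<Gamma>\<^esub>" "S \<boxtimes> Z" "S \<boxtimes> Z", symmetric]])
      (use assms in \<open>simp_all add: aproj_tens_left\<close>)
  then show ?thesis
    using acomp_assoc[of B "\<pi> \<one>\<^bsub>\<Gamma>\<^esub> (S \<boxtimes> Z)" "\<pi> a S || \<I> Z"] B assms by simp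
qed

text \<open>
  In the component of degree \<open>a\<close> of \<open>S\<close>, the coevaluation contributes degree \<open>a\<^sup>-\<^sup>1\<close> in \<open>Z\<close>, so the associator
  in the twisted equation is multiplication by \<open>\<omega> a a\<^sup>-\<^sup>1 a\<close>. This scalar is moved into the coevaluation.
\<close>

lemma zigzag_twist:
  assumes d: "dual_pair Z S E B"
    and z: "(\<I> S || E) \<bullet> assoc_arr (twisted_assoc \<omega>) S Z S \<bullet> (B || \<I> S) = \<I> S"
  shows "zigzag S E ((degree_scalar (\<lambda>a. \<omega> a (inv\<^sub>\<Gamma> a) a) S || \<I> Z) \<bullet> B)"
  unfolding zigzag_def
proof (rule aproj_ext, goal_cases)
  case (5 a)
  note D = dual_pairD[OF d]
  define \<chi> where "\<chi> = (\<lambda>a. \<omega> a (inv\<^sub>\<Gamma> a) a)"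
  define A where "A = assoc_arr (twisted_assoc \<omega>) S Z S"
  have A: "arr A" "src A = S \<boxtimes> (Z \<boxtimes> S)" "tgt A = S \<boxtimes> (Z \<boxtimes> S)" using D by (simp_all add: A_def arr_twisted)
  define B' where "B' = (\<pi> a S || \<pi> (inv\<^sub>\<Gamma> a) Z) \<bullet> B"
  have B': "arr B'" "src B' = unito C" "tgt B' = S \<boxtimes> Z" using D 5 by (simp_all add: B'_def)
  have cB: "(\<pi> a S || \<I> Z) \<bullet> B = B'" using coeval_aproj[of B S Z a] D 5 by (simp add: B'_def)
  have a: "a \<in> carrier \<Gamma>" "inv\<^sub>\<Gamma> a \<in> carrier \<Gamma>" using 5 by auto
  have piE: "\<pi> a S \<bullet> (\<I> S || E) = (\<I> S || E) \<bullet> (\<pi> a S || \<I> (Z \<boxtimes> S))"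
    using interchange[of "\<I> S" "\<pi> a S" E "\<I> (unito C)"] interchange[of "\<pi> a S" "\<I> S" "\<I> (Z \<boxtimes> S)" E] D a by simp
  have piB: "(\<pi> a S || \<I> (Z \<boxtimes> S)) \<bullet> (G || \<I> S) = ((\<pi> a S || \<I> Z) \<bullet> G) || \<I> S" if "arr G" "tgt G = S \<boxtimes> Z" for G
    using interchange[of G "\<pi> a S || \<I> Z" "\<I> S" "\<I> S"] D a that by (simp add: atens_assoc)
  have rB: "(G || \<I> S) \<bullet> \<pi> a S = G || \<pi> a S" if "arr G" "src G = unito C" for G
    using interchange[of "\<I> (unito C)" G "\<pi> a S" "\<I> S"] D a that by simp
  have idem: "\<pi> a Y \<bullet> \<pi> a Y = \<pi> a Y" if "Y \<in> Ob C" for Y using aproj_orth[OF that a(1,1)] by simp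
  have "(\<I> S || E) \<bullet> A \<bullet> (B || \<I> S) = \<I> S" using z by (simp add: A_def)
  then have "\<pi> a S \<bullet> ((\<I> S || E) \<bullet> A \<bullet> (B || \<I> S)) \<bullet> \<pi> a S = \<pi> a S"
    using D a idem by simp
  moreover have "\<pi> a S \<bullet> ((\<I> S || E) \<bullet> A \<bullet> (B || \<I> S)) \<bullet> \<pi> a S = \<chi> a *\<^sub>s ((\<I> S || E) \<bullet> (B' || \<pi> a S))"
  proof -
    have 1: "(\<pi> a S || \<I> (Z \<boxtimes> S)) \<bullet> A = A \<bullet> (\<pi> a S || \<I> (Z \<boxtimes> S))"
      unfolding A_def using assoc_arr_natural[OF natural_assoc_twisted, of "\<pi> a S" "\<I> Z" "\<I> S"] D a by simp
    have 2: "B' || \<pi> a S = (\<pi> a S || (\<pi> (inv\<^sub>\<Gamma> a) Z || \<pi> a S)) \<bullet> (B || \<I> S)"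
      unfolding B'_def using interchange[of B "\<pi> a S || \<pi> (inv\<^sub>\<Gamma> a) Z" "\<I> S" "\<pi> a S"] D a by (simp add: atens_assoc)
    have 3: "A \<bullet> (B' || \<pi> a S) = \<chi> a *\<^sub>s (B' || \<pi> a S)"
    proof -
      have "A \<bullet> (B' || \<pi> a S) = (A \<bullet> (\<pi> a S || (\<pi> (inv\<^sub>\<Gamma> a) Z || \<pi> a S))) \<bullet> (B || \<I> S)"
        unfolding 2 using D a A by (simp add: acomp_assoc)
      also have "\<dots> = \<chi> a *\<^sub>s (B' || \<pi> a S)"
        unfolding 2 A_def \<chi>_def using D a by (simp add: twisted_aproj ascale_rules)
      finally show ?thesis .
    qed
    have "\<pi> a S \<bullet> ((\<I> S || E) \<bullet> A \<bullet> (B || \<I> S)) \<bullet> \<pi> a S =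
      (\<pi> a S \<bullet> (\<I> S || E)) \<bullet> A \<bullet> ((B || \<I> S) \<bullet> \<pi> a S)"
      using D a A by (simp add: acomp_assoc)
    also have "\<dots> = (\<I> S || E) \<bullet> ((\<pi> a S || \<I> (Z \<boxtimes> S)) \<bullet> A) \<bullet> (B || \<pi> a S)"
      unfolding piE using D a A rB[of B] by (simp add: acomp_assoc)
    also have "\<dots> = (\<I> S || E) \<bullet> A \<bullet> ((\<pi> a S || \<I> (Z \<boxtimes> S)) \<bullet> (B || \<pi> a S))"
      unfolding 1 using D a A by (simp add: acomp_assoc)
    also have "(\<pi> a S || \<I> (Z \<boxtimes> S)) \<bullet> (B || \<pi> a S) = B' || \<pi> a S"
      using interchange[of B "\<pi> a S || \<I> Z" "\<pi> a S" "\<I> S"] D a cB by (simp add: atens_assoc)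
    also have "(\<I> S || E) \<bullet> A \<bullet> (B' || \<pi> a S) = \<chi> a *\<^sub>s ((\<I> S || E) \<bullet> (B' || \<pi> a S))"
      using D a A B' 3 by (simp add: acomp_assoc ascale_rules)
    finally show ?thesis .
  qed
  ultimately have L: "\<chi> a *\<^sub>s ((\<I> S || E) \<bullet> (B' || \<pi> a S)) = \<pi> a S" by simp
  define W where "W = (\<I> S || E) \<bullet> (((degree_scalar \<chi> S || \<I> Z) \<bullet> B) || \<I> S)"
  have W: "arr W" "src W = S" "tgt W = S" using D by (simp_all add: W_def)
  have sB: "(\<pi> a S || \<I> Z) \<bullet> ((degree_scalar \<chi> S || \<I> Z) \<bullet> B) = \<chi> a *\<^sub>s B'"
  proof -
    have "(\<pi> a S || \<I> Z) \<bullet> (degree_scalar \<chi> S || \<I> Z) = \<chi> a *\<^sub>s (\<pi> a S || \<I> Z)"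
      using D a by (simp add: interchange aproj_degree_scalar ascale_rules)
    then show ?thesis
      using acomp_assoc[of B "degree_scalar \<chi> S || \<I> Z" "\<pi> a S || \<I> Z"] D a cB by (simp add: ascale_rules)
  qed
  have "W \<bullet> \<pi> a S = W \<bullet> \<pi> a S \<bullet> \<pi> a S" using W a D idem by (simp add: acomp_assoc)
  also have "\<dots> = \<pi> a S \<bullet> W \<bullet> \<pi> a S" using aproj_natural[OF W(1) a(1) W(2,3)[symmetric]] by simp
  also have "\<dots> = (\<I> S || E) \<bullet> ((\<pi> a S || \<I> (Z \<boxtimes> S)) \<bullet> (((degree_scalar \<chi> S || \<I> Z) \<bullet> B) || \<I> S)) \<bullet> \<pi> a S"
    unfolding W_def using D a piE
    by (simp add: acomp_assoc acomp_slide[OF piE])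
  also have "\<dots> = \<chi> a *\<^sub>s ((\<I> S || E) \<bullet> ((B' || \<I> S) \<bullet> \<pi> a S))"
    using piB[of "(degree_scalar \<chi> S || \<I> Z) \<bullet> B"] D a sB B' by (simp add: acomp_assoc ascale_rules)
  also have "\<dots> = \<pi> a S" using rB[OF B'(1,2)] L by simp
  finally show ?case using D a by (simp add: W_def \<chi>_def)
qed (use dual_pairD[OF d] in simp_all)

text \<open>
  The evaluation pairs degree \<open>a\<close> of \<open>S\<close> with degree \<open>a\<^sup>-\<^sup>1\<close> of \<open>Z\<close>. So a projection applied to \<open>S\<close> in the
  target of \<open>G\<close> can be replaced by one applied to \<open>Z\<close>, which commutes with everything else.
\<close>

lemma arrow_star_restrict:
  assumes A: "natural_assoc A" and d: "dual_pair Z S E B" and X: "Xk \<in> Ob C" "Xj \<in> Ob C"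
    and G: "arr G" "src G = Xk \<boxtimes> S" "tgt G = S \<boxtimes> Xj" and a: "a \<in> carrier \<Gamma>"
  shows "arrow_star A Z S Xk Xj E B ((\<pi> a S || \<I> Xj) \<bullet> G) = arrow_star A Z S Xk Xj E B G \<bullet> (\<pi> (inv\<^sub>\<Gamma> a) Z || \<I> Xk)"
proof -
  note D = dual_pairD[OF d] X G a
  define P where "P = \<pi> (inv\<^sub>\<Gamma> a) Z"
  have P: "arr P" "src P = Z" "tgt P = Z" using D by (simp_all add: P_def)
  define a1 where "a1 = (assoc_arr A Z S Xj)\<dagger>"
  define a2 where "a2 = (assoc_arr A Z (Xk \<boxtimes> S) Z)\<dagger>"
  define a3 where "a3 = (assoc_arr A Xk S Z)\<dagger>"
  define Y where "Y = a3 \<bullet> (\<I> Xk || B)"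
  have al: "arr a1" "src a1 = Z \<boxtimes> (S \<boxtimes> Xj)" "tgt a1 = Z \<boxtimes> (S \<boxtimes> Xj)"
    "arr a2" "src a2 = Z \<boxtimes> (Xk \<boxtimes> (S \<boxtimes> Z))" "tgt a2 = Z \<boxtimes> (Xk \<boxtimes> (S \<boxtimes> Z))"
    "arr a3" "src a3 = Xk \<boxtimes> (S \<boxtimes> Z)" "tgt a3 = Xk \<boxtimes> (S \<boxtimes> Z)"
    using D arr_assocow[OF A] by (simp_all add: a1_def a2_def a3_def)
  have Y: "arr Y" "src Y = Xk" "tgt Y = Xk \<boxtimes> (S \<boxtimes> Z)" using D al by (simp_all add: Y_def)
  note D = D P al Y
  have e0: "(\<I> Z || ((\<pi> a S || \<I> Xj) \<bullet> G)) || \<I> Z = (\<I> Z || (\<pi> a S || \<I> (Xj \<boxtimes> Z))) \<bullet> ((\<I> Z || G) || \<I> Z)"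
    using interchange[of "\<I> Z" "\<I> Z" G "\<pi> a S || \<I> Xj"]
      interchange[of "\<I> Z || G" "\<I> Z || (\<pi> a S || \<I> Xj)" "\<I> Z" "\<I> Z"] D by (simp add: atens_assoc)
  have e1: "(((E || \<I> Xj) \<bullet> a1) || \<I> Z) \<bullet> (\<I> Z || (\<pi> a S || \<I> (Xj \<boxtimes> Z))) =
     (((E || \<I> Xj) \<bullet> a1) || \<I> Z) \<bullet> (P || \<I> (S \<boxtimes> (Xj \<boxtimes> Z)))"
  proof -
    have "a1 \<bullet> (\<I> Z || (\<pi> a S || \<I> Xj)) = (\<I> Z || (\<pi> a S || \<I> Xj)) \<bullet> a1"
      "a1 \<bullet> (P || \<I> (S \<boxtimes> Xj)) = (P || \<I> (S \<boxtimes> Xj)) \<bullet> a1"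
      using assoc_arr_adj_natural[OF A, of "\<I> Z" "\<pi> a S" "\<I> Xj"] assoc_arr_adj_natural[OF A, of P "\<I> S" "\<I> Xj"] D
      by (simp_all add: a1_def)
    moreover have "(E || \<I> Xj) \<bullet> (\<I> Z || (\<pi> a S || \<I> Xj)) = (E || \<I> Xj) \<bullet> (P || \<I> (S \<boxtimes> Xj))"
      using interchange[of "\<I> Z || \<pi> a S" E "\<I> Xj" "\<I> Xj"] interchange[of "P || \<I> S" E "\<I> Xj" "\<I> Xj"]
       eval_aproj[of E Z S a] D by (simp add: atens_assoc P_def)
    ultimately have "((E || \<I> Xj) \<bullet> a1) \<bullet> (\<I> Z || (\<pi> a S || \<I> Xj)) = ((E || \<I> Xj) \<bullet> a1) \<bullet> (P || \<I> (S \<boxtimes> Xj))"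
      using D acomp_assoc[of a1 "\<I> Z || (\<pi> a S || \<I> Xj)" "E || \<I> Xj"] acomp_assoc[of a1 "P || \<I> (S \<boxtimes> Xj)" "E || \<I> Xj"]
      by (simp add: acomp_assoc)
    then show ?thesis
      using interchange[of "\<I> Z || (\<pi> a S || \<I> Xj)" "(E || \<I> Xj) \<bullet> a1" "\<I> Z" "\<I> Z"]
        interchange[of "P || \<I> (S \<boxtimes> Xj)" "(E || \<I> Xj) \<bullet> a1" "\<I> Z" "\<I> Z"] D by (simp add: atens_assoc)
  qed
  have e2: "(P || \<I> (S \<boxtimes> (Xj \<boxtimes> Z))) \<bullet> ((\<I> Z || G) || \<I> Z) = ((\<I> Z || G) || \<I> Z) \<bullet> (P || \<I> (Xk \<boxtimes> (S \<boxtimes> Z)))"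
    using D by (simp add: atens_assoc interchange)
  have e3: "(P || \<I> (Xk \<boxtimes> (S \<boxtimes> Z))) \<bullet> a2 = a2 \<bullet> (P || \<I> (Xk \<boxtimes> (S \<boxtimes> Z)))"
    using assoc_arr_adj_natural[OF A, of P "\<I> (Xk \<boxtimes> S)" "\<I> Z"] D by (simp add: a2_def)
  have e4: "(P || \<I> (Xk \<boxtimes> (S \<boxtimes> Z))) \<bullet> (\<I> Z || Y) = (\<I> Z || Y) \<bullet> (P || \<I> Xk)"
    using D by (simp add: interchange)
  show ?thesis
    unfolding arrow_star_def e0 a1_def[symmetric] a2_def[symmetric] a3_def[symmetric] Y_def[symmetric] P_def[symmetric]
    using D by (simp add: acomp_assoc acomp_slide[OF e1] acomp_slide[OF e2] acomp_slide[OF e3] e4)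
qed

text \<open>
  If \<open>G\<close> takes values in the component of degree \<open>a\<close> of \<open>S\<close>, then it is supported on the component of degree
  \<open>b\<close> of the \<open>S\<close> in its source, where \<open>\<kappa> b = a \<gamma>\<close>. The evaluation forces degree \<open>a\<^sup>-\<^sup>1\<close> on the left \<open>Z\<close> and
  the coevaluation degree \<open>b\<^sup>-\<^sup>1\<close> on the right \<open>Z\<close>, so each of the three associators is a scalar.
\<close>

lemma arrow_star_component:
  assumes d: "dual_pair Z S E B" and X: "Xk \<in> Ob C" "Xj \<in> Ob C" "has_degree C Gr \<kappa> Xk" "has_degree C Gr \<gamma> Xj"
    and c: "\<kappa> \<in> carrier \<Gamma>" "\<gamma> \<in> carrier \<Gamma>" "a \<in> carrier \<Gamma>"
    and G: "arr G" "src G = Xk \<boxtimes> S" "tgt G = S \<boxtimes> Xj" and Ga: "(\<pi> a S || \<I> Xj) \<bullet> G = G"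
  defines "b \<equiv> inv\<^sub>\<Gamma> \<kappa> \<otimes>\<^sub>\<Gamma> (a \<otimes>\<^sub>\<Gamma> \<gamma>)"
  shows "arrow_star (twisted_assoc \<omega>) Z S Xk Xj E B G =
    cnj (\<omega> (inv\<^sub>\<Gamma> a) a \<gamma> * \<omega> (inv\<^sub>\<Gamma> a) (\<kappa> \<otimes>\<^sub>\<Gamma> b) (inv\<^sub>\<Gamma> b) * \<omega> \<kappa> b (inv\<^sub>\<Gamma> b)) *\<^sub>s strict_star Z S Xk Xj E B G"
    and "G \<bullet> (\<I> Xk || \<pi> b S) = G"
proof -
  have b: "b \<in> carrier \<Gamma>" using c by (simp add: b_def)
  note D = dual_pairD[OF d] X(1,2) G c b
  have \<kappa>: "\<pi> \<kappa> Xk = \<I> Xk" using has_degree_aproj[OF X(1,3) c(1,1)] by simp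
  have \<gamma>: "\<pi> \<gamma> Xj = \<I> Xj" using has_degree_aproj[OF X(2,4) c(2,2)] by simp
  have G1: "\<pi> (a \<otimes>\<^sub>\<Gamma> \<gamma>) (S \<boxtimes> Xj) \<bullet> G = G"
    using aproj_tens[of S Xj a \<gamma> "a \<otimes>\<^sub>\<Gamma> \<gamma>"] D Ga \<gamma>
      acomp_assoc[of G "\<pi> a S || \<I> Xj" "\<pi> (a \<otimes>\<^sub>\<Gamma> \<gamma>) (S \<boxtimes> Xj)"] by simp
  have "\<pi> (a \<otimes>\<^sub>\<Gamma> \<gamma>) (Xk \<boxtimes> S) = \<I> Xk || \<pi> b S"
    using aproj_tens_left[of Xk S \<kappa> "a \<otimes>\<^sub>\<Gamma> \<gamma>"] D \<kappa> by (simp add: b_def)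
  then show Gb: "G \<bullet> (\<I> Xk || \<pi> b S) = G"
    using aproj_natural[of G "a \<otimes>\<^sub>\<Gamma> \<gamma>" "Xk \<boxtimes> S" "S \<boxtimes> Xj"] G1 D by simp
  define P where "P = \<pi> (inv\<^sub>\<Gamma> a) Z"
  define p where "p = \<pi> a S"
  define q where "q = \<pi> b S"
  define Q where "Q = \<pi> (inv\<^sub>\<Gamma> b) Z"
  have PQ: "arr P" "src P = Z" "tgt P = Z" "arr Q" "src Q = Z" "tgt Q = Z" "arr p" "src p = S" "tgt p = S"
    "arr q" "src q = S" "tgt q = S" using D by (simp_all add: P_def Q_def p_def q_def)
  define a1 where "a1 = (assoc_arr (twisted_assoc \<omega>) Z S Xj)\<dagger>"
  define a2 where "a2 = (assoc_arr (twisted_assoc \<omega>) Z (Xk \<boxtimes> S) Z)\<dagger>"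
  define a3 where "a3 = (assoc_arr (twisted_assoc \<omega>) Xk S Z)\<dagger>"
  have al: "arr a1" "src a1 = Z \<boxtimes> (S \<boxtimes> Xj)" "tgt a1 = Z \<boxtimes> (S \<boxtimes> Xj)"
    "arr a2" "src a2 = Z \<boxtimes> (Xk \<boxtimes> (S \<boxtimes> Z))" "tgt a2 = Z \<boxtimes> (Xk \<boxtimes> (S \<boxtimes> Z))"
    "arr a3" "src a3 = Xk \<boxtimes> (S \<boxtimes> Z)" "tgt a3 = Xk \<boxtimes> (S \<boxtimes> Z)"
    using D arr_twisted by (simp_all add: a1_def a2_def a3_def)
  define Y where "Y = a3 \<bullet> (\<I> Xk || B)"
  have Y: "arr Y" "src Y = Xk" "tgt Y = Xk \<boxtimes> (S \<boxtimes> Z)" using D al by (simp_all add: Y_def)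
  note D = D PQ al Y
  note nat = assoc_arr_adj_natural[OF natural_assoc_twisted[of \<omega>]]
  define c1 where "c1 = cnj (\<omega> (inv\<^sub>\<Gamma> a) a \<gamma>)"
  define c2 where "c2 = cnj (\<omega> (inv\<^sub>\<Gamma> a) (\<kappa> \<otimes>\<^sub>\<Gamma> b) (inv\<^sub>\<Gamma> b))"
  define c3 where "c3 = cnj (\<omega> \<kappa> b (inv\<^sub>\<Gamma> b))"
  have t1: "a1 \<bullet> (P || (p || \<I> Xj)) = c1 *\<^sub>s (P || (p || \<I> Xj))"
    using twisted_adj_aproj[of Z S Xj "inv\<^sub>\<Gamma> a" a \<gamma> \<omega>] D \<gamma> by (simp add: a1_def P_def p_def c1_def)
  have t3: "a3 \<bullet> (\<I> Xk || (q || Q)) = c3 *\<^sub>s (\<I> Xk || (q || Q))"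
    using twisted_adj_aproj[of Xk S Z \<kappa> b "inv\<^sub>\<Gamma> b" \<omega>] D \<kappa> by (simp add: a3_def Q_def q_def c3_def)
  have t2: "a2 \<bullet> (P || (\<I> Xk || (q || Q))) = c2 *\<^sub>s (P || (\<I> Xk || (q || Q)))"
  proof -
    have "\<pi> (\<kappa> \<otimes>\<^sub>\<Gamma> b) (Xk \<boxtimes> S) \<bullet> (\<I> Xk || q) = \<I> Xk || q"
      using aproj_tens[of Xk S \<kappa> b "\<kappa> \<otimes>\<^sub>\<Gamma> b"] D \<kappa> by (simp add: q_def)
    then have "P || (\<I> Xk || (q || Q)) = (P || (\<pi> (\<kappa> \<otimes>\<^sub>\<Gamma> b) (Xk \<boxtimes> S) || Q)) \<bullet> (\<I> Z || ((\<I> Xk || q) || \<I> Z))"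
      using interchange[of "(\<I> Xk || q) || \<I> Z" "\<I> Z"]
        interchange[of "\<I> Z" P "(\<I> Xk || q) || \<I> Z" "\<pi> (\<kappa> \<otimes>\<^sub>\<Gamma> b) (Xk \<boxtimes> S) || Q"]
        interchange[of "\<I> Xk || q" "\<pi> (\<kappa> \<otimes>\<^sub>\<Gamma> b) (Xk \<boxtimes> S)" "\<I> Z" Q] D by (simp add: atens_assoc)
    moreover have "a2 \<bullet> (P || (\<pi> (\<kappa> \<otimes>\<^sub>\<Gamma> b) (Xk \<boxtimes> S) || Q)) = c2 *\<^sub>s (P || (\<pi> (\<kappa> \<otimes>\<^sub>\<Gamma> b) (Xk \<boxtimes> S) || Q))"
      using twisted_adj_aproj[of Z "Xk \<boxtimes> S" Z "inv\<^sub>\<Gamma> a" "\<kappa> \<otimes>\<^sub>\<Gamma> b" "inv\<^sub>\<Gamma> b" \<omega>] D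
      by (simp add: a2_def P_def Q_def c2_def)
    ultimately show ?thesis
      using acomp_assoc[of "\<I> Z || ((\<I> Xk || q) || \<I> Z)" "P || (\<pi> (\<kappa> \<otimes>\<^sub>\<Gamma> b) (Xk \<boxtimes> S) || Q)" a2] D
      by (simp add: ascale_rules)
  qed
  define K where "K = P || (\<I> Xk || (q || \<I> Z))"
  have K: "arr K" "src K = Z \<boxtimes> (Xk \<boxtimes> (S \<boxtimes> Z))" "tgt K = Z \<boxtimes> (Xk \<boxtimes> (S \<boxtimes> Z))" using D by (simp_all add: K_def)
  define g where "g = (\<I> Z || G) || \<I> Z"
  have g: "arr g" "src g = Z \<boxtimes> (Xk \<boxtimes> (S \<boxtimes> Z))" "tgt g = Z \<boxtimes> (S \<boxtimes> (Xj \<boxtimes> Z))" using D by (simp_all add: g_def)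
  note D = D K g
  have EP: "E \<bullet> (\<I> Z || p) = E \<bullet> (P || p)"
    using eval_aproj(1)[of E Z S a] D by (simp add: P_def p_def)
  \<comment> \<open>\<open>K\<close> collects the projections forced on the source of \<open>g\<close>; the evaluation side produces it, with the scalar \<open>c1\<close> if \<open>a1\<close> is present\<close>
  have g1: "(\<I> Z || (p || \<I> (Xj \<boxtimes> Z))) \<bullet> g = g"
    using interchange[of "\<I> Z" "\<I> Z" G "p || \<I> Xj"]
      interchange[of "\<I> Z || G" "\<I> Z || (p || \<I> Xj)" "\<I> Z" "\<I> Z"] D Ga
    by (simp add: atens_assoc g_def p_def)
  have g2: "(P || (p || \<I> (Xj \<boxtimes> Z))) \<bullet> g = g \<bullet> K"
  proof -
    have "G \<bullet> (\<I> Xk || q) = G" using Gb by (simp add: q_def)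
    moreover have "(p || \<I> Xj) \<bullet> G = G" using Ga by (simp add: p_def)
    moreover have "g \<bullet> K = (P || (G \<bullet> (\<I> Xk || q))) || \<I> Z"
      using interchange[of "P || (\<I> Xk || q)" "\<I> Z || G" "\<I> Z" "\<I> Z"]
        interchange[of P "\<I> Z" "\<I> Xk || q" G] D by (simp add: atens_assoc K_def g_def)
    moreover have "(P || (p || \<I> (Xj \<boxtimes> Z))) \<bullet> g = (P || ((p || \<I> Xj) \<bullet> G)) || \<I> Z"
      using interchange[of "\<I> Z || G" "P || (p || \<I> Xj)" "\<I> Z" "\<I> Z"]
        interchange[of "\<I> Z" P G "p || \<I> Xj"] D by (simp add: atens_assoc g_def)
    ultimately show ?thesis by simp
  qed
  have L0: "(E || \<I> (Xj \<boxtimes> Z)) \<bullet> (\<I> Z || (p || \<I> (Xj \<boxtimes> Z))) = (E || \<I> (Xj \<boxtimes> Z)) \<bullet> (P || (p || \<I> (Xj \<boxtimes> Z)))"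
    using interchange[of "\<I> Z || p" E "\<I> (Xj \<boxtimes> Z)" "\<I> (Xj \<boxtimes> Z)"]
       interchange[of "P || p" E "\<I> (Xj \<boxtimes> Z)" "\<I> (Xj \<boxtimes> Z)"] EP D by (simp add: atens_assoc)
  have L1': "(E || \<I> (Xj \<boxtimes> Z)) \<bullet> g = (E || \<I> (Xj \<boxtimes> Z)) \<bullet> g \<bullet> K"
  proof -
    have "(E || \<I> (Xj \<boxtimes> Z)) \<bullet> g = (E || \<I> (Xj \<boxtimes> Z)) \<bullet> ((\<I> Z || (p || \<I> (Xj \<boxtimes> Z))) \<bullet> g)" by (simp add: g1)
    also have "\<dots> = (E || \<I> (Xj \<boxtimes> Z)) \<bullet> ((P || (p || \<I> (Xj \<boxtimes> Z))) \<bullet> g)"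
      by (rule acomp_slide[OF L0]) (use D in simp_all)
    also have "\<dots> = (E || \<I> (Xj \<boxtimes> Z)) \<bullet> g \<bullet> K" unfolding g2 using D by (simp add: acomp_assoc)
    finally show ?thesis .
  qed
  have L2: "(((E || \<I> Xj) \<bullet> a1) || \<I> Z) \<bullet> (\<I> Z || (p || \<I> (Xj \<boxtimes> Z))) = c1 *\<^sub>s ((E || \<I> (Xj \<boxtimes> Z)) \<bullet> (P || (p || \<I> (Xj \<boxtimes> Z))))"
  proof -
    have 1: "a1 \<bullet> (\<I> Z || (p || \<I> Xj)) = (\<I> Z || (p || \<I> Xj)) \<bullet> a1"
      "a1 \<bullet> (P || (p || \<I> Xj)) = (P || (p || \<I> Xj)) \<bullet> a1"
      using nat[of "\<I> Z" p "\<I> Xj"] nat[of P p "\<I> Xj"] D by (simp_all add: a1_def)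
    have 2: "(E || \<I> Xj) \<bullet> (\<I> Z || (p || \<I> Xj)) = (E || \<I> Xj) \<bullet> (P || (p || \<I> Xj))"
      using interchange[of "\<I> Z || p" E "\<I> Xj" "\<I> Xj"] interchange[of "P || p" E "\<I> Xj" "\<I> Xj"] EP D by (simp add: atens_assoc)
    have "((E || \<I> Xj) \<bullet> a1) \<bullet> (\<I> Z || (p || \<I> Xj)) = (E || \<I> Xj) \<bullet> ((\<I> Z || (p || \<I> Xj)) \<bullet> a1)"
      using D 1 by (simp add: acomp_assoc)
    also have "\<dots> = (E || \<I> Xj) \<bullet> ((P || (p || \<I> Xj)) \<bullet> a1)"
      by (rule acomp_slide[OF 2]) (use D in simp_all)
    also have "\<dots> = c1 *\<^sub>s ((E \<bullet> (P || p)) || \<I> Xj)"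
      unfolding 1(2)[symmetric] t1 using D interchange[of "P || p" E "\<I> Xj" "\<I> Xj"] by (simp add: ascale_rules atens_assoc)
    finally show ?thesis
      using interchange[of "\<I> Z || (p || \<I> Xj)" "(E || \<I> Xj) \<bullet> a1" "\<I> Z" "\<I> Z"]
        interchange[of "P || p" E "\<I> (Xj \<boxtimes> Z)" "\<I> (Xj \<boxtimes> Z)"] D by (simp add: atens_assoc ascale_rules)
  qed
  have L1: "(((E || \<I> Xj) \<bullet> a1) || \<I> Z) \<bullet> g = c1 *\<^sub>s ((E || \<I> (Xj \<boxtimes> Z)) \<bullet> g \<bullet> K)"
  proof -
    have "(((E || \<I> Xj) \<bullet> a1) || \<I> Z) \<bullet> g = (((E || \<I> Xj) \<bullet> a1) || \<I> Z) \<bullet> (\<I> Z || (p || \<I> (Xj \<boxtimes> Z))) \<bullet> g"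
      using D by (simp add: acomp_assoc g1)
    also have "\<dots> = c1 *\<^sub>s ((E || \<I> (Xj \<boxtimes> Z)) \<bullet> ((P || (p || \<I> (Xj \<boxtimes> Z))) \<bullet> g))"
      unfolding L2 using D by (simp add: acomp_assoc ascale_rules)
    finally show ?thesis unfolding g2 using D by (simp add: acomp_assoc)
  qed
  \<comment> \<open>in front of the coevaluation, \<open>K\<close> turns the associators \<open>a2\<close> and \<open>a3\<close> into scalars\<close>
  have R1: "(\<I> Xk || (q || \<I> Z)) \<bullet> (\<I> Xk || B) = (\<I> Xk || (q || Q)) \<bullet> (\<I> Xk || B)"
    using coeval_aproj[of B S Z b] D by (simp add: interchange q_def Q_def)
  have R2: "(\<I> Xk || (q || \<I> Z)) \<bullet> Y = c3 *\<^sub>s ((\<I> Xk || (q || Q)) \<bullet> (\<I> Xk || B))"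
  proof -
    have "(\<I> Xk || (q || \<I> Z)) \<bullet> Y = ((\<I> Xk || (q || \<I> Z)) \<bullet> a3) \<bullet> (\<I> Xk || B)"
      using D by (simp add: Y_def acomp_assoc)
    also have "(\<I> Xk || (q || \<I> Z)) \<bullet> a3 = a3 \<bullet> (\<I> Xk || (q || \<I> Z))"
      using nat[of "\<I> Xk" q "\<I> Z"] D by (simp add: a3_def)
    also have "\<dots> \<bullet> (\<I> Xk || B) = a3 \<bullet> ((\<I> Xk || (q || \<I> Z)) \<bullet> (\<I> Xk || B))"
      using D by (simp add: acomp_assoc)
    also have "\<dots> = (a3 \<bullet> (\<I> Xk || (q || Q))) \<bullet> (\<I> Xk || B)"
      unfolding R1 using D by (simp add: acomp_assoc)
    also have "\<dots> = c3 *\<^sub>s ((\<I> Xk || (q || Q)) \<bullet> (\<I> Xk || B))"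
      unfolding t3 using D by (simp add: ascale_rules)
    finally show ?thesis .
  qed
  have KB: "P || ((\<I> Xk || (q || Q)) \<bullet> (\<I> Xk || B)) = (P || (\<I> Xk || (q || Q))) \<bullet> (\<I> (Z \<boxtimes> Xk) || B)"
    using interchange[of "\<I> Z" P "\<I> Xk || B" "\<I> Xk || (q || Q)"] D by simp
  have KB': "K \<bullet> (\<I> (Z \<boxtimes> Xk) || B) = P || ((\<I> Xk || (q || Q)) \<bullet> (\<I> Xk || B))"
    unfolding R1[symmetric] K_def using interchange[of "\<I> Z" P "\<I> Xk || B" "\<I> Xk || (q || \<I> Z)"] D by simp
  have R3: "K \<bullet> (a2 \<bullet> (\<I> Z || Y)) = (c2 * c3) *\<^sub>s (K \<bullet> (\<I> (Z \<boxtimes> Xk) || B))"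
  proof -
    have "K \<bullet> (a2 \<bullet> (\<I> Z || Y)) = (K \<bullet> a2) \<bullet> (\<I> Z || Y)" using D by (simp add: acomp_assoc)
    also have "K \<bullet> a2 = a2 \<bullet> K"
      using nat[of P "\<I> Xk || q" "\<I> Z"] D by (simp add: a2_def K_def atens_assoc)
    also have "a2 \<bullet> K \<bullet> (\<I> Z || Y) = a2 \<bullet> (P || ((\<I> Xk || (q || \<I> Z)) \<bullet> Y))"
      using interchange[of "\<I> Z" P Y "\<I> Xk || (q || \<I> Z)"] D by (simp add: acomp_assoc K_def)
    also have "\<dots> = c3 *\<^sub>s (a2 \<bullet> (P || (\<I> Xk || (q || Q))) \<bullet> (\<I> (Z \<boxtimes> Xk) || B))"
      unfolding R2 using D KB by (simp add: ascale_rules acomp_assoc)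
    also have "\<dots> = (c2 * c3) *\<^sub>s (K \<bullet> (\<I> (Z \<boxtimes> Xk) || B))"
      unfolding t2 KB' KB using D by (simp add: ascale_rules mult.commute)
    finally show ?thesis .
  qed
  have "arrow_star (twisted_assoc \<omega>) Z S Xk Xj E B G =
    (((E || \<I> Xj) \<bullet> a1) || \<I> Z) \<bullet> g \<bullet> (a2 \<bullet> (\<I> Z || Y))"
    unfolding arrow_star_def a1_def[symmetric] a2_def[symmetric] a3_def[symmetric] Y_def[symmetric] g_def[symmetric]
    using D by (simp add: acomp_assoc)
  also have "\<dots> = c1 *\<^sub>s ((E || \<I> (Xj \<boxtimes> Z)) \<bullet> g \<bullet> (K \<bullet> (a2 \<bullet> (\<I> Z || Y))))"
    unfolding L1 using D by (simp add: acomp_assoc ascale_rules)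
  also have "\<dots> = (c1 * c2 * c3) *\<^sub>s ((E || \<I> (Xj \<boxtimes> Z)) \<bullet> g \<bullet> K \<bullet> (\<I> (Z \<boxtimes> Xk) || B))"
    unfolding R3 using D by (simp add: acomp_assoc ascale_rules mult.assoc)
  also have "\<dots> = (c1 * c2 * c3) *\<^sub>s strict_star Z S Xk Xj E B G"
    unfolding L1'[symmetric] unfolding strict_star_def g_def using D by (simp add: atens_assoc)
  finally show "arrow_star (twisted_assoc \<omega>) Z S Xk Xj E B G =
    cnj (\<omega> (inv\<^sub>\<Gamma> a) a \<gamma> * \<omega> (inv\<^sub>\<Gamma> a) (\<kappa> \<otimes>\<^sub>\<Gamma> b) (inv\<^sub>\<Gamma> b) * \<omega> \<kappa> b (inv\<^sub>\<Gamma> b)) *\<^sub>s strict_star Z S Xk Xj E B G"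
    by (simp add: c1_def c2_def c3_def)
qed

lemma strict_star_degree_scalar:
  assumes d: "dual_pair Z S E B" and X: "Xk \<in> Ob C" "Xj \<in> Ob C"
    and G: "arr G" "src G = Xk \<boxtimes> S" "tgt G = S \<boxtimes> Xj" and b: "b \<in> carrier \<Gamma>" and Gb: "G \<bullet> (\<I> Xk || \<pi> b S) = G"
  shows "strict_star Z S Xk Xj E ((degree_scalar \<chi> S || \<I> Z) \<bullet> B) G = \<chi> b *\<^sub>s strict_star Z S Xk Xj E B G"
proof -
  note D = dual_pairD[OF d] X G b
  have 1: "\<I> Z || (G || \<I> Z) = (\<I> Z || (G || \<I> Z)) \<bullet> (\<I> (Z \<boxtimes> Xk) || (\<pi> b S || \<I> Z))"
    using interchange[of "\<I> Xk || \<pi> b S" G "\<I> Z" "\<I> Z"]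
      interchange[of "\<I> Z" "\<I> Z" "\<I> Xk || (\<pi> b S || \<I> Z)" "G || \<I> Z"] D Gb by (simp add: atens_assoc)
  have 2: "(\<pi> b S || \<I> Z) \<bullet> ((degree_scalar \<chi> S || \<I> Z) \<bullet> B) = \<chi> b *\<^sub>s ((\<pi> b S || \<I> Z) \<bullet> B)"
  proof -
    have "(\<pi> b S || \<I> Z) \<bullet> (degree_scalar \<chi> S || \<I> Z) = \<chi> b *\<^sub>s (\<pi> b S || \<I> Z)"
      using D by (simp add: interchange aproj_degree_scalar ascale_rules)
    then show ?thesis
      using acomp_assoc[of B "degree_scalar \<chi> S || \<I> Z" "\<pi> b S || \<I> Z"] D by (simp add: ascale_rules)
  qed
  have 3: "(\<I> (Z \<boxtimes> Xk) || (\<pi> b S || \<I> Z)) \<bullet> (\<I> (Z \<boxtimes> Xk) || ((degree_scalar \<chi> S || \<I> Z) \<bullet> B)) =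
     \<chi> b *\<^sub>s ((\<I> (Z \<boxtimes> Xk) || (\<pi> b S || \<I> Z)) \<bullet> (\<I> (Z \<boxtimes> Xk) || B))"
    using D by (simp add: interchange 2 ascale_rules)
  show ?thesis
    unfolding strict_star_def by (subst (1 2) 1) (use D in \<open>simp add: acomp_assoc 3 ascale_rules\<close>)
qed

text \<open>
  Both sides are compared on the components of the source factor \<open>Z\<close>; by \<open>arrow_star_restrict\<close> this amounts to
  restricting \<open>G\<close> to a single degree, where \<open>arrow_star_component\<close> applies. The last factor of \<open>\<phi>\<close> compensates
  the modification of the coevaluation.
\<close>

lemma arrow_star_twisted:
  assumes d: "dual_pair Z S E B" and X: "Xk \<in> Ob C" "Xj \<in> Ob C" "has_degree C Gr \<kappa> Xk" "has_degree C Gr \<gamma> Xj"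
    and c: "\<kappa> \<in> carrier \<Gamma>" "\<gamma> \<in> carrier \<Gamma>"
    and G: "arr G" "src G = Xk \<boxtimes> S" "tgt G = S \<boxtimes> Xj" and \<omega>: "normalized_3cocycle \<Gamma> \<omega>"
  defines "\<beta> \<equiv> \<lambda>a. inv\<^sub>\<Gamma> \<kappa> \<otimes>\<^sub>\<Gamma> (a \<otimes>\<^sub>\<Gamma> \<gamma>)"
  defines "\<phi> \<equiv> \<lambda>a. cnj (\<omega> (inv\<^sub>\<Gamma> a) a \<gamma> * \<omega> (inv\<^sub>\<Gamma> a) (\<kappa> \<otimes>\<^sub>\<Gamma> \<beta> a) (inv\<^sub>\<Gamma> (\<beta> a)) * \<omega> \<kappa> (\<beta> a) (inv\<^sub>\<Gamma> (\<beta> a))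
      * \<omega> (\<beta> a) (inv\<^sub>\<Gamma> (\<beta> a)) (\<beta> a))"
  shows "arrow_star (twisted_assoc \<omega>) Z S Xk Xj E B G =
     strict_star Z S Xk Xj E ((degree_scalar (\<lambda>a. \<omega> a (inv\<^sub>\<Gamma> a) a) S || \<I> Z) \<bullet> B) ((degree_scalar \<phi> S || \<I> Xj) \<bullet> G)" (is "_ = strict_star Z S Xk Xj E ?B ?G")
proof (rule aproj_ext_left[where X = Z and Y = Xk], goal_cases)
  note D = dual_pairD[OF d] X(1,2) G c
  interpret w: three_cocycle \<Gamma> \<omega> by unfold_locales (rule \<omega>)
  have dB: "dual_pair Z S E ?B" using D by (simp add: dual_pair_def)
  have GG: "arr ?G" "src ?G = Xk \<boxtimes> S" "tgt ?G = S \<boxtimes> Xj" using D by simp_all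
  {
    case 1 then show ?case using arr_arrow_star[OF natural_assoc_twisted d X(1,2) G] by simp
  next
    case 2 then show ?case using arr_strict_star[OF dB X(1,2) GG] by simp
  next
    case 3 then show ?case using arr_arrow_star[OF natural_assoc_twisted d X(1,2) G] by simp
  next
    case 4 then show ?case using arr_strict_star[OF dB X(1,2) GG] by simp
  next
    case 5 then show ?case using arr_strict_star[OF dB X(1,2) GG] arr_arrow_star[OF natural_assoc_twisted d X(1,2) G] by simp
  next
    case 6 then show ?case using D by simp
  next
    case 7 then show ?case using D by simp
  next
    case (8 e)
    define a where "a = inv\<^sub>\<Gamma> e"
    have a: "a \<in> carrier \<Gamma>" "e = inv\<^sub>\<Gamma> a" using 8 by (simp_all add: a_def)
    have b: "\<beta> a \<in> carrier \<Gamma>" using a c by (simp add: \<beta>_def)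
    define G0 where "G0 = (\<pi> a S || \<I> Xj) \<bullet> G"
    have G0: "arr G0" "src G0 = Xk \<boxtimes> S" "tgt G0 = S \<boxtimes> Xj" using D a by (simp_all add: G0_def)
    have idem: "(\<pi> a S || \<I> Xj) \<bullet> (\<pi> a S || \<I> Xj) = \<pi> a S || \<I> Xj"
      using D a by (simp add: interchange aproj_orth)
    have G0a: "(\<pi> a S || \<I> Xj) \<bullet> G0 = G0"
      using D a acomp_assoc[of G "\<pi> a S || \<I> Xj" "\<pi> a S || \<I> Xj"] idem by (simp add: G0_def)
    have "inv\<^sub>\<Gamma> \<kappa> \<otimes>\<^sub>\<Gamma> (a \<otimes>\<^sub>\<Gamma> \<gamma>) = \<beta> a" by (simp add: \<beta>_def)
    note comp = arrow_star_component[OF d X c a(1) G0 G0a, unfolded this]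
    define z where "z = \<omega> (inv\<^sub>\<Gamma> a) a \<gamma> * \<omega> (inv\<^sub>\<Gamma> a) (\<kappa> \<otimes>\<^sub>\<Gamma> \<beta> a) (inv\<^sub>\<Gamma> (\<beta> a)) * \<omega> \<kappa> (\<beta> a) (inv\<^sub>\<Gamma> (\<beta> a))"
    define x where "x = \<omega> (\<beta> a) (inv\<^sub>\<Gamma> (\<beta> a)) (\<beta> a)"
    have x: "cnj x * x = 1" using w.cnj_cocycle[of "\<beta> a" "inv\<^sub>\<Gamma> (\<beta> a)" "\<beta> a"] w.cocycle_nonzero[of "\<beta> a" "inv\<^sub>\<Gamma> (\<beta> a)" "\<beta> a"] b
      by (simp add: x_def)
    have \<phi>a: "\<phi> a = cnj z * cnj x" by (simp add: \<phi>_def z_def x_def)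
    have "arrow_star (twisted_assoc \<omega>) Z S Xk Xj E B G \<bullet> (\<pi> e Z || \<I> Xk) = arrow_star (twisted_assoc \<omega>) Z S Xk Xj E B G0"
      using arrow_star_restrict[OF natural_assoc_twisted d X(1,2) G a(1)] by (simp add: a(2) G0_def)
    also have "\<dots> = cnj z *\<^sub>s strict_star Z S Xk Xj E B G0"
      unfolding comp(1) z_def ..
    also have "\<dots> = \<phi> a *\<^sub>s (x *\<^sub>s strict_star Z S Xk Xj E B G0)"
      using x by (simp add: \<phi>a ascale_rules mult.assoc)
    also have "x *\<^sub>s strict_star Z S Xk Xj E B G0 = strict_star Z S Xk Xj E ?B G0"
      using strict_star_degree_scalar[OF d X(1,2) G0 b comp(2), of "\<lambda>a. \<omega> a (inv\<^sub>\<Gamma> a) a"] by (simp add: x_def)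
    also have "\<phi> a *\<^sub>s \<dots> = strict_star Z S Xk Xj E ?B (\<phi> a *\<^sub>s G0)"
      using arrow_star_linear(1)[OF natural_assoc_assoc dB X(1,2) G0, of "\<phi> a"] arrow_star_strict[OF dB X(1,2)] G0 by simp
    also have "\<phi> a *\<^sub>s G0 = (\<pi> a S || \<I> Xj) \<bullet> ?G"
    proof -
      have "(\<pi> a S || \<I> Xj) \<bullet> (degree_scalar \<phi> S || \<I> Xj) = \<phi> a *\<^sub>s (\<pi> a S || \<I> Xj)"
        using D a by (simp add: interchange aproj_degree_scalar ascale_rules)
      then show ?thesis
        using acomp_assoc[of G "degree_scalar \<phi> S || \<I> Xj" "\<pi> a S || \<I> Xj"] D a by (simp add: ascale_rules G0_def)
    qed
    also have "strict_star Z S Xk Xj E ?B ((\<pi> a S || \<I> Xj) \<bullet> ?G) = strict_star Z S Xk Xj E ?B ?G \<bullet> (\<pi> e Z || \<I> Xk)"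
      using arrow_star_restrict[OF natural_assoc_assoc dB X(1,2) GG a(1)] arrow_star_strict[OF dB X(1,2)] GG D a by simp
    finally show ?case .
  }
qed

end

section \<open>The annular algebra of a natural associator\<close>

locale annular_family = strict_tensor_category C
  for C :: "('o, 'm::ab_group_add) tensor_cat" (structure) +
  fixes X :: "'j \<Rightarrow> 'o"
  assumes X_Ob [simp]: "X j \<in> Ob C"
begin

abbreviation sgl :: "'j \<times> 'j \<times> 'o \<Rightarrow> 'm \<Rightarrow> ('j, 'o, 'm) annular_rep" where
  "sgl \<equiv> Poly_Mapping.single"
abbreviation lk where "lk \<equiv> Poly_Mapping.lookup"
abbreviation kys where "kys \<equiv> Poly_Mapping.keys"

lemma lookup_rep_scale [simp]: "lk (rep_scale C c F) \<kappa> = smul C c (lk F \<kappa>)"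
  by (simp add: rep_scale_def Poly_Mapping.map.rep_eq when_def)

lemma rep_scale_single [simp]: "rep_scale C c (sgl \<kappa> f) = sgl \<kappa> (smul C c f)"
  by (rule poly_mapping_eqI) (simp add: lookup_single when_def)

sublocale reps: vector_space "rep_scale C"
  by unfold_locales
    (auto intro!: poly_mapping_eqI simp: lookup_add vs.scale_right_distrib vs.scale_left_distrib)

definition space_of :: "'j \<times> 'j \<times> 'o \<Rightarrow> 'm set" where
  "space_of \<kappa> = (case \<kappa> of (k, j, S) \<Rightarrow> Hom C (S \<boxtimes> X j) (X k \<boxtimes> S))"

definition valid :: "'j \<times> 'j \<times> 'o \<Rightarrow> bool" where
  "valid \<kappa> \<longleftrightarrow> snd (snd \<kappa>) \<in> Ob C"

lemma space_subspace: "valid \<kappa> \<Longrightarrow> vs.subspace (space_of \<kappa>)"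
  by (auto simp: space_of_def valid_def intro!: Hom_subspace split: prod.splits)

lemma annular_reps_iff: "F \<in> annular_reps C X \<longleftrightarrow> (\<forall>\<kappa>\<in>kys F. valid \<kappa> \<and> lk F \<kappa> \<in> space_of \<kappa>)"
  by (auto simp: annular_reps_def valid_def space_of_def)

lemma reps_lookup:
  "\<lbrakk>F \<in> annular_reps C X; valid \<kappa>\<rbrakk> \<Longrightarrow> lk F \<kappa> \<in> space_of \<kappa>"
  using vs.subspace_0[OF space_subspace] unfolding annular_reps_iff by (metis in_keys_iff)

lemma subspace_reps: "reps.subspace (annular_reps C X)"
proof (rule reps.subspaceI)
  show "0 \<in> annular_reps C X" by (simp add: annular_reps_iff)
  show "F + G \<in> annular_reps C X" if F: "F \<in> annular_reps C X" "G \<in> annular_reps C X" for F G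
    unfolding annular_reps_iff
  proof
    fix \<kappa> assume "\<kappa> \<in> kys (F + G)"
    then have "valid \<kappa>" using F Poly_Mapping.keys_add[of F G] by (auto simp: annular_reps_iff)
    then show "valid \<kappa> \<and> lk (F + G) \<kappa> \<in> space_of \<kappa>"
      using vs.subspace_add[OF space_subspace reps_lookup reps_lookup] F by (simp add: lookup_add)
  qed
  show "rep_scale C c F \<in> annular_reps C X" if F: "F \<in> annular_reps C X" for c F
    unfolding annular_reps_iff
  proof
    fix \<kappa> assume "\<kappa> \<in> kys (rep_scale C c F)"
    then have "\<kappa> \<in> kys F" by (auto simp: in_keys_iff)
    then have "valid \<kappa>" using F by (auto simp: annular_reps_iff)
    then show "valid \<kappa> \<and> lk (rep_scale C c F) \<kappa> \<in> space_of \<kappa>"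
      using vs.subspace_scale[OF space_subspace reps_lookup] F by simp
  qed
qed

lemma single_reps: "\<lbrakk>valid \<kappa>; f \<in> space_of \<kappa>\<rbrakk> \<Longrightarrow> sgl \<kappa> f \<in> annular_reps C X"
  by (auto simp: annular_reps_iff split: if_splits)

definition slide_relations :: "('j, 'o, 'm) annular_rep set" where
  "slide_relations = {sgl (k, j, src U) (mor (F \<bullet> (U || \<I> (X j)))) - sgl (k, j, tgt U) (mor ((\<I> (X k) || U) \<bullet> F))
    | k j U F. arr U \<and> arr F \<and> src F = tgt U \<boxtimes> X j \<and> tgt F = X k \<boxtimes> src U}"

lemma annular_relations_eq: "annular_relations C X = reps.span slide_relations"
proof -
  have "{sgl (k, j, S) (f \<cdot> (f' \<odot> \<iota> (X j))) - sgl (k, j, T) ((\<iota> (X k) \<odot> f') \<cdot> f)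
      | k j S T f f'. S \<in> Ob C \<and> T \<in> Ob C \<and> f \<in> Hom C (T \<boxtimes> X j) (X k \<boxtimes> S) \<and> f' \<in> Hom C S T} = slide_relations"
    (is "?L = _")
  proof (intro equalityI subsetI)
    fix r assume "r \<in> ?L"
    then obtain k j S T f f' where r: "r = sgl (k, j, S) (f \<cdot> (f' \<odot> \<iota> (X j))) - sgl (k, j, T) ((\<iota> (X k) \<odot> f') \<cdot> f)"
      "S \<in> Ob C" "T \<in> Ob C" "f \<in> Hom C (T \<boxtimes> X j) (X k \<boxtimes> S)" "f' \<in> Hom C S T" by blast
    show "r \<in> slide_relations" unfolding slide_relations_def
      by (rule CollectI, rule exI[of _ k], rule exI[of _ j], rule exI[of _ "Arrow S T f'"],
          rule exI[of _ "Arrow (T \<boxtimes> X j) (X k \<boxtimes> S) f"]) (use r in simp)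
  next
    fix r assume "r \<in> slide_relations"
    then obtain k j U F where r: "r = sgl (k, j, src U) (mor (F \<bullet> (U || \<I> (X j)))) - sgl (k, j, tgt U) (mor ((\<I> (X k) || U) \<bullet> F))"
      "arr U" "arr F" "src F = tgt U \<boxtimes> X j" "tgt F = X k \<boxtimes> src U" by (auto simp: slide_relations_def)
    show "r \<in> ?L"
      by (rule CollectI, rule exI[of _ k], rule exI[of _ j], rule exI[of _ "src U"], rule exI[of _ "tgt U"],
          rule exI[of _ "mor F"], rule exI[of _ "mor U"]) (use r arr_mor[OF r(2)] arr_mor[OF r(3)] in simp)
  qed
  then show ?thesis by (simp add: annular_relations_def)
qed

lemma slide_relation_spaces:
  assumes "arr U" "arr F" "src F = tgt U \<boxtimes> X j" "tgt F = X k \<boxtimes> src U"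
  shows "mor (F \<bullet> (U || \<I> (X j))) \<in> space_of (k, j, src U)" "mor ((\<I> (X k) || U) \<bullet> F) \<in> space_of (k, j, tgt U)"
  using arr_mor[of "F \<bullet> (U || \<I> (X j))"] arr_mor[of "(\<I> (X k) || U) \<bullet> F"] assms
  by (simp_all add: space_of_def)

lemma slide_relations_reps: "slide_relations \<subseteq> annular_reps C X"
proof
  fix r assume "r \<in> slide_relations"
  then show "r \<in> annular_reps C X"
    unfolding slide_relations_def using slide_relation_spaces
    by (auto intro!: reps.subspace_diff[OF subspace_reps] single_reps simp: valid_def)
qed

lemma relations_reps: "annular_relations C X \<subseteq> annular_reps C X"
  unfolding annular_relations_eq by (rule reps.span_minimal[OF slide_relations_reps subspace_reps])

lemma subspace_relations: "reps.subspace (annular_relations C X)"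
  unfolding annular_relations_eq by (rule reps.subspace_span)

abbreviation cls :: "('j, 'o, 'm) annular_rep \<Rightarrow> ('j, 'o, 'm) annular_rep set" where
  "cls \<equiv> annular_class C X"

lemma mem_class: "H \<in> cls F \<longleftrightarrow> H - F \<in> annular_relations C X"
  by (simp add: annular_class_def)

lemma class_eq_iff: "cls F = cls G \<longleftrightarrow> F - G \<in> annular_relations C X"
proof
  assume "cls F = cls G"
  moreover have "F \<in> cls F" using reps.subspace_0[OF subspace_relations] by (simp add: mem_class)
  ultimately show "F - G \<in> annular_relations C X" by (simp add: mem_class)
next
  assume *: "F - G \<in> annular_relations C X"
  have "H - F \<in> annular_relations C X \<longleftrightarrow> H - G \<in> annular_relations C X" for H
    using reps.subspace_add[OF subspace_relations _ *, of "H - F"]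
      reps.subspace_diff[OF subspace_relations _ *, of "H - G"] by auto
  then show "cls F = cls G" by (auto simp: mem_class)
qed

lemma class_add: "\<lbrakk>cls F = cls F'; cls G = cls G'\<rbrakk> \<Longrightarrow> cls (F + G) = cls (F' + G')"
  using reps.subspace_add[OF subspace_relations, of "F - F'" "G - G'"]
  by (simp add: class_eq_iff algebra_simps)

lemma class_sum: "(\<And>i. i \<in> A \<Longrightarrow> cls (f i) = cls (g i)) \<Longrightarrow> cls (sum f A) = cls (sum g A)"
proof (induction A rule: infinite_finite_induct)
  case (insert i A)
  then show ?case using class_add[of "f i" "g i" "sum f A" "sum g A"] by simp
qed simp_all

lemma class_scale: "cls F = cls G \<Longrightarrow> cls (rep_scale C c F) = cls (rep_scale C c G)"
  using reps.subspace_scale[OF subspace_relations, of "F - G" c]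
  by (simp add: class_eq_iff reps.scale_right_diff_distrib)

lemma class_slide:
  assumes "arr U" "arr F" "src F = tgt U \<boxtimes> X j" "tgt F = X k \<boxtimes> src U"
  shows "cls (sgl (k, j, src U) (mor (F \<bullet> (U || \<I> (X j))))) = cls (sgl (k, j, tgt U) (mor ((\<I> (X k) || U) \<bullet> F)))"
  unfolding class_eq_iff annular_relations_eq
  by (rule reps.span_base) (use assms in \<open>auto simp: slide_relations_def\<close>)

lemma annular_scale_class: "annular_scale C X c (cls F) = cls (rep_scale C c F)"
proof -
  have "F \<in> cls F" using reps.subspace_0[OF subspace_relations] by (simp add: mem_class)
  moreover have "cls (rep_scale C c H) = cls (rep_scale C c F)" if "H \<in> cls F" for H
    using that by (intro class_scale) (simp add: class_eq_iff mem_class)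
  ultimately have "(\<Union>H\<in>cls F. {cls (rep_scale C c H)}) = {cls (rep_scale C c F)}" by blast
  then show ?thesis by (simp add: annular_scale_def)
qed

text \<open>
  For \<open>T\<close> linear or conjugate-linear on each morphism space, the corresponding map on the total direct sum.
\<close>

definition extend :: "('j \<times> 'j \<times> 'o \<Rightarrow> 'm \<Rightarrow> ('j, 'o, 'm) annular_rep) \<Rightarrow> ('j, 'o, 'm) annular_rep \<Rightarrow> ('j, 'o, 'm) annular_rep" where
  "extend T F = (\<Sum>\<kappa>\<in>kys F. T \<kappa> (lk F \<kappa>))"

definition semilinear :: "(complex \<Rightarrow> complex) \<Rightarrow> ('j \<times> 'j \<times> 'o \<Rightarrow> 'm \<Rightarrow> ('j, 'o, 'm) annular_rep) \<Rightarrow> bool" where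
  "semilinear \<sigma> T \<longleftrightarrow> (\<forall>\<kappa>. valid \<kappa> \<longrightarrow> (\<forall>f\<in>space_of \<kappa>. (\<forall>g\<in>space_of \<kappa>. T \<kappa> (f + g) = T \<kappa> f + T \<kappa> g) \<and>
     (\<forall>c. T \<kappa> (smul C c f) = rep_scale C (\<sigma> c) (T \<kappa> f))))"

context
  fixes \<sigma> T assumes T: "semilinear \<sigma> T"
begin

lemma semilinear_zero: "valid \<kappa> \<Longrightarrow> T \<kappa> 0 = 0"
  using T vs.subspace_0[OF space_subspace, of \<kappa>] unfolding semilinear_def
  by (metis add.right_neutral add_left_cancel)

lemma extend_superset:
  assumes "F \<in> annular_reps C X" "finite K" "kys F \<subseteq> K" "\<And>\<kappa>. \<kappa> \<in> K \<Longrightarrow> valid \<kappa>"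
  shows "extend T F = (\<Sum>\<kappa>\<in>K. T \<kappa> (lk F \<kappa>))"
  unfolding extend_def using assms
  by (intro sum.mono_neutral_left) (auto simp: in_keys_iff semilinear_zero)

lemma extend_add:
  assumes F: "F \<in> annular_reps C X" "G \<in> annular_reps C X" shows "extend T (F + G) = extend T F + extend T G"
proof -
  let ?K = "kys F \<union> kys G"
  have v: "valid \<kappa>" if "\<kappa> \<in> ?K" for \<kappa> using that F by (auto simp: annular_reps_iff)
  have "extend T (F + G) = (\<Sum>\<kappa>\<in>?K. T \<kappa> (lk (F + G) \<kappa>))"
    using v Poly_Mapping.keys_add[of F G] reps.subspace_add[OF subspace_reps F] by (intro extend_superset) auto
  also have "\<dots> = (\<Sum>\<kappa>\<in>?K. T \<kappa> (lk F \<kappa>) + T \<kappa> (lk G \<kappa>))"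
    using T v reps_lookup F by (intro sum.cong) (auto simp: lookup_add semilinear_def)
  also have "\<dots> = extend T F + extend T G"
    using v F extend_superset[of F ?K] extend_superset[of G ?K] by (simp add: sum.distrib)
  finally show ?thesis .
qed

lemma extend_scale:
  assumes F: "F \<in> annular_reps C X" shows "extend T (rep_scale C c F) = rep_scale C (\<sigma> c) (extend T F)"
proof -
  have v: "valid \<kappa>" if "\<kappa> \<in> kys F" for \<kappa> using that F by (auto simp: annular_reps_iff)
  have "extend T (rep_scale C c F) = (\<Sum>\<kappa>\<in>kys F. T \<kappa> (lk (rep_scale C c F) \<kappa>))"
    using v reps.subspace_scale[OF subspace_reps F] by (intro extend_superset) (auto simp: in_keys_iff)
  also have "\<dots> = (\<Sum>\<kappa>\<in>kys F. rep_scale C (\<sigma> c) (T \<kappa> (lk F \<kappa>)))"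
    using T v reps_lookup F by (intro sum.cong) (auto simp: semilinear_def)
  finally show ?thesis by (simp add: extend_def reps.scale_sum_right)
qed

lemma extend_single: "valid \<kappa> \<Longrightarrow> extend T (sgl \<kappa> f) = T \<kappa> f"
  by (simp add: extend_def semilinear_zero)

lemma extend_diff:
  assumes "F \<in> annular_reps C X" "G \<in> annular_reps C X" shows "extend T (F - G) = extend T F - extend T G"
  using extend_add[of "F - G" G] reps.subspace_diff[OF subspace_reps assms] assms by (simp add: algebra_simps)

text \<open>
  It suffices that \<open>T\<close> sends both sides of each generating relation to the same class.
\<close>

lemma extend_class:
  assumes slide: "\<And>k j U F. \<lbrakk>arr U; arr F; src F = tgt U \<boxtimes> X j; tgt F = X k \<boxtimes> src U\<rbrakk> \<Longrightarrow>
      cls (T (k, j, src U) (mor (F \<bullet> (U || \<I> (X j))))) = cls (T (k, j, tgt U) (mor ((\<I> (X k) || U) \<bullet> F)))"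
    and F: "F \<in> annular_reps C X" "G \<in> annular_reps C X" "cls F = cls G"
  shows "cls (extend T F) = cls (extend T G)"
proof -
  have "r \<in> annular_reps C X \<and> extend T r \<in> annular_relations C X" if "r \<in> reps.span slide_relations" for r
    using that
  proof (induction rule: reps.span_induct_alt)
    case base
    then show ?case using reps.subspace_0[OF subspace_reps] reps.subspace_0[OF subspace_relations] by (simp add: extend_def)
  next
    case (step c g r)
    from step(1) obtain k j U F where g: "g = sgl (k, j, src U) (mor (F \<bullet> (U || \<I> (X j)))) - sgl (k, j, tgt U) (mor ((\<I> (X k) || U) \<bullet> F))"
      "arr U" "arr F" "src F = tgt U \<boxtimes> X j" "tgt F = X k \<boxtimes> src U" by (auto simp: slide_relations_def)
    have v: "valid (k, j, src U)" "valid (k, j, tgt U)" using g by (simp_all add: valid_def)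
    have "extend T g = T (k, j, src U) (mor (F \<bullet> (U || \<I> (X j)))) - T (k, j, tgt U) (mor ((\<I> (X k) || U) \<bullet> F))"
      unfolding g(1) using v slide_relation_spaces[OF g(2-5)]
      by (subst extend_diff) (auto intro!: single_reps simp: extend_single simp del: sel_simps)
    then have lg: "extend T g \<in> annular_relations C X"
      using slide[OF g(2-5)] by (simp add: class_eq_iff)
    have gr: "g \<in> annular_reps C X" using step(1) slide_relations_reps by blast
    have sr: "rep_scale C c g \<in> annular_reps C X" using reps.subspace_scale[OF subspace_reps gr] .
    show ?case
      using step(2) sr extend_add[OF sr, of r] extend_scale[OF gr, of c]
        reps.subspace_add[OF subspace_reps sr, of r]
        reps.subspace_add[OF subspace_relations reps.subspace_scale[OF subspace_relations lg, of "\<sigma> c"], of "extend T r"]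
      by simp
  qed
  then have "extend T (F - G) \<in> annular_relations C X"
    using F(3) by (simp add: class_eq_iff annular_relations_eq)
  then show ?thesis using extend_diff[OF F(1,2)] by (simp add: class_eq_iff)
qed

end

definition mult_term where
  "mult_term E \<kappa> f \<mu> g = (case \<kappa> of (m, k, S) \<Rightarrow> case \<mu> of (k', j, T) \<Rightarrow>
     if k = k' then sgl (m, j, S \<boxtimes> T) (mor_mult E X m k j S T f g) else 0)"

context
  fixes A E assumes A: "natural_assoc A" and E: "E = C\<lparr>assoc := A\<rparr>"
begin

lemma rep_mult_alt:
  "rep_mult E X F G = (\<Sum>\<kappa>\<in>kys F. \<Sum>\<mu>\<in>kys G. mult_term E \<kappa> (lk F \<kappa>) \<mu> (lk G \<mu>))"
  unfolding rep_mult_def mult_term_def E by (auto intro!: sum.cong split: prod.splits)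

lemma mult_term_bilinear:
  assumes v: "valid \<kappa>" "valid \<mu>" and f: "f \<in> space_of \<kappa>" "g \<in> space_of \<mu>"
  shows "f' \<in> space_of \<kappa> \<Longrightarrow> mult_term E \<kappa> (f + f') \<mu> g = mult_term E \<kappa> f \<mu> g + mult_term E \<kappa> f' \<mu> g"
    "mult_term E \<kappa> (smul C c f) \<mu> g = rep_scale C c (mult_term E \<kappa> f \<mu> g)"
    "g' \<in> space_of \<mu> \<Longrightarrow> mult_term E \<kappa> f \<mu> (g + g') = mult_term E \<kappa> f \<mu> g + mult_term E \<kappa> f \<mu> g'"
    "mult_term E \<kappa> f \<mu> (smul C c g) = rep_scale C c (mult_term E \<kappa> f \<mu> g)"
proof -
  obtain m k S k' j T where \<kappa>: "\<kappa> = (m, k, S)" "\<mu> = (k', j, T)" by (cases \<kappa>, cases \<mu>) auto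
  have t: "S \<in> Ob C" "T \<in> Ob C" "f \<in> Hom C (S \<boxtimes> X k) (X m \<boxtimes> S)" "g \<in> Hom C (T \<boxtimes> X j) (X k' \<boxtimes> T)"
    using assms by (simp_all add: \<kappa> valid_def space_of_def)
  define a where "a f = Arrow (S \<boxtimes> X k) (X m \<boxtimes> S) f" for f :: 'm
  define b where "b f = Arrow (T \<boxtimes> X j) (X k' \<boxtimes> T) f" for f :: 'm
  have add: "a (f + f') = a f +\<^sub>a a f'" "b (f + f') = b f +\<^sub>a b f'" "a (smul C c f) = c *\<^sub>s a f" "b (smul C c f) = c *\<^sub>s b f" for f f'
    by (simp_all add: a_def b_def aadd_def ascale_def)
  have ab: "src (a f) = S \<boxtimes> X k" "tgt (a f) = X m \<boxtimes> S" "src (b f) = T \<boxtimes> X j" "tgt (b f) = X k' \<boxtimes> T" for f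
    by (simp_all add: a_def b_def)
  have arr: "arr (a f)" "arr (b g)" using t by (simp_all add: a_def b_def)
  have mm: "mor_mult E X m k j S T f g = mor (arrow_mult A (X m) (X k) (X j) S T (a f) (b g))" if "k = k'" for f g
    unfolding E mor_mult_arrow a_def b_def that ..
  have a': "arr (a f')" if "f' \<in> space_of \<kappa>" for f' using that t by (simp add: a_def \<kappa> space_of_def)
  have b': "arr (b f')" if "f' \<in> space_of \<mu>" for f' using that t by (simp add: b_def \<kappa> space_of_def)
  note r = t(1,2) ab arr arr_assocow[OF A]
  show "mult_term E \<kappa> (f + f') \<mu> g = mult_term E \<kappa> f \<mu> g + mult_term E \<kappa> f' \<mu> g" if "f' \<in> space_of \<kappa>"
  proof (cases "k = k'")
    case True
    have "arrow_mult A (X m) (X k) (X j) S T (a (f + f')) (b g) =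
      arrow_mult A (X m) (X k) (X j) S T (a f) (b g) +\<^sub>a arrow_mult A (X m) (X k) (X j) S T (a f') (b g)"
      unfolding arrow_mult_def add using r True a'[OF that] by (simp add: aadd_rules)
    then show ?thesis by (simp add: \<kappa> mult_term_def mm[OF True] single_add True[symmetric])
  qed (simp add: \<kappa> mult_term_def)
  show "mult_term E \<kappa> (smul C c f) \<mu> g = rep_scale C c (mult_term E \<kappa> f \<mu> g)"
  proof (cases "k = k'")
    case True
    have "arrow_mult A (X m) (X k) (X j) S T (a (smul C c f)) (b g) =
      c *\<^sub>s arrow_mult A (X m) (X k) (X j) S T (a f) (b g)"
      unfolding arrow_mult_def add using r True by (simp add: ascale_rules)
    then show ?thesis by (simp add: \<kappa> mult_term_def mm[OF True] True[symmetric])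
  qed (simp add: \<kappa> mult_term_def)
  show "mult_term E \<kappa> f \<mu> (g + g') = mult_term E \<kappa> f \<mu> g + mult_term E \<kappa> f \<mu> g'" if "g' \<in> space_of \<mu>"
  proof (cases "k = k'")
    case True
    have "arrow_mult A (X m) (X k) (X j) S T (a f) (b (g + g')) =
      arrow_mult A (X m) (X k) (X j) S T (a f) (b g) +\<^sub>a arrow_mult A (X m) (X k) (X j) S T (a f) (b g')"
      unfolding arrow_mult_def add using r True b'[OF that] by (simp add: aadd_rules)
    then show ?thesis by (simp add: \<kappa> mult_term_def mm[OF True] single_add True[symmetric])
  qed (simp add: \<kappa> mult_term_def)
  show "mult_term E \<kappa> f \<mu> (smul C c g) = rep_scale C c (mult_term E \<kappa> f \<mu> g)"
  proof (cases "k = k'")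
    case True
    have "arrow_mult A (X m) (X k) (X j) S T (a f) (b (smul C c g)) =
      c *\<^sub>s arrow_mult A (X m) (X k) (X j) S T (a f) (b g)"
      unfolding arrow_mult_def add using r True by (simp add: ascale_rules)
    then show ?thesis by (simp add: \<kappa> mult_term_def mm[OF True] True[symmetric])
  qed (simp add: \<kappa> mult_term_def)
qed

lemma arrow_sel_eq: "src F = S \<Longrightarrow> tgt F = T \<Longrightarrow> Arrow S T (mor F) = F"
  by (cases F) simp

lemma mult_term_slide_left:
  assumes U: "arr U" "arr F" "src F = tgt U \<boxtimes> X k" "tgt F = X m \<boxtimes> src U"
    and g: "valid \<mu>" "g \<in> space_of \<mu>"
  shows "cls (mult_term E (m, k, src U) (mor (F \<bullet> (U || \<I> (X k)))) \<mu> g) =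
    cls (mult_term E (m, k, tgt U) (mor ((\<I> (X m) || U) \<bullet> F)) \<mu> g)"
proof -
  obtain k' j T where \<mu>: "\<mu> = (k', j, T)" by (cases \<mu>)
  show ?thesis
  proof (cases "k = k'")
    case True
    let ?G = "Arrow (T \<boxtimes> X j) (X k \<boxtimes> T) g"
    have T: "T \<in> Ob C" "g \<in> Hom C (T \<boxtimes> X j) (X k \<boxtimes> T)" using g True by (simp_all add: \<mu> valid_def space_of_def)
    obtain H where H: "arr H" "src H = (tgt U \<boxtimes> T) \<boxtimes> X j" "tgt H = X m \<boxtimes> (src U \<boxtimes> T)"
      "arrow_mult A (X m) (X k) (X j) (src U) T (F \<bullet> (U || \<I> (X k))) ?G = H \<bullet> ((U || \<I> T) || \<I> (X j))"
      "arrow_mult A (X m) (X k) (X j) (tgt U) T ((\<I> (X m) || U) \<bullet> F) ?G = (\<I> (X m) || (U || \<I> T)) \<bullet> H"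
      using arrow_mult_slide_left[OF A, of "X m" "X k" "X j" F ?G U T] U T by auto
    have 1: "mult_term E (m, k, src U) (mor (F \<bullet> (U || \<I> (X k)))) \<mu> g
      = sgl (m, j, src (U || \<I> T)) (mor (H \<bullet> ((U || \<I> T) || \<I> (X j))))"
      unfolding \<mu> mult_term_def True[symmetric] E mor_mult_arrow H(4)[symmetric]
      using U by (simp add: arrow_sel_eq del: sel_simps(3))
    have 2: "mult_term E (m, k, tgt U) (mor ((\<I> (X m) || U) \<bullet> F)) \<mu> g
      = sgl (m, j, tgt (U || \<I> T)) (mor ((\<I> (X m) || (U || \<I> T)) \<bullet> H))"
      unfolding \<mu> mult_term_def True[symmetric] E mor_mult_arrow H(5)[symmetric]
      using U by (simp add: arrow_sel_eq del: sel_simps(3))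
    show ?thesis unfolding 1 2 by (rule class_slide) (use U T H in simp_all)
  qed (simp add: \<mu> mult_term_def)
qed

lemma mult_term_slide_right:
  assumes U: "arr U" "arr G" "src G = tgt U \<boxtimes> X j" "tgt G = X k \<boxtimes> src U"
    and g: "valid \<kappa>" "f \<in> space_of \<kappa>"
  shows "cls (mult_term E \<kappa> f (k, j, src U) (mor (G \<bullet> (U || \<I> (X j))))) =
    cls (mult_term E \<kappa> f (k, j, tgt U) (mor ((\<I> (X k) || U) \<bullet> G)))"
proof -
  obtain m k' S where \<kappa>: "\<kappa> = (m, k', S)" by (cases \<kappa>)
  show ?thesis
  proof (cases "k' = k")
    case True
    let ?F = "Arrow (S \<boxtimes> X k) (X m \<boxtimes> S) f"
    have S: "S \<in> Ob C" "f \<in> Hom C (S \<boxtimes> X k) (X m \<boxtimes> S)" using g True by (simp_all add: \<kappa> valid_def space_of_def)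
    obtain H where H: "arr H" "src H = (S \<boxtimes> tgt U) \<boxtimes> X j" "tgt H = X m \<boxtimes> (S \<boxtimes> src U)"
      "arrow_mult A (X m) (X k) (X j) S (src U) ?F (G \<bullet> (U || \<I> (X j))) = H \<bullet> ((\<I> S || U) || \<I> (X j))"
      "arrow_mult A (X m) (X k) (X j) S (tgt U) ?F ((\<I> (X k) || U) \<bullet> G) = (\<I> (X m) || (\<I> S || U)) \<bullet> H"
      using arrow_mult_slide_right[OF A, of "X m" "X k" "X j" ?F G U S] U S by auto
    have 1: "mult_term E \<kappa> f (k, j, src U) (mor (G \<bullet> (U || \<I> (X j))))
      = sgl (m, j, src (\<I> S || U)) (mor (H \<bullet> ((\<I> S || U) || \<I> (X j))))"
      unfolding \<kappa> mult_term_def True E mor_mult_arrow H(4)[symmetric]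
      using U by (simp add: arrow_sel_eq mor_mult_arrow del: sel_simps(3))
    have 2: "mult_term E \<kappa> f (k, j, tgt U) (mor ((\<I> (X k) || U) \<bullet> G))
      = sgl (m, j, tgt (\<I> S || U)) (mor ((\<I> (X m) || (\<I> S || U)) \<bullet> H))"
      unfolding \<kappa> mult_term_def True E mor_mult_arrow H(5)[symmetric]
      using U by (simp add: arrow_sel_eq mor_mult_arrow del: sel_simps(3))
    show ?thesis unfolding 1 2 by (rule class_slide) (use U S H in simp_all)
  qed (simp add: \<kappa> mult_term_def)
qed

text \<open>
  The two factors are replaced one at a time, the product being linear in each.
\<close>

lemma rep_mult_class:
  assumes F: "F \<in> annular_reps C X" "F' \<in> annular_reps C X" "cls F = cls F'"
    and G: "G \<in> annular_reps C X" "G' \<in> annular_reps C X" "cls G = cls G'"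
  shows "cls (rep_mult E X F G) = cls (rep_mult E X F' G')"
proof -
  have v: "valid \<kappa>" "lk H \<kappa> \<in> space_of \<kappa>" if "H \<in> annular_reps C X" "\<kappa> \<in> kys H" for H \<kappa>
    using that by (auto simp: annular_reps_iff)
  have "cls (extend (\<lambda>\<kappa> f. \<Sum>\<mu>\<in>kys G. mult_term E \<kappa> f \<mu> (lk G \<mu>)) F) = cls (extend (\<lambda>\<kappa> f. \<Sum>\<mu>\<in>kys G. mult_term E \<kappa> f \<mu> (lk G \<mu>)) F')"
  proof (rule extend_class[OF _ _ F, where \<sigma> = "\<lambda>c. c"])
    show "semilinear (\<lambda>c. c) (\<lambda>\<kappa> f. \<Sum>\<mu>\<in>kys G. mult_term E \<kappa> f \<mu> (lk G \<mu>))"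
      unfolding semilinear_def using v[OF G(1)]
      by (auto simp: mult_term_bilinear sum.distrib reps.scale_sum_right)
  qed (use mult_term_slide_left v[OF G(1)] in \<open>auto intro!: class_sum simp del: sel_simps\<close>)
  also have "extend (\<lambda>\<kappa> f. \<Sum>\<mu>\<in>kys G. mult_term E \<kappa> f \<mu> (lk G \<mu>)) F' = extend (\<lambda>\<mu> g. \<Sum>\<kappa>\<in>kys F'. mult_term E \<kappa> (lk F' \<kappa>) \<mu> g) G"
    unfolding extend_def by (rule sum.swap)
  also have "cls \<dots> = cls (extend (\<lambda>\<mu> g. \<Sum>\<kappa>\<in>kys F'. mult_term E \<kappa> (lk F' \<kappa>) \<mu> g) G')"
  proof (rule extend_class[OF _ _ G, where \<sigma> = "\<lambda>c. c"])
    show "semilinear (\<lambda>c. c) (\<lambda>\<mu> g. \<Sum>\<kappa>\<in>kys F'. mult_term E \<kappa> (lk F' \<kappa>) \<mu> g)"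
      unfolding semilinear_def using v[OF F(2)]
      by (auto simp: mult_term_bilinear sum.distrib reps.scale_sum_right)
  qed (use mult_term_slide_right v[OF F(2)] in \<open>auto intro!: class_sum simp del: sel_simps\<close>)
  finally show ?thesis
    unfolding rep_mult_alt extend_def by (subst (2) sum.swap)
qed

lemma class_update: "annular_class E X = cls"
proof -
  have "(rep_scale E :: _ \<Rightarrow> ('j, 'o, 'm) annular_rep \<Rightarrow> _) = rep_scale C" by (intro ext) (simp add: E rep_scale_def)
  then show ?thesis by (intro ext) (simp add: E annular_class_def annular_relations_def)
qed

lemma annular_mult_class:
  assumes "F \<in> annular_reps C X" "G \<in> annular_reps C X"
  shows "annular_mult E X (cls F) (cls G) = cls (rep_mult E X F G)"
proof -
  have mem: "H \<in> annular_reps C X" "cls H = cls F" if "H \<in> cls F" "F \<in> annular_reps C X" for H F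
    using reps.subspace_add[OF subspace_reps that(2), of "H - F"] that relations_reps
    by (auto simp: mem_class class_eq_iff)
  have self: "F \<in> cls F" for F using reps.subspace_0[OF subspace_relations] by (simp add: mem_class)
  have "(\<Union>F'\<in>cls F. \<Union>G'\<in>cls G. {cls (rep_mult E X F' G')}) = {cls (rep_mult E X F G)}"
    using self[of F] self[of G] rep_mult_class[OF mem(1) assms(1) mem(2) mem(1) assms(2) mem(2)] assms by blast
  then show ?thesis by (simp add: annular_mult_def class_update)
qed

end

definition star_term where
  "star_term E dual R Rb \<kappa> f = (case \<kappa> of (k, j, S) \<Rightarrow> sgl (j, k, dual S) (mor_star E dual R Rb X k j S f))"

lemma rep_star_alt: "rep_star E dual R Rb X F = extend (star_term E dual R Rb) F"
  unfolding rep_star_def extend_def star_term_def by (auto intro!: sum.cong split: prod.splits)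

context
  fixes A dual R Rb
  assumes A: "natural_assoc A"
    and dp: "\<And>S. S \<in> Ob C \<Longrightarrow> dual_pair (dual S) S ((Arrow (unito C) (dual S \<boxtimes> S) (R S))\<dagger>) (Arrow (unito C) (S \<boxtimes> dual S) (Rb S))"
begin

abbreviation CA where "CA \<equiv> C\<lparr>assoc := A\<rparr>"
abbreviation ev where "ev S \<equiv> (Arrow (unito C) (dual S \<boxtimes> S) (R S))\<dagger>"
abbreviation coev where "coev S \<equiv> Arrow (unito C) (S \<boxtimes> dual S) (Rb S)"

lemma star_term_arrow:
  assumes "arr F" "src F = S \<boxtimes> X j" "tgt F = X k \<boxtimes> S"
  shows "star_term CA dual R Rb (k, j, S) (mor F) =
    sgl (j, k, dual S) (mor (arrow_star A (dual S) S (X k) (X j) (ev S) (coev S) (F\<dagger>)))"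
proof -
  have "Arrow (S \<boxtimes> X j) (X k \<boxtimes> S) (mor F) = F" using assms by (cases F) simp
  then show ?thesis by (simp add: star_term_def mor_star_arrow)
qed

lemma star_term_semilinear: "semilinear cnj (star_term CA dual R Rb)"
  unfolding semilinear_def
proof (intro allI impI ballI conjI)
  fix \<kappa> f g c assume v: "valid \<kappa>" and f: "f \<in> space_of \<kappa>"
  obtain k j S where \<kappa>: "\<kappa> = (k, j, S)" by (cases \<kappa>)
  let ?a = "\<lambda>f. Arrow (S \<boxtimes> X j) (X k \<boxtimes> S) f"
  have S: "S \<in> Ob C" using v by (simp add: \<kappa> valid_def)
  have arr: "arr (?a f)" if "f \<in> space_of \<kappa>" for f using that S by (simp add: \<kappa> space_of_def)
  have t: "star_term CA dual R Rb \<kappa> f =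
     sgl (j, k, dual S) (mor (arrow_star A (dual S) S (X k) (X j) (ev S) (coev S) ((?a f)\<dagger>)))" for f
    by (simp add: star_term_def \<kappa> mor_star_arrow)
  note L = arrow_star_linear[OF A dp[OF S] X_Ob X_Ob arr_adj[OF arr[OF f]], of k j]
  have "?a (smul C c f) = c *\<^sub>s ?a f" by (simp add: ascale_def)
  then show "star_term CA dual R Rb \<kappa> (smul C c f) = rep_scale C (cnj c) (star_term CA dual R Rb \<kappa> f)"
    using L(1) arr[OF f] unfolding t by (simp add: ascale_rules)
  assume g: "g \<in> space_of \<kappa>"
  have "?a (f + g) = ?a f +\<^sub>a ?a g" by (simp add: aadd_def)
  then show "star_term CA dual R Rb \<kappa> (f + g) =
     star_term CA dual R Rb \<kappa> f + star_term CA dual R Rb \<kappa> g"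
    using L(2)[of "(?a g)\<dagger>"] arr[OF f] arr[OF g] unfolding t by (simp add: aadd_rules single_add)
qed

text \<open>
  A description of the involution for the associator \<open>A\<close> by strict adjoints: solutions with coevaluation \<open>B'\<close>
  of the strict conjugate equation, and natural endomorphisms \<open>\<theta>\<close>. For \<open>C\<close> these endomorphisms are
  identities, for the twisted category they are multiplication by scalars on homogeneous components.
\<close>

context
  fixes \<theta> B'
  assumes \<theta>: "\<And>k j S. S \<in> Ob C \<Longrightarrow> arr (\<theta> k j S) \<and> src (\<theta> k j S) = S \<and> tgt (\<theta> k j S) = S"
    and \<theta>_nat: "\<And>k j U. arr U \<Longrightarrow> \<theta> k j (tgt U) \<bullet> U = U \<bullet> \<theta> k j (src U)"
    and B': "\<And>S. S \<in> Ob C \<Longrightarrow> dual_pair (dual S) S (ev S) (B' S) \<and> zigzag S (ev S) (B' S)"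
    and arrow_star_\<theta>: "\<And>k j S G. \<lbrakk>S \<in> Ob C; arr G; src G = X k \<boxtimes> S; tgt G = S \<boxtimes> X j\<rbrakk> \<Longrightarrow>
       arrow_star A (dual S) S (X k) (X j) (ev S) (coev S) G =
       strict_star (dual S) S (X k) (X j) (ev S) (B' S) ((\<theta> k j S || \<I> (X j)) \<bullet> G)"
begin

text \<open>
  By naturality of \<open>\<theta>\<close>, the endomorphisms on both sides of the relation can be absorbed into one arrow \<open>G\<close>,
  and \<open>strict_star_slide\<close> applies to \<open>U\<dagger>\<close> and \<open>G\<close>.
\<close>

lemma star_term_slide:
  assumes U: "arr U" "arr F" "src F = tgt U \<boxtimes> X j" "tgt F = X k \<boxtimes> src U"
  shows "cls (star_term CA dual R Rb (k, j, src U) (mor (F \<bullet> (U || \<I> (X j))))) =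
    cls (star_term CA dual R Rb (k, j, tgt U) (mor ((\<I> (X k) || U) \<bullet> F)))"
proof -
  define S where "S = src U"
  define T where "T = tgt U"
  have o: "S \<in> Ob C" "T \<in> Ob C" "src U = S" "tgt U = T" using U by (simp_all add: S_def T_def)
  note \<theta>S = \<theta>[OF o(1), of k j] and \<theta>T = \<theta>[OF o(2), of k j]
  define G where "G = (\<theta> k j T || \<I> (X j)) \<bullet> F\<dagger>"
  have G: "arr G" "src G = X k \<boxtimes> S" "tgt G = T \<boxtimes> X j" using U o \<theta>T by (simp_all add: G_def)
  have 1: "(\<theta> k j S || \<I> (X j)) \<bullet> (F \<bullet> (U || \<I> (X j)))\<dagger> = (U\<dagger> || \<I> (X j)) \<bullet> G"
  proof -
    have "(\<theta> k j S || \<I> (X j)) \<bullet> (U\<dagger> || \<I> (X j)) = (U\<dagger> || \<I> (X j)) \<bullet> (\<theta> k j T || \<I> (X j))"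
      using \<theta>_nat[of "U\<dagger>" k j] U o \<theta>S \<theta>T by (simp add: interchange)
    from acomp_slide[OF this, of "F\<dagger>"] show ?thesis
      using U o \<theta>S \<theta>T by (simp add: G_def aadj_comp aadj_tens)
  qed
  have 2: "(\<theta> k j T || \<I> (X j)) \<bullet> ((\<I> (X k) || U) \<bullet> F)\<dagger> = G \<bullet> (\<I> (X k) || U\<dagger>)"
    using U o \<theta>T by (simp add: G_def aadj_comp aadj_tens acomp_assoc)
  obtain V H where V: "arr V" "src V = dual S" "tgt V = dual T" and H: "arr H" "src H = dual T \<boxtimes> X k" "tgt H = X j \<boxtimes> dual S"
    and s: "strict_star (dual S) S (X k) (X j) (ev S) (B' S) ((U\<dagger> || \<I> (X j)) \<bullet> G) = H \<bullet> (V || \<I> (X k))"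
     "strict_star (dual T) T (X k) (X j) (ev T) (B' T) (G \<bullet> (\<I> (X k) || U\<dagger>)) = (\<I> (X j) || V) \<bullet> H"
    using strict_star_slide[of "dual S" S "ev S" "B' S" "dual T" T "ev T" "B' T" "X k" "X j" "U\<dagger>" G]
      B'[OF o(1)] B'[OF o(2)] U o G by auto
  have t1: "star_term CA dual R Rb (k, j, src U) (mor (F \<bullet> (U || \<I> (X j)))) =
     sgl (j, k, src V) (mor (H \<bullet> (V || \<I> (X k))))"
    unfolding s(1)[symmetric] 1[symmetric] V(2) using U o
    by (subst star_term_arrow) (simp_all add: arrow_star_\<theta> del: sel_simps(3))
  have t2: "star_term CA dual R Rb (k, j, tgt U) (mor ((\<I> (X k) || U) \<bullet> F)) =
     sgl (j, k, tgt V) (mor ((\<I> (X j) || V) \<bullet> H))"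
    unfolding s(2)[symmetric] 2[symmetric] V(3) using U o
    by (subst star_term_arrow) (simp_all add: arrow_star_\<theta> del: sel_simps(3))
  show ?thesis unfolding t1 t2 by (rule class_slide) (use V H in simp_all)
qed

lemma annular_star_class:
  assumes F: "F \<in> annular_reps C X"
  shows "annular_star CA dual R Rb X (cls F) = cls (rep_star CA dual R Rb X F)"
proof -
  have mem: "H \<in> annular_reps C X" "cls H = cls F" if "H \<in> cls F" for H
    using reps.subspace_add[OF subspace_reps F, of "H - F"] that relations_reps
    by (auto simp: mem_class class_eq_iff)
  have self: "F \<in> cls F" using reps.subspace_0[OF subspace_relations] by (simp add: mem_class)
  have "cls (rep_star CA dual R Rb X H) = cls (rep_star CA dual R Rb X F)" if "H \<in> cls F" for H
    unfolding rep_star_alt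
    by (rule extend_class[OF star_term_semilinear star_term_slide mem(1)[OF that] F mem(2)[OF that]])
  then have "(\<Union>H\<in>cls F. {cls (rep_star CA dual R Rb X H)}) = {cls (rep_star CA dual R Rb X F)}"
    using self by blast
  then show ?thesis by (simp add: annular_star_def class_update[OF A refl])
qed

end

end

text \<open>
  Two solutions for the same object are compared by \<open>strict_star_slide\<close> with \<open>U\<close> the identity.
\<close>

lemma strict_star_class_unique:
  assumes "dual_pair Z S E B" "zigzag S E B" "dual_pair W S P D" "zigzag S P D"
    and G: "arr G" "src G = X k \<boxtimes> S" "tgt G = S \<boxtimes> X j"
  shows "cls (sgl (j, k, Z) (mor (strict_star Z S (X k) (X j) E B G))) = cls (sgl (j, k, W) (mor (strict_star W S (X k) (X j) P D G)))"
proof -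
  have S: "S \<in> Ob C" using assms(1) by (simp add: dual_pair_def)
  obtain V H where V: "arr V" "src V = Z" "tgt V = W" and H: "arr H" "src H = W \<boxtimes> X k" "tgt H = X j \<boxtimes> Z"
    and s: "strict_star Z S (X k) (X j) E B G = H \<bullet> (V || \<I> (X k))"
     "strict_star W S (X k) (X j) P D G = (\<I> (X j) || V) \<bullet> H"
    using strict_star_slide[OF assms(1-4) X_Ob X_Ob arr_id[OF S], of G k j] S G by auto
  show ?thesis unfolding s
    using class_slide[of V H k j] V H by (simp del: sel_simps(3))
qed

end

section \<open>Comparison of the two annular algebras\<close>

locale twisted_annular = strict_graded_category \<Gamma> C Gr + annular_family C X + three_cocycle \<Gamma> \<omega>
  for \<Gamma> :: "('g, 'z) monoid_scheme" and C :: "('o, 'm::ab_group_add) tensor_cat" (structure)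
    and Gr :: "'g \<Rightarrow> 'o set" and X :: "'j \<Rightarrow> 'o" and \<omega> +
  fixes deg :: "'j \<Rightarrow> 'g"
  assumes deg: "deg j \<in> carrier \<Gamma>" "has_degree C Gr (deg j) (X j)"
begin

abbreviation C' where "C' \<equiv> twisted_category \<Gamma> Gr \<omega> C"

lemma C_self: "C\<lparr>assoc := assoc C\<rparr> = C" by simp

lemmas mult_class = annular_mult_class[OF natural_assoc_assoc refl, unfolded C_self]
lemmas mult_class' = annular_mult_class[OF natural_assoc_twisted refl, folded twisted_category_update]

lemmas rep_mult_sum = rep_mult_alt[OF natural_assoc_assoc refl, unfolded C_self]
lemmas rep_mult_sum' = rep_mult_alt[OF natural_assoc_twisted refl, folded twisted_category_update]

definition homogeneous :: "'g \<times> 'g \<Rightarrow> ('j, 'o, 'm) annular_rep \<Rightarrow> bool" where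
  "homogeneous g F \<longleftrightarrow> F \<in> annular_reps C X \<and> (\<forall>(k, j, S)\<in>kys F. has_degree C Gr (fst g) S \<and>
      deg j = snd g \<and> deg k = adjoint_act \<Gamma> (fst g) (snd g))"

lemma fibreE:
  assumes "a \<in> fibre \<Gamma> C Gr I X deg g" obtains F where "a = cls F" "homogeneous g F"
  using assms unfolding fibre_def homogeneous_def by fastforce

lemma twisted_homogeneous:
  assumes X: "U \<in> Ob C" "V \<in> Ob C" "W \<in> Ob C"
    and d: "has_degree C Gr a U" "has_degree C Gr b V" "has_degree C Gr c W"
    and a: "a \<in> carrier \<Gamma>" "b \<in> carrier \<Gamma>" "c \<in> carrier \<Gamma>"
  shows "assoc_arr (twisted_assoc \<omega>) U V W = \<omega> a b c *\<^sub>s \<I> (U \<boxtimes> (V \<boxtimes> W))"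
  using twisted_aproj[OF X a, of \<omega>] arr_twisted[OF X, of \<omega>] X
    has_degree_aproj[OF X(1) d(1) a(1,1)] has_degree_aproj[OF X(2) d(2) a(2,2)] has_degree_aproj[OF X(3) d(3) a(3,3)]
  by simp

lemma mor_mult_twisted:
  assumes S: "S \<in> Ob C" "has_degree C Gr s S" "s \<in> carrier \<Gamma>" and T: "T \<in> Ob C" "has_degree C Gr t T" "t \<in> carrier \<Gamma>"
    and f: "f \<in> Hom C (S \<boxtimes> X k) (X m \<boxtimes> S)" "g \<in> Hom C (T \<boxtimes> X j) (X k \<boxtimes> T)"
  shows "mor_mult C' X m k j S T f g =
    smul C (\<omega> (deg m) s t * cnj (\<omega> s (deg k) t) * \<omega> s t (deg j)) (mor_mult C X m k j S T f g)"
proof -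
  let ?F = "Arrow (S \<boxtimes> X k) (X m \<boxtimes> S) f" and ?G = "Arrow (T \<boxtimes> X j) (X k \<boxtimes> T) g"
  have "arrow_mult (twisted_assoc \<omega>) (X m) (X k) (X j) S T ?F ?G =
    (\<omega> (deg m) s t * cnj (\<omega> s (deg k) t) * \<omega> s t (deg j)) *\<^sub>s arrow_mult (assoc C) (X m) (X k) (X j) S T ?F ?G"
    using S T f deg twisted_homogeneous[of "X m" S T "deg m" s t] twisted_homogeneous[of S "X k" T s "deg k" t]
      twisted_homogeneous[of S T "X j" s t "deg j"]
    unfolding arrow_mult_def by (simp add: assoc_arr_assoc ascale_rules mult_ac)
  then show ?thesis
    using mor_mult_arrow[of "assoc C" X m k j S T f g] by (simp add: twisted_category_update mor_mult_arrow)
qed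

lemma rep_mult_twisted:
  assumes g: "g1 \<in> arrows \<Gamma>" "g2 \<in> arrows \<Gamma>" and F: "homogeneous g1 F" "homogeneous g2 G"
  shows "rep_mult C' X F G = rep_scale C (transgression \<Gamma> \<omega> g1 g2) (rep_mult C X F G)"
proof -
  obtain s1 \<gamma>1 s2 \<gamma>2 where e: "g1 = (s1, \<gamma>1)" "g2 = (s2, \<gamma>2)" by (cases g1, cases g2)
  have c: "s1 \<in> carrier \<Gamma>" "s2 \<in> carrier \<Gamma>" using g by (simp_all add: e arrows_def)
  have "mult_term C' \<kappa> (lk F \<kappa>) \<mu> (lk G \<mu>) = rep_scale C (transgression \<Gamma> \<omega> g1 g2) (mult_term C \<kappa> (lk F \<kappa>) \<mu> (lk G \<mu>))"
    if "\<kappa> \<in> kys F" "\<mu> \<in> kys G" for \<kappa> \<mu>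
  proof -
    obtain m k S k' j T where \<kappa>: "\<kappa> = (m, k, S)" "\<mu> = (k', j, T)" by (cases \<kappa>, cases \<mu>) auto
    have h: "has_degree C Gr s1 S" "deg k = \<gamma>1" "deg m = adjoint_act \<Gamma> s1 \<gamma>1"
      "has_degree C Gr s2 T" "deg j = \<gamma>2" "deg k' = adjoint_act \<Gamma> s2 \<gamma>2"
      using F that by (auto simp: homogeneous_def \<kappa> e)
    have t: "S \<in> Ob C" "T \<in> Ob C" "lk F \<kappa> \<in> Hom C (S \<boxtimes> X k) (X m \<boxtimes> S)" "lk G \<mu> \<in> Hom C (T \<boxtimes> X j) (X k' \<boxtimes> T)"
      using F that by (auto simp: homogeneous_def annular_reps_iff \<kappa> valid_def space_of_def)
    show ?thesis
    proof (cases "k = k'")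
      case True
      then show ?thesis
        using mor_mult_twisted[OF t(1) h(1) c(1) t(2) h(4) c(2) t(3) t(4)[folded True]] h
        by (simp add: \<kappa> e mult_term_def adjoint_act_def)
    qed (simp add: \<kappa> mult_term_def)
  qed
  then show ?thesis
    by (simp add: rep_mult_sum rep_mult_sum' reps.scale_sum_right)
qed

lemma rep_mult_noncomposable:
  assumes F: "homogeneous g1 F" "homogeneous g2 G" and n: "\<not> composable \<Gamma> g1 g2"
  shows "rep_mult E X F G = 0"
proof -
  have "k \<noteq> k'" if "(m, k, S) \<in> kys F" "(k', j, T) \<in> kys G" for m k S k' j T
    using that F n by (fastforce simp: homogeneous_def composable_def)
  then show ?thesis unfolding rep_mult_def by (intro sum.neutral) (auto intro!: sum.neutral)
qed

context
  fixes dual dual' R Rb R' Rb'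
  assumes std: "standard_choice C dual R Rb" and std': "standard_choice C' dual' R' Rb'"
begin

abbreviation ev0 where "ev0 S \<equiv> (Arrow (unito C) (dual S \<boxtimes> S) (R S))\<dagger>"
abbreviation coev0 where "coev0 S \<equiv> Arrow (unito C) (S \<boxtimes> dual S) (Rb S)"
abbreviation ev1 where "ev1 S \<equiv> (Arrow (unito C) (dual' S \<boxtimes> S) (R' S))\<dagger>"
abbreviation coev1 where "coev1 S \<equiv> Arrow (unito C) (S \<boxtimes> dual' S) (Rb' S)"
abbreviation B1 where "B1 S \<equiv> (degree_scalar (\<lambda>a. \<omega> a (inv\<^sub>\<Gamma> a) a) S || \<I> (dual' S)) \<bullet> coev1 S"

lemma solution:
  assumes S: "S \<in> Ob C" shows "dual_pair (dual S) S (ev0 S) (coev0 S) \<and> zigzag S (ev0 S) (coev0 S)"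
proof -
  have c: "conj_solution C S (dual S) (R S) (Rb S)"
    using std S by (simp add: standard_choice_def standard_solution_def)
  then have d: "dual_pair (dual S) S (ev0 S) (coev0 S)"
    using S by (simp add: conj_solution_def dual_pair_def)
  have "(\<I> S || ev0 S) \<bullet> assoc_arr (assoc C) S (dual S) S \<bullet> (coev0 S || \<I> S) = \<I> S"
    using c S by (intro arrow_eqI) (simp_all add: conj_solution_def)
  then show ?thesis using d dual_pairD[OF d] by (simp add: zigzag_def assoc_arr_assoc)
qed

lemma solution':
  assumes S: "S \<in> Ob C"
  shows "dual_pair (dual' S) S (ev1 S) (coev1 S)" and "dual_pair (dual' S) S (ev1 S) (B1 S) \<and> zigzag S (ev1 S) (B1 S)"
proof -
  have c: "conj_solution C' S (dual' S) (R' S) (Rb' S)"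
    using std' S by (simp add: standard_choice_def standard_solution_def twisted_category_update)
  then show d: "dual_pair (dual' S) S (ev1 S) (coev1 S)"
    using S by (simp add: conj_solution_def dual_pair_def twisted_category_update)
  have "(\<I> S || ev1 S) \<bullet> assoc_arr (twisted_assoc \<omega>) S (dual' S) S \<bullet> (coev1 S || \<I> S) = \<I> S"
    using c S by (intro arrow_eqI) (simp_all add: conj_solution_def twisted_category_update)
  from zigzag_twist[OF d this] show "dual_pair (dual' S) S (ev1 S) (B1 S) \<and> zigzag S (ev1 S) (B1 S)"
    using d by (simp add: dual_pair_def)
qed

lemma star_class:
  assumes "F \<in> annular_reps C X"
  shows "annular_star C dual R Rb X (cls F) = cls (rep_star C dual R Rb X F)"
proof -
  have "annular_star (C\<lparr>assoc := assoc C\<rparr>) dual R Rb X (cls F) = cls (rep_star (C\<lparr>assoc := assoc C\<rparr>) dual R Rb X F)"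
    by (rule annular_star_class[where \<theta> = "\<lambda>k j. \<I>" and B' = coev0])
      (use assms solution in \<open>auto simp: natural_assoc_assoc arrow_star_strict\<close>)
  then show ?thesis by simp
qed

text \<open>
  Here \<open>a\<close> and \<open>b\<close> are the degrees of \<open>S\<close> in the source \<open>S \<boxtimes> X j\<close> and in the target \<open>X k \<boxtimes> S\<close> of a
  morphism; the total degrees agree, which determines \<open>b\<close>.
\<close>

definition twist_fun :: "'j \<Rightarrow> 'j \<Rightarrow> 'g \<Rightarrow> complex" where
  "twist_fun k j a = (let b = inv\<^sub>\<Gamma> (deg k) \<otimes>\<^sub>\<Gamma> (a \<otimes>\<^sub>\<Gamma> deg j) in
     cnj (\<omega> (inv\<^sub>\<Gamma> a) a (deg j) * \<omega> (inv\<^sub>\<Gamma> a) (deg k \<otimes>\<^sub>\<Gamma> b) (inv\<^sub>\<Gamma> b) * \<omega> (deg k) b (inv\<^sub>\<Gamma> b) * \<omega> b (inv\<^sub>\<Gamma> b) b))"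

lemma arrow_star_twist_fun:
  assumes "S \<in> Ob C" "arr G" "src G = X k \<boxtimes> S" "tgt G = S \<boxtimes> X j"
  shows "arrow_star (twisted_assoc \<omega>) (dual' S) S (X k) (X j) (ev1 S) (coev1 S) G =
       strict_star (dual' S) S (X k) (X j) (ev1 S) (B1 S) ((degree_scalar (twist_fun k j) S || \<I> (X j)) \<bullet> G)"
  using arrow_star_twisted[OF solution'(1)[OF assms(1)] X_Ob X_Ob deg(2) deg(2) deg(1) deg(1) assms(2-4) \<omega>]
  unfolding twist_fun_def Let_def .

lemma star_class':
  assumes "F \<in> annular_reps C X"
  shows "annular_star C' dual' R' Rb' X (cls F) = cls (rep_star C' dual' R' Rb' X F)"
  unfolding twisted_category_update
  by (rule annular_star_class[where \<theta> = "\<lambda>k j. degree_scalar (twist_fun k j)" and B' = B1])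
    (use assms solution' in \<open>auto simp: natural_assoc_twisted arrow_star_twist_fun degree_scalar_natural\<close>)

text \<open>
  On a fibre \<open>a = b = s\<close>, and the scalar is the one of \<open>transgression_inverse\<close>.
\<close>

lemma twist_fun_homogeneous:
  assumes "s \<in> carrier \<Gamma>" "deg k = adjoint_act \<Gamma> s (deg j)"
  shows "twist_fun k j s = cnj (transgression \<Gamma> \<omega> (arrow_inv \<Gamma> (s, deg j)) (s, deg j))"
proof -
  have c: "deg j \<in> carrier \<Gamma>" "s \<in> carrier \<Gamma>" using deg assms by auto
  have b: "inv\<^sub>\<Gamma> (deg k) \<otimes>\<^sub>\<Gamma> (s \<otimes>\<^sub>\<Gamma> deg j) = s"
    using c by (simp add: assms(2) adjoint_act_def \<Gamma>.m_assoc \<Gamma>.inv_solve_left')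
  note t = transgression_inverse[OF c(2,1), folded assms(2)]
  show ?thesis
    by (simp only: twist_fun_def Let_def b arrow_inv_def fst_conv snd_conv assms(2)[symmetric] t)
qed

text \<open>
  On each morphism space, the twisted adjoint is a scalar multiple of a strict adjoint that is formed with
  another dual object; passing to classes removes the dependence on the dual.
\<close>

lemma rep_star_twisted:
  assumes g: "g \<in> arrows \<Gamma>" and F: "homogeneous g F"
  shows "cls (rep_star C' dual' R' Rb' X F) =
    cls (rep_scale C (cnj (transgression \<Gamma> \<omega> (arrow_inv \<Gamma> g) g)) (rep_star C dual R Rb X F))"
  unfolding rep_star_alt extend_def reps.scale_sum_right
proof (rule class_sum)
  fix \<kappa> assume K: "\<kappa> \<in> kys F"
  obtain k j S where \<kappa>: "\<kappa> = (k, j, S)" by (cases \<kappa>)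
  obtain s \<gamma> where e: "g = (s, \<gamma>)" by (cases g)
  have s: "s \<in> carrier \<Gamma>" using g by (simp add: e arrows_def)
  have h: "has_degree C Gr s S" "deg j = \<gamma>" "deg k = adjoint_act \<Gamma> s \<gamma>"
    using F K by (auto simp: homogeneous_def \<kappa> e)
  have t: "S \<in> Ob C" "lk F \<kappa> \<in> Hom C (S \<boxtimes> X j) (X k \<boxtimes> S)"
    using F K by (auto simp: homogeneous_def annular_reps_iff \<kappa> valid_def space_of_def)
  define G where "G = (Arrow (S \<boxtimes> X j) (X k \<boxtimes> S) (lk F \<kappa>))\<dagger>"
  have G: "arr G" "src G = X k \<boxtimes> S" "tgt G = S \<boxtimes> X j" using t by (simp_all add: G_def)
  define c where "c = cnj (transgression \<Gamma> \<omega> (arrow_inv \<Gamma> g) g)"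
  have c: "degree_scalar (twist_fun k j) S = c *\<^sub>s \<I> S"
    using degree_scalar_has_degree[OF t(1) h(1) s] twist_fun_homogeneous[OF s, of k j] h by (simp add: c_def e)
  note sol = solution[OF t(1)] and sol' = solution'[OF t(1)]
  have "star_term C' dual' R' Rb' \<kappa> (lk F \<kappa>) =
    sgl (j, k, dual' S) (mor (arrow_star (twisted_assoc \<omega>) (dual' S) S (X k) (X j) (ev1 S) (coev1 S) G))"
    by (simp add: star_term_def \<kappa> mor_star_arrow twisted_category_update G_def)
  also have "\<dots> = sgl (j, k, dual' S) (mor (strict_star (dual' S) S (X k) (X j) (ev1 S) (B1 S) (c *\<^sub>s G)))"
    using arrow_star_twist_fun[OF t(1) G] c G t by (simp add: ascale_rules)
  also have "cls \<dots> = cls (sgl (j, k, dual S) (mor (strict_star (dual S) S (X k) (X j) (ev0 S) (coev0 S) (c *\<^sub>s G))))"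
    by (rule strict_star_class_unique) (use sol sol' G in simp_all)
  also have "strict_star (dual S) S (X k) (X j) (ev0 S) (coev0 S) (c *\<^sub>s G) = c *\<^sub>s arrow_star (assoc C) (dual S) S (X k) (X j) (ev0 S) (coev0 S) G"
    using arrow_star_linear(1)[OF natural_assoc_assoc _ X_Ob X_Ob G, of "dual S" "ev0 S" "coev0 S" c]
      arrow_star_strict[of "dual S" S "ev0 S" "coev0 S" "X k" "X j"] sol G by simp
  also have "sgl (j, k, dual S) (mor \<dots>) = rep_scale C c (star_term C dual R Rb \<kappa> (lk F \<kappa>))"
    using mor_star_arrow[of "assoc C" dual R Rb X k j S "lk F \<kappa>"] by (simp add: star_term_def \<kappa> G_def)
  finally show "cls (star_term C' dual' R' Rb' \<kappa> (lk F \<kappa>)) = cls (rep_scale C (cnj (transgression \<Gamma> \<omega> (arrow_inv \<Gamma> g) g)) (star_term C dual R Rb \<kappa> (lk F \<kappa>)))"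
    by (simp add: c_def)
qed

end

end

theorem theorem4p8:
  fixes \<Gamma> :: "('g, 'z) monoid_scheme"
    and C :: "('o, 'm::ab_group_add) tensor_cat"
    and Gr :: "'g \<Rightarrow> 'o set"
    and \<omega> :: "'g \<Rightarrow> 'g \<Rightarrow> 'g \<Rightarrow> complex"
    and I :: "'o set"
    and X :: "'j \<Rightarrow> 'o"
    and deg :: "'j \<Rightarrow> 'g"
    and dual dual' :: "'o \<Rightarrow> 'o"
    and R Rb R' Rb' :: "'o \<Rightarrow> 'm"
  assumes "group \<Gamma>"
    and "cstar_tensor_category C"
    and "strict_cat C"
    and "rigid_cat C"
    and "graded_category \<Gamma> C Gr"
    and "normalized_3cocycle \<Gamma> \<omega>"
    and "irr_representatives C I"
    and "full_family C I X"
    and adapted: "\<And>j. deg j \<in> carrier \<Gamma> \<and> has_degree C Gr (deg j) (X j)"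
    and "standard_choice C dual R Rb"
    and "standard_choice (twisted_category \<Gamma> Gr \<omega> C) dual' R' Rb'"
  shows "let C\<omega> = twisted_category \<Gamma> Gr \<omega> C;
             \<psi> = transgression \<Gamma> \<omega>;
             A = fibre \<Gamma> C Gr I X deg;
             zero = annular_class C X 0;
             scale = annular_scale C X;
             mult = annular_mult C X;
             star = annular_star C dual R Rb X;
             mult' = annular_mult C\<omega> X;
             star' = annular_star C\<omega> dual' R' Rb' X
         in annular_space C\<omega> X = annular_space C X \<and>
            normalized_2cocycle \<Gamma> \<psi> \<and>
            (\<forall>g\<^sub>1\<in>arrows \<Gamma>. \<forall>g\<^sub>2\<in>arrows \<Gamma>. \<forall>a\<in>A g\<^sub>1. \<forall>b\<in>A g\<^sub>2.
               if composable \<Gamma> g\<^sub>1 g\<^sub>2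
               then mult' a b = scale (\<psi> g\<^sub>1 g\<^sub>2) (mult a b)
               else mult' a b = zero \<and> mult a b = zero) \<and>
            (\<forall>g\<in>arrows \<Gamma>. \<forall>a\<in>A g.
               star' a = scale (cnj (\<psi> (arrow_inv \<Gamma> g) g)) (star a))"
proof -
  interpret group \<Gamma> by fact
  interpret cstar_tensor_category C by fact
  interpret graded_category \<Gamma> C Gr by fact
  interpret twisted_annular \<Gamma> C Gr X \<omega> deg
    by unfold_locales (use assms in \<open>auto simp: full_family_def\<close>)
  note std = \<open>standard_choice C dual R Rb\<close> \<open>standard_choice C' dual' R' Rb'\<close>
  have "annular_reps C' X = annular_reps C X"
    by (simp add: annular_reps_def twisted_category_update)
  then have "annular_space C' X = annular_space C X"
    by (simp add: annular_space_def class_update[OF natural_assoc_twisted twisted_category_update])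
  moreover have "if composable \<Gamma> g1 g2
     then annular_mult C' X a b = annular_scale C X (transgression \<Gamma> \<omega> g1 g2) (annular_mult C X a b)
     else annular_mult C' X a b = cls 0 \<and> annular_mult C X a b = cls 0"
    if g: "g1 \<in> arrows \<Gamma>" "g2 \<in> arrows \<Gamma>" and ab: "a \<in> fibre \<Gamma> C Gr I X deg g1" "b \<in> fibre \<Gamma> C Gr I X deg g2" for g1 g2 a b
  proof -
    obtain F G where F: "a = cls F" "homogeneous g1 F" and G: "b = cls G" "homogeneous g2 G"
      using ab by (elim fibreE)
    then have r: "F \<in> annular_reps C X" "G \<in> annular_reps C X" by (simp_all add: homogeneous_def)
    show ?thesis
      using rep_mult_noncomposable[OF F(2) G(2)] rep_mult_twisted[OF g F(2) G(2)]
      by (simp add: F(1) G(1) mult_class[OF r] mult_class'[OF r] annular_scale_class)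
  qed
  moreover have "annular_star C' dual' R' Rb' X a =
      annular_scale C X (cnj (transgression \<Gamma> \<omega> (arrow_inv \<Gamma> g) g)) (annular_star C dual R Rb X a)"
    if g: "g \<in> arrows \<Gamma>" and a: "a \<in> fibre \<Gamma> C Gr I X deg g" for g a
  proof -
    obtain F where F: "a = cls F" "homogeneous g F" using a by (elim fibreE)
    then have r: "F \<in> annular_reps C X" by (simp add: homogeneous_def)
    show ?thesis
      using rep_star_twisted[OF std g F(2)]
      by (simp add: F(1) star_class[OF std r] star_class'[OF std r] annular_scale_class)
  qed
  ultimately show ?thesis
    unfolding Let_def using transgression_cocycle by blast
qed

end
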